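(* Let $\Delta=\{\delta_1,\ldots,\delta_m\}$ be a finite set of commuting derivations. Let $K$ be a $\Delta$-field of characteristic zero whose field of constants $K^\Delta$ is algebraically closed, and let $L|K$ be a finitely $\Delta$-generated extension of $\Delta$-fields with $L^\Delta=K^\Delta$. Then $L|K$ is a Picard-Vessiot extension if and only if $L|K$ is $\Delta$-normal.
   Context: All rings are commutative. A $\Delta$-ring (field, algebra) is a ring (field, algebra) equipped with commuting derivations $\delta_1,\ldots,\delta_m$, compatible with the structure morphism in the case of algebras; $\Delta$-morphisms are ring morphisms commuting with all $\delta_i$. For a $\Delta$-ring $R$, $R^\Delta=\{r\in R\mid \delta_i(r)=0,\ i=1,\ldots,m\}$ denotes its constants. $L|K$ is finitely $\Delta$-generated if there is a finite subset of $L$ such that $L$ is the smallest $\Delta$-subfield of $L$ containing $K$ and this subset. If $S,T$ are subrings of a ring $R$, then $S\cdot T=\{\sum_i s_it_i\mid s_i\in S,\ t_i\in T\}$ (finite sums) and $ST=\{\frac{r}{r'}\mid r,r'\in S\cdot T,\ r'\in R^\times\}\subset R$, the smallest subring of $R$ containing $S$ and $T$ and closed under taking inverses (of elements that are units in $R$). Let $L|K$ be an extension of $\Delta$-fields and $\tau_s,\tau_t\colon L\to R$ a pair of $K$-$\Delta$-morphisms into some $K$-$\Delta$-algebra $R$. $L|K$ is $\Delta$-normal with respect to $(\tau_s,\tau_t)$ if $\tau_t(L)\subset\tau_s(L)R^\Delta$, where $\tau_s(L)R^\Delta=\{\frac{r}{r'}\mid r,r'\in \tau_s(L)\cdot R^\Delta,\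 r'\in R^\times\}$ is the subring $ST$ of $R$ formed with $S=\tau_s(L)$ and $T=R^\Delta$. $L|K$ is $\Delta$-normal if it is $\Delta$-normal with respect to every such pair, for every $K$-$\Delta$-algebra $R$. $L|K$ is a Picard-Vessiot extension if $L^\Delta=K^\Delta$ and there exist $n\ge 1$, matrices $A_1,\ldots,A_m\in K^{n\times n}$ satisfying the integrability conditions $\delta_i(A_j)-\delta_j(A_i)=A_iA_j-A_jA_i$ for $1\le i,j\le m$, and $Y\in\mathrm{GL}_n(L)$ with $\delta_i(Y)=A_iY$ for $i=1,\ldots,m$ and $L=K(Y)$, i.e. $L$ is generated as a field over $K$ by the entries of $Y$. *)

theory Defs
  imports "HOL-Algebra.Algebra"
begin

text \<open>
  The derivations \<open>\<delta>\<^sub>1, \<dots>, \<delta>\<^sub>m\<close> are indexed by \<open>i < m\<close>. They are total functions on the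
  ambient type, and only their values on the carrier matter.
\<close>

definition derivation :: "('a, 'b) ring_scheme \<Rightarrow> ('a \<Rightarrow> 'a) \<Rightarrow> bool" where
  "derivation R \<delta> \<longleftrightarrow>
     \<delta> \<in> carrier R \<rightarrow> carrier R \<and>
     (\<forall>x \<in> carrier R. \<forall>y \<in> carrier R.
        \<delta> (x \<oplus>\<^bsub>R\<^esub> y) = \<delta> x \<oplus>\<^bsub>R\<^esub> \<delta> y \<and>
        \<delta> (x \<otimes>\<^bsub>R\<^esub> y) = \<delta> x \<otimes>\<^bsub>R\<^esub> y \<oplus>\<^bsub>R\<^esub> x \<otimes>\<^bsub>R\<^esub> \<delta> y)"

locale delta_ring = cring R for R (structure) +
  fixes m :: nat and \<delta> :: "nat \<Rightarrow> 'a \<Rightarrow> 'a"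
  assumes derivation: "i < m \<Longrightarrow> derivation R (\<delta> i)"
    and derivations_commute:
      "\<lbrakk> i < m; j < m; x \<in> carrier R \<rbrakk> \<Longrightarrow> \<delta> i (\<delta> j x) = \<delta> j (\<delta> i x)"

locale delta_field = delta_ring R m \<delta> + field R for R (structure) and m \<delta>

definition constants :: "('a, 'b) ring_scheme \<Rightarrow> nat \<Rightarrow> (nat \<Rightarrow> 'a \<Rightarrow> 'a) \<Rightarrow> 'a set" where
  "constants R m \<delta> = {r \<in> carrier R. \<forall>i<m. \<delta> i r = \<zero>\<^bsub>R\<^esub>}"

text \<open>
  An extension \<open>L|K\<close> of \<open>\<Delta>\<close>-fields is a \<open>\<Delta>\<close>-field \<open>L\<close> with a \<open>\<Delta>\<close>-subfield \<open>K\<close>. As a ring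
  in its own right \<open>K\<close> is \<open>L\<lparr>carrier := K\<rparr>\<close>, with the same functions \<open>\<delta> i\<close>.
\<close>

definition delta_subfield ::
    "'a set \<Rightarrow> ('a, 'b) ring_scheme \<Rightarrow> nat \<Rightarrow> (nat \<Rightarrow> 'a \<Rightarrow> 'a) \<Rightarrow> bool" where
  "delta_subfield K L m \<delta> \<longleftrightarrow> subfield K L \<and> (\<forall>i<m. \<forall>x \<in> K. \<delta> i x \<in> K)"

definition char_zero :: "('a, 'b) ring_scheme \<Rightarrow> bool" where
  "char_zero R \<longleftrightarrow> (\<forall>n::nat. n > 0 \<longrightarrow> [n] \<cdot>\<^bsub>R\<^esub> \<one>\<^bsub>R\<^esub> \<noteq> \<zero>\<^bsub>R\<^esub>)"

definition finitely_delta_generated ::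
    "('a, 'b) ring_scheme \<Rightarrow> 'a set \<Rightarrow> nat \<Rightarrow> (nat \<Rightarrow> 'a \<Rightarrow> 'a) \<Rightarrow> bool" where
  "finitely_delta_generated L K m \<delta> \<longleftrightarrow>
     (\<exists>S. finite S \<and> S \<subseteq> carrier L \<and>
          carrier L = \<Inter> {F. delta_subfield F L m \<delta> \<and> K \<union> S \<subseteq> F})"

definition delta_hom ::
    "nat \<Rightarrow> ('a, 'b) ring_scheme \<Rightarrow> (nat \<Rightarrow> 'a \<Rightarrow> 'a) \<Rightarrow>
     ('c, 'd) ring_scheme \<Rightarrow> (nat \<Rightarrow> 'c \<Rightarrow> 'c) \<Rightarrow> ('a \<Rightarrow> 'c) set" where
  "delta_hom m R \<delta> S \<epsilon> =
     {h \<in> ring_hom R S. \<forall>i<m. \<forall>x \<in> carrier R. h (\<delta> i x) = \<epsilon> i (h x)}"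

text \<open>\<open>S \<cdot> T\<close>, the set of finite sums \<open>\<Sum> s\<^sub>i t\<^sub>i\<close>\<close>

definition subring_prod :: "('a, 'b) ring_scheme \<Rightarrow> 'a set \<Rightarrow> 'a set \<Rightarrow> 'a set" where
  "subring_prod R S T =
     {\<Oplus>\<^bsub>R\<^esub>i \<in> {..<k}. s i \<otimes>\<^bsub>R\<^esub> t i | (k::nat) s t. s \<in> {..<k} \<rightarrow> S \<and> t \<in> {..<k} \<rightarrow> T}"

text \<open>\<open>S T\<close>, the set of fractions of \<open>S \<cdot> T\<close> whose denominator is a unit of the ambient ring \<open>R\<close>\<close>

definition subring_compositum :: "('a, 'b) ring_scheme \<Rightarrow> 'a set \<Rightarrow> 'a set \<Rightarrow> 'a set" where
  "subring_compositum R S T =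
     {r \<otimes>\<^bsub>R\<^esub> inv\<^bsub>R\<^esub> r' | r r'.
        r \<in> subring_prod R S T \<and> r' \<in> subring_prod R S T \<and> r' \<in> Units R}"

definition delta_normal_wrt ::
    "('a, 'b) ring_scheme \<Rightarrow> nat \<Rightarrow> ('c, 'd) ring_scheme \<Rightarrow> (nat \<Rightarrow> 'c \<Rightarrow> 'c) \<Rightarrow>
     ('a \<Rightarrow> 'c) \<Rightarrow> ('a \<Rightarrow> 'c) \<Rightarrow> bool" where
  "delta_normal_wrt L m R \<epsilon> \<tau>\<^sub>s \<tau>\<^sub>t \<longleftrightarrow>
     \<tau>\<^sub>t ` carrier L \<subseteq> subring_compositum R (\<tau>\<^sub>s ` carrier L) (constants R m \<epsilon>)"

text \<open>
  \<open>\<Delta>\<close>-normality quantifies over all \<open>K\<close>-\<open>\<Delta>\<close>-algebras \<open>R\<close>. HOL cannot quantify over types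
  inside a formula, so the type \<open>'r\<close> containing the carrier of \<open>R\<close> is a parameter. The
  structure morphism of the algebra is \<open>\<sigma>\<close>.

  The choice \<open>'r = 'a\<close>, the type containing the carrier of \<open>L\<close>, already captures the notion
  in characteristic zero. If normality fails for some \<open>R\<close>, \<open>\<tau>\<^sub>s\<close>, \<open>\<tau>\<^sub>t\<close>, then it fails for the
  \<open>\<Delta>\<close>-subring of \<open>R\<close> generated by \<open>\<tau>\<^sub>s(L)\<close> and \<open>\<tau>\<^sub>t(L)\<close>, which has no more constants and no
  more units than \<open>R\<close>. The cardinality of this subring is at most that of the infinite set
  \<open>carrier L\<close>, so it is isomorphic to a ring with carrier in \<open>'a\<close>.
\<close>

definition delta_normal ::
    "'r itself \<Rightarrow> ('a, 'b) ring_scheme \<Rightarrow> 'a set \<Rightarrow> nat \<Rightarrow> (nat \<Rightarrow> 'a \<Rightarrow> 'a) \<Rightarrow> bool" where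
  "delta_normal TYPE('r) L K m \<delta> \<longleftrightarrow>
     (\<forall>(R :: 'r ring) \<epsilon> \<sigma> \<tau>\<^sub>s \<tau>\<^sub>t.
        delta_ring R m \<epsilon> \<and>
        \<sigma> \<in> delta_hom m (L\<lparr>carrier := K\<rparr>) \<delta> R \<epsilon> \<and>
        \<tau>\<^sub>s \<in> delta_hom m L \<delta> R \<epsilon> \<and> (\<forall>x \<in> K. \<tau>\<^sub>s x = \<sigma> x) \<and>
        \<tau>\<^sub>t \<in> delta_hom m L \<delta> R \<epsilon> \<and> (\<forall>x \<in> K. \<tau>\<^sub>t x = \<sigma> x)
        \<longrightarrow> delta_normal_wrt L m R \<epsilon> \<tau>\<^sub>s \<tau>\<^sub>t)"

text \<open>
  An \<open>n \<times> n\<close> matrix is a function of the row and column indices \<open>r, c < n\<close>. Its values at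
  other indices are irrelevant.
\<close>

definition matrices :: "nat \<Rightarrow> 'a set \<Rightarrow> (nat \<Rightarrow> nat \<Rightarrow> 'a) set" where
  "matrices n S = {A. \<forall>r<n. \<forall>c<n. A r c \<in> S}"

definition mat_mult ::
    "('a, 'b) ring_scheme \<Rightarrow> nat \<Rightarrow> (nat \<Rightarrow> nat \<Rightarrow> 'a) \<Rightarrow> (nat \<Rightarrow> nat \<Rightarrow> 'a) \<Rightarrow> nat \<Rightarrow> nat \<Rightarrow> 'a" where
  "mat_mult R n A B = (\<lambda>r c. \<Oplus>\<^bsub>R\<^esub>k \<in> {..<n}. A r k \<otimes>\<^bsub>R\<^esub> B k c)"

definition GL :: "nat \<Rightarrow> ('a, 'b) ring_scheme \<Rightarrow> (nat \<Rightarrow> nat \<Rightarrow> 'a) set" where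
  "GL n R =
     {Y \<in> matrices n (carrier R). \<exists>Z \<in> matrices n (carrier R). \<forall>r<n. \<forall>c<n.
        mat_mult R n Y Z r c = (if r = c then \<one>\<^bsub>R\<^esub> else \<zero>\<^bsub>R\<^esub>) \<and>
        mat_mult R n Z Y r c = (if r = c then \<one>\<^bsub>R\<^esub> else \<zero>\<^bsub>R\<^esub>)}"

definition integrable_system ::
    "('a, 'b) ring_scheme \<Rightarrow> nat \<Rightarrow> (nat \<Rightarrow> 'a \<Rightarrow> 'a) \<Rightarrow> nat \<Rightarrow> (nat \<Rightarrow> nat \<Rightarrow> nat \<Rightarrow> 'a) \<Rightarrow> bool" where
  "integrable_system R m \<delta> n A \<longleftrightarrow>
     (\<forall>i<m. \<forall>j<m. \<forall>r<n. \<forall>c<n.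
        \<delta> i (A j r c) \<ominus>\<^bsub>R\<^esub> \<delta> j (A i r c) =
        mat_mult R n (A i) (A j) r c \<ominus>\<^bsub>R\<^esub> mat_mult R n (A j) (A i) r c)"

definition picard_vessiot ::
    "('a, 'b) ring_scheme \<Rightarrow> 'a set \<Rightarrow> nat \<Rightarrow> (nat \<Rightarrow> 'a \<Rightarrow> 'a) \<Rightarrow> bool" where
  "picard_vessiot L K m \<delta> \<longleftrightarrow>
     constants L m \<delta> = constants (L\<lparr>carrier := K\<rparr>) m \<delta> \<and>
     (\<exists>(n::nat) A Y.
        n \<ge> 1 \<and>
        (\<forall>i<m. A i \<in> matrices n K) \<and>
        integrable_system L m \<delta> n A \<and>
        Y \<in> GL n L \<and>
        (\<forall>i<m. \<forall>r<n. \<forall>c<n. \<delta> i (Y r c) = mat_mult L n (A i) Y r c) \<and>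
        carrier L = generate_field L (K \<union> {Y r c | r c. r < n \<and> c < n}))"

end

theory Submission
  imports Defs
begin

text \<open>
  If \<open>Y\<close> is a fundamental matrix of \<open>L|K\<close>, then \<open>\<tau>\<^sub>s(Y)\<close> and \<open>\<tau>\<^sub>t(Y)\<close> solve the same system over \<open>R\<close>,
  so they differ by a matrix of constants.

  Conversely, apply normality to \<open>R = L \<otimes>\<^sub>K L\<close>, with \<open>D\<close> the constants of \<open>R\<close>. If \<open>\<Sum> a\<^sub>i \<otimes> b\<^sub>i \<in> D\<close>
  has linearly independent \<open>b\<^sub>i\<close>, then the \<open>a\<^sub>i\<close> span a \<open>\<Delta>\<close>-stable \<open>K\<close>-space, so
  \<open>(1 \<otimes> L) \<cdot> D \<subseteq> T \<otimes> L\<close> where \<open>T\<close> is the union of the finite-dimensional \<open>\<Delta>\<close>-stable subspaces of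
  \<open>L\<close>. Comparing coefficients in \<open>(a \<otimes> 1) r' = r\<close> gives \<open>L = Frac T\<close>, and finite generation gives one such
  subspace \<open>V\<close> with \<open>L = K(V)\<close>. A basis \<open>v\<close> of \<open>V\<close> solves a system \<open>\<delta>\<^sub>i v = A\<^sub>i v\<close> over \<open>K\<close>.

  The \<open>x \<in> (1 \<otimes> L) \<cdot> D\<close> with \<open>x (v\<^sub>r \<otimes> 1) \<in> (1 \<otimes> L) \<cdot> D\<close> for all \<open>r\<close> form a \<open>\<Delta>\<close>-stable
  subspace, which is therefore generated by constants \<open>j\<close>, and it contains a unit. Writing
  \<open>j (v\<^sub>r \<otimes> 1) = \<Sum>\<^sub>d (1 \<otimes> l\<^sub>r\<^sub>d) d\<close> with independent \<open>d \<in> D\<close>, each column \<open>(l\<^sub>r\<^sub>d)\<^sub>r\<close> is a solution in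
  \<open>L\<close>, and the columns for all \<open>j\<close> together span \<open>L\<^sup>n\<close>. So there is a fundamental matrix \<open>Y\<close> over \<open>L\<close>,
  and \<open>v = Y c\<close> with \<open>c\<close> constant shows \<open>L = K(Y)\<close>.
\<close>

section \<open>Finite sums and derivations\<close>

text \<open>The obstacle is that \<open>L \<otimes>\<^sub>K L\<close> may have zero divisors and its
  constants need not form a field, so a relation in it can be neither divided nor moved into a
  quotient field. Two devices take the place of division. First, that x lies in S T is always used
  in the form: r and x r lie in S \<cdot> T for some unit r. Secondly, no K-basis of the possibly
  infinite-dimensional L is chosen. The second tensor factor is evaluated at K-linear functionals
  instead. They see enough, because the elements annihilated by all of them form an ideal without 1,
  hence without units. They also control the derivations, because the commutator of a functional
  with a derivation is again a functional.

  Elements of the tensor square are functions on the endomorphisms of L, so they do not have the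
  type \<open>'a\<close> over which normality is assumed. The ring is therefore copied into
  \<open>'a\<close> along an injection. It exists because characteristic zero makes K infinite, and
  a tensor is described by a finite list of pairs.\<close>

lemma (in abelian_monoid) finsum_swap:
  assumes "finite A" "finite B" "\<And>i j. \<lbrakk>i \<in> A; j \<in> B\<rbrakk> \<Longrightarrow> f i j \<in> carrier G"
  shows "(\<Oplus>i\<in>A. \<Oplus>j\<in>B. f i j) = (\<Oplus>j\<in>B. \<Oplus>i\<in>A. f i j)"
  using assms(1,3)
proof (induction A rule: finite_induct)
  case empty
  then show ?case by (simp add: finsum_zero)
next
  case (insert a A)
  have "(\<Oplus>i\<in>insert a A. \<Oplus>j\<in>B. f i j) = (\<Oplus>j\<in>B. f a j) \<oplus> (\<Oplus>j\<in>B. \<Oplus>i\<in>A. f i j)"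
    using insert by (subst finsum_insert) (auto intro!: finsum_closed)
  also have "\<dots> = (\<Oplus>j\<in>B. f a j \<oplus> (\<Oplus>i\<in>A. f i j))"
    using insert by (subst finsum_addf) (auto intro!: finsum_closed)
  also have "\<dots> = (\<Oplus>j\<in>B. \<Oplus>i\<in>insert a A. f i j)"
    using insert by (intro finsum_cong') (auto intro!: finsum_closed add.m_closed finsum_insert[symmetric])
  finally show ?case .
qed

text \<open>Associativity a (B x) = (a B) x for a row a, a matrix B and a column x. All later
  manipulations of matrix products go through it.\<close>

lemma (in ring) finsum_assoc:
  assumes "finite A" "finite B" "\<And>i. i \<in> A \<Longrightarrow> a i \<in> carrier R"
    "\<And>i j. \<lbrakk>i \<in> A; j \<in> B\<rbrakk> \<Longrightarrow> b i j \<in> carrier R" "\<And>j. j \<in> B \<Longrightarrow> x j \<in> carrier R"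
  shows "(\<Oplus>i\<in>A. a i \<otimes> (\<Oplus>j\<in>B. b i j \<otimes> x j)) = (\<Oplus>j\<in>B. (\<Oplus>i\<in>A. a i \<otimes> b i j) \<otimes> x j)"
proof -
  have "(\<Oplus>i\<in>A. a i \<otimes> (\<Oplus>j\<in>B. b i j \<otimes> x j)) = (\<Oplus>i\<in>A. \<Oplus>j\<in>B. a i \<otimes> b i j \<otimes> x j)"
    using assms
    by (intro finsum_cong' refl) (auto simp: finsum_rdistr m_assoc intro!: finsum_closed finsum_cong')
  also have "\<dots> = (\<Oplus>j\<in>B. \<Oplus>i\<in>A. a i \<otimes> b i j \<otimes> x j)"
    using assms by (intro finsum_swap) auto
  also have "\<dots> = (\<Oplus>j\<in>B. (\<Oplus>i\<in>A. a i \<otimes> b i j) \<otimes> x j)"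
    using assms by (intro finsum_cong' refl) (auto simp: finsum_ldistr intro!: finsum_closed)
  finally show ?thesis .
qed

lemma (in ring) finsum_unit_vector:
  assumes "finite A" "q \<in> A" "\<And>j. j \<in> A \<Longrightarrow> x j \<in> carrier R"
  shows "(\<Oplus>j\<in>A. (if q = j then \<one> else \<zero>) \<otimes> x j) = x q"
proof -
  have "(\<Oplus>j\<in>A. (if q = j then \<one> else \<zero>) \<otimes> x j) = (\<Oplus>j\<in>A. if q = j then x j else \<zero>)"
    using assms by (intro finsum_cong' refl) auto
  also have "\<dots> = x q"
    using assms by (intro finsum_singleton) auto
  finally show ?thesis .
qed

lemma (in ring) finsum_neg:
  assumes "finite A" "\<And>j. j \<in> A \<Longrightarrow> x j \<in> carrier R"
  shows "(\<Oplus>j\<in>A. \<ominus> x j) = \<ominus> (\<Oplus>j\<in>A. x j)"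
proof -
  have "(\<Oplus>j\<in>A. \<ominus> x j) = (\<Oplus>j\<in>A. (\<ominus> \<one>) \<otimes> x j)"
    using assms by (intro finsum_cong' refl) (auto simp: l_minus)
  also have "\<dots> = (\<ominus> \<one>) \<otimes> (\<Oplus>j\<in>A. x j)"
    using assms by (intro finsum_rdistr[symmetric]) auto
  finally show ?thesis using assms by (simp add: l_minus finsum_closed Pi_def)
qed

context delta_ring
begin

lemma delta_closed [simp, intro]: "\<lbrakk>i < m; x \<in> carrier R\<rbrakk> \<Longrightarrow> \<delta> i x \<in> carrier R"
  using derivation unfolding derivation_def by blast

lemma delta_add: "\<lbrakk>i < m; x \<in> carrier R; y \<in> carrier R\<rbrakk> \<Longrightarrow> \<delta> i (x \<oplus> y) = \<delta> i x \<oplus> \<delta> i y"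
  using derivation unfolding derivation_def by blast

lemma delta_mult:
  "\<lbrakk>i < m; x \<in> carrier R; y \<in> carrier R\<rbrakk> \<Longrightarrow> \<delta> i (x \<otimes> y) = \<delta> i x \<otimes> y \<oplus> x \<otimes> \<delta> i y"
  using derivation unfolding derivation_def by blast

lemma delta_zero [simp]: "i < m \<Longrightarrow> \<delta> i \<zero> = \<zero>"
  using delta_add[of i \<zero> \<zero>] by (metis add.l_cancel_one delta_closed l_zero zero_closed)

lemma delta_one [simp]: "i < m \<Longrightarrow> \<delta> i \<one> = \<zero>"
  using delta_mult[of i \<one> \<one>] by (metis add.l_cancel_one delta_closed l_one one_closed r_one)

lemma delta_minus: "\<lbrakk>i < m; x \<in> carrier R\<rbrakk> \<Longrightarrow> \<delta> i (\<ominus> x) = \<ominus> \<delta> i x"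
  using delta_add[of i "\<ominus> x" x]
  by (metis a_inv_closed add.inv_equality delta_closed delta_zero l_neg)

lemma delta_finsum:
  assumes "i < m" "finite A" "\<And>j. j \<in> A \<Longrightarrow> f j \<in> carrier R"
  shows "\<delta> i (\<Oplus>j\<in>A. f j) = (\<Oplus>j\<in>A. \<delta> i (f j))"
  using assms(2,3)
proof (induction A rule: finite_induct)
  case empty
  then show ?case using assms(1) by simp
next
  case (insert a A)
  then show ?case using assms(1)
    by (simp add: finsum_insert Pi_def delta_add finsum_closed)
qed

lemma delta_lincomb:
  assumes "i < m" "finite A" "\<And>j. j \<in> A \<Longrightarrow> f j \<in> carrier R" "\<And>j. j \<in> A \<Longrightarrow> g j \<in> carrier R"
  shows "\<delta> i (\<Oplus>j\<in>A. f j \<otimes> g j) = (\<Oplus>j\<in>A. \<delta> i (f j) \<otimes> g j) \<oplus> (\<Oplus>j\<in>A. f j \<otimes> \<delta> i (g j))"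
proof -
  have "\<delta> i (\<Oplus>j\<in>A. f j \<otimes> g j) = (\<Oplus>j\<in>A. \<delta> i (f j \<otimes> g j))"
    using assms by (intro delta_finsum) auto
  also have "\<dots> = (\<Oplus>j\<in>A. \<delta> i (f j) \<otimes> g j \<oplus> f j \<otimes> \<delta> i (g j))"
    using assms by (intro finsum_cong' refl) (auto simp: delta_mult)
  also have "\<dots> = (\<Oplus>j\<in>A. \<delta> i (f j) \<otimes> g j) \<oplus> (\<Oplus>j\<in>A. f j \<otimes> \<delta> i (g j))"
    using assms by (intro finsum_addf) auto
  finally show ?thesis .
qed

lemma delta_inv:
  assumes "i < m" "x \<in> Units R"
  shows "\<delta> i (inv x) = \<ominus> (\<delta> i x \<otimes> inv x \<otimes> inv x)"
proof -
  have x: "x \<in> carrier R" "inv x \<in> carrier R" using assms by auto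
  have "\<zero> = \<delta> i (x \<otimes> inv x)" using assms by simp
  also have "\<dots> = \<delta> i x \<otimes> inv x \<oplus> x \<otimes> \<delta> i (inv x)"
    using assms(1) x by (rule delta_mult)
  finally have "x \<otimes> \<delta> i (inv x) = \<ominus> (\<delta> i x \<otimes> inv x)"
    using assms x by (metis add.inv_equality add.m_comm delta_closed m_closed)
  then have "inv x \<otimes> (x \<otimes> \<delta> i (inv x)) = inv x \<otimes> \<ominus> (\<delta> i x \<otimes> inv x)" by simp
  then have "(inv x \<otimes> x) \<otimes> \<delta> i (inv x) = \<ominus> (inv x \<otimes> (\<delta> i x \<otimes> inv x))"
    using assms x by (simp add: m_assoc r_minus del: Units_l_inv Units_r_inv)
  then show ?thesis using assms x by (simp add: m_ac)
qed

lemma constants_subring: "subring (constants R m \<delta>) R"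
  by (rule subringI) (auto simp: constants_def delta_add delta_mult delta_minus)

text \<open>Differentiating y = Y c and inserting A Y for the derivative of Y leaves Y c' = 0, and
  the left inverse \<open>Z\<close> removes \<open>Y\<close>. The lemma is applied in
  \<open>R\<close>, to the two images of a fundamental matrix, and in \<open>L\<close>, to a basis
  of a stable subspace.\<close>

lemma fundamental_coefficients_constant:
  assumes i: "i < m" and A: "A \<in> matrices n (carrier R)"
    and Y: "Y \<in> matrices n (carrier R)" and Z: "Z \<in> matrices n (carrier R)"
    and ZY: "\<And>r c. \<lbrakk>r < n; c < n\<rbrakk> \<Longrightarrow> mat_mult R n Z Y r c = (if r = c then \<one> else \<zero>)"
    and dY: "\<And>r c. \<lbrakk>r < n; c < n\<rbrakk> \<Longrightarrow> \<delta> i (Y r c) = mat_mult R n A Y r c"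
    and c: "\<And>k. k < n \<Longrightarrow> c k \<in> carrier R"
    and y: "\<And>r. r < n \<Longrightarrow> y r = (\<Oplus>k\<in>{..<n}. Y r k \<otimes> c k)"
    and dy: "\<And>r. r < n \<Longrightarrow> \<delta> i (y r) = (\<Oplus>k\<in>{..<n}. A r k \<otimes> y k)"
    and q: "q < n"
  shows "\<delta> i (c q) = \<zero>"
proof -
  have Yc: "\<And>r s. r < n \<Longrightarrow> s < n \<Longrightarrow> Y r s \<in> carrier R"
    and Zc: "\<And>r s. r < n \<Longrightarrow> s < n \<Longrightarrow> Z r s \<in> carrier R"
    and Ac: "\<And>r s. r < n \<Longrightarrow> s < n \<Longrightarrow> A r s \<in> carrier R"
    using Y Z A by (auto simp: matrices_def)
  have eq0: "(\<Oplus>k\<in>{..<n}. Y r k \<otimes> \<delta> i (c k)) = \<zero>" if r: "r < n" for r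
  proof -
    have yc: "y s \<in> carrier R" if "s < n" for s using y that Yc c by (auto intro!: finsum_closed)
    have "(\<Oplus>k\<in>{..<n}. A r k \<otimes> y k) = (\<Oplus>s\<in>{..<n}. A r s \<otimes> (\<Oplus>k\<in>{..<n}. Y s k \<otimes> c k))"
      using r Ac Yc c y by (intro finsum_cong' refl) (auto intro!: m_closed finsum_closed)
    also have "\<dots> = (\<Oplus>k\<in>{..<n}. (\<Oplus>s\<in>{..<n}. A r s \<otimes> Y s k) \<otimes> c k)"
      using r Ac Yc c by (intro finsum_assoc) auto
    also have "\<dots> = (\<Oplus>k\<in>{..<n}. \<delta> i (Y r k) \<otimes> c k)"
      using r Ac Yc c i by (intro finsum_cong' refl) (auto simp: dY mat_mult_def intro!: finsum_closed)
    finally have e1: "(\<Oplus>k\<in>{..<n}. A r k \<otimes> y k) = (\<Oplus>k\<in>{..<n}. \<delta> i (Y r k) \<otimes> c k)" .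
    have "\<delta> i (y r) = (\<Oplus>k\<in>{..<n}. \<delta> i (Y r k) \<otimes> c k) \<oplus> (\<Oplus>k\<in>{..<n}. Y r k \<otimes> \<delta> i (c k))"
      unfolding y[OF r] using r Yc c i by (intro delta_lincomb) auto
    moreover have "(\<Oplus>k\<in>{..<n}. \<delta> i (Y r k) \<otimes> c k) \<in> carrier R"
      "(\<Oplus>k\<in>{..<n}. Y r k \<otimes> \<delta> i (c k)) \<in> carrier R"
      using r Yc c i by (auto intro!: finsum_closed)
    ultimately show ?thesis using dy[OF r] e1 by (metis add.l_cancel_one)
  qed
  have "\<delta> i (c q) = (\<Oplus>k\<in>{..<n}. (if q = k then \<one> else \<zero>) \<otimes> \<delta> i (c k))"
    using q c i by (intro finsum_unit_vector[symmetric]) auto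
  also have "\<dots> = (\<Oplus>k\<in>{..<n}. (\<Oplus>s\<in>{..<n}. Z q s \<otimes> Y s k) \<otimes> \<delta> i (c k))"
    using ZY[OF q] q c i Zc Yc by (intro finsum_cong' refl) (auto simp: mat_mult_def intro!: finsum_closed)
  also have "\<dots> = (\<Oplus>s\<in>{..<n}. Z q s \<otimes> (\<Oplus>k\<in>{..<n}. Y s k \<otimes> \<delta> i (c k)))"
    using q c i Zc Yc by (intro finsum_assoc[symmetric]) auto
  also have "\<dots> = (\<Oplus>s\<in>{..<n}. \<zero>)"
    using q Zc by (intro finsum_cong' refl) (auto simp: eq0)
  finally show ?thesis by (simp add: finsum_zero)
qed

end

section \<open>The subrings \<open>S \<cdot> T\<close> and \<open>S T\<close>\<close>

context cring
begin

context
  fixes S T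
  assumes S: "S \<subseteq> carrier R" and T: "T \<subseteq> carrier R"
begin

lemma subring_prod_zero: "\<zero> \<in> subring_prod R S T"
  unfolding subring_prod_def by (intro CollectI exI[of _ "0::nat"]) auto

lemma subring_prod_step:
  assumes "a \<in> S" "b \<in> T" "p \<in> subring_prod R S T"
  shows "a \<otimes> b \<oplus> p \<in> subring_prod R S T"
proof -
  obtain k :: nat and s t where p: "p = (\<Oplus>i \<in> {..<k}. s i \<otimes> t i)"
    and st: "s \<in> {..<k} \<rightarrow> S" "t \<in> {..<k} \<rightarrow> T"
    using assms(3) unfolding subring_prod_def by blast
  have car: "\<And>i. i < k \<Longrightarrow> s i \<otimes> t i \<in> carrier R" using st S T by (intro m_closed) auto
  have "(\<Oplus>i \<in> {..<Suc k}. (s(k := a)) i \<otimes> (t(k := b)) i) = a \<otimes> b \<oplus> p"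
  proof -
    have "(\<Oplus>i \<in> {..<k}. (s(k := a)) i \<otimes> (t(k := b)) i) = p"
      unfolding p using car by (intro finsum_cong' refl) auto
    then show ?thesis
      using assms(1,2) S T car unfolding lessThan_Suc
      by (subst finsum_insert) (auto intro!: m_closed)
  qed
  moreover have "s(k := a) \<in> {..<Suc k} \<rightarrow> S" "t(k := b) \<in> {..<Suc k} \<rightarrow> T"
    using st assms by (auto simp: less_Suc_eq)
  ultimately show ?thesis
    unfolding subring_prod_def
    by (intro CollectI exI[of _ "Suc k"] exI[of _ "s(k := a)"] exI[of _ "t(k := b)"]) simp
qed

end

text \<open>Induction on the number of summands. With it most later proofs avoid the indexed
  families of the definition and add one product at a time.\<close>

lemma subring_prod_induct [consumes 3, case_names zero step]:
  assumes p: "p \<in> subring_prod R S T" and S: "S \<subseteq> carrier R" and T: "T \<subseteq> carrier R"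
    and zero: "P \<zero>"
    and step: "\<And>a b p. \<lbrakk>a \<in> S; b \<in> T; p \<in> subring_prod R S T; P p\<rbrakk> \<Longrightarrow> P (a \<otimes> b \<oplus> p)"
  shows "P p"
proof -
  \<comment> \<open>Membership is carried along because \<open>step\<close> also asks for the
    partial sum to lie in \<open>subring_prod R S T\<close>.\<close>
  have "P (\<Oplus>i \<in> {..<k}. s i \<otimes> t i) \<and> (\<Oplus>i \<in> {..<k}. s i \<otimes> t i) \<in> subring_prod R S T"
    if "s \<in> {..<k} \<rightarrow> S" "t \<in> {..<k} \<rightarrow> T" for k :: nat and s t
    using that
  proof (induction k)
    case 0
    then show ?case using zero subring_prod_zero[OF S T] by simp
  next
    case (Suc k)
    have "(\<Oplus>i \<in> {..<Suc k}. s i \<otimes> t i) = s k \<otimes> t k \<oplus> (\<Oplus>i \<in> {..<k}. s i \<otimes> t i)"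
      unfolding lessThan_Suc using Suc.prems S T
      by (subst finsum_insert) (auto intro!: m_closed)
    moreover have "s \<in> {..<k} \<rightarrow> S" "t \<in> {..<k} \<rightarrow> T" using Suc.prems by auto
    moreover have "s k \<in> S" "t k \<in> T" using Suc.prems by auto
    ultimately show ?case using Suc.IH step subring_prod_step[OF S T] by metis
  qed
  then show ?thesis using p unfolding subring_prod_def by blast
qed

context
  fixes S T
  assumes S: "S \<subseteq> carrier R" and T: "T \<subseteq> carrier R"
begin

lemma subring_prod_closed:
  assumes "p \<in> subring_prod R S T"
  shows "p \<in> carrier R"
  using assms S T
proof (induction p rule: subring_prod_induct)
  case (step a b p)
  then show ?case using S T by (intro a_closed m_closed) auto
qed simp

lemma subring_prod_add:
  assumes "p \<in> subring_prod R S T" "q \<in> subring_prod R S T"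
  shows "p \<oplus> q \<in> subring_prod R S T"
  using assms(1) S T
proof (induction p rule: subring_prod_induct)
  case zero
  then show ?case using assms(2) subring_prod_closed by simp
next
  case (step a b p)
  have "a \<otimes> b \<oplus> p \<oplus> q = a \<otimes> b \<oplus> (p \<oplus> q)"
    using step S T subring_prod_closed assms(2) by (intro a_assoc) auto
  then show ?case using step subring_prod_step[OF S T] by simp
qed

lemma subring_prod_tensor:
  assumes "a \<in> S" "b \<in> T"
  shows "a \<otimes> b \<in> subring_prod R S T"
  using subring_prod_step[OF S T assms subring_prod_zero[OF S T]] assms S T by (metis m_closed r_zero subsetD)

end

text \<open>\<open>T\<close> may be any subset: the lemma is later used for the constants contained
  in a stable subspace, which need not form a ring.\<close>

lemma subring_prod_left_mult:
  assumes S: "subring S R" and T: "T \<subseteq> carrier R" and "s \<in> S" "p \<in> subring_prod R S T"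
  shows "s \<otimes> p \<in> subring_prod R S T"
proof -
  note Sc = subringE(1)[OF S]
  show ?thesis using assms(4) Sc T
  proof (induction p rule: subring_prod_induct)
    case zero
    then show ?case using assms(3) Sc subring_prod_zero[OF Sc T] by auto
  next
    case (step a b p)
    have "s \<in> carrier R" "a \<in> carrier R" "b \<in> carrier R" "p \<in> carrier R"
      using step Sc T assms(3) subring_prod_closed[OF Sc T] by auto
    then have "s \<otimes> (a \<otimes> b \<oplus> p) = (s \<otimes> a) \<otimes> b \<oplus> s \<otimes> p" by (simp add: r_distr m_assoc)
    then show ?case
      using subring_prod_step[OF Sc T] step subringE(6)[OF S assms(3)] by simp
  qed
qed

lemma subring_prod_swap:
  assumes "S \<subseteq> carrier R" "T \<subseteq> carrier R"
  shows "subring_prod R S T = subring_prod R T S"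
proof -
  have *: "p \<in> subring_prod R T S"
    if S: "S \<subseteq> carrier R" and T: "T \<subseteq> carrier R" and "p \<in> subring_prod R S T" for S T p
    using that(3) S T
  proof (induction p rule: subring_prod_induct)
    case zero
    then show ?case by (rule subring_prod_zero[OF T S])
  next
    case (step a b p)
    moreover have "a \<otimes> b = b \<otimes> a" using step S T by (intro m_comm) auto
    ultimately show ?case using subring_prod_step[OF T S] by simp
  qed
  show ?thesis using *[OF assms] *[OF assms(2,1)] by blast
qed

lemma subring_prod_mult:
  assumes S: "subring S R" and T: "subring T R"
    and "p \<in> subring_prod R S T" "q \<in> subring_prod R S T"
  shows "p \<otimes> q \<in> subring_prod R S T"
proof -
  note Sc = subringE(1)[OF S] and Tc = subringE(1)[OF T]
  note closed = subring_prod_closed[OF Sc Tc]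
  show ?thesis using assms(3) Sc Tc
  proof (induction p rule: subring_prod_induct)
    case zero
    then show ?case using assms(4) closed subring_prod_zero[OF Sc Tc] by auto
  next
    case (step a b p)
    have "b \<otimes> q \<in> subring_prod R S T"
      using subring_prod_left_mult[OF T Sc] step assms(4) subring_prod_swap[OF Sc Tc] by simp
    then have "a \<otimes> (b \<otimes> q) \<in> subring_prod R S T"
      using subring_prod_left_mult[OF S Tc] step by simp
    moreover have "(a \<otimes> b \<oplus> p) \<otimes> q = a \<otimes> (b \<otimes> q) \<oplus> p \<otimes> q"
    proof -
      have "a \<in> carrier R" "b \<in> carrier R" "p \<in> carrier R" "q \<in> carrier R"
        using step Sc Tc assms(4) closed by auto
      then show ?thesis by (simp add: l_distr m_assoc)
    qed
    ultimately show ?case using subring_prod_add[OF Sc Tc] step by simp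
  qed
qed

lemma subring_prod_subring:
  assumes S: "subring S R" and T: "subring T R"
  shows "subring (subring_prod R S T) R"
proof (rule subringI)
  note Sc = subringE(1)[OF S] and Tc = subringE(1)[OF T]
  show "subring_prod R S T \<subseteq> carrier R" using subring_prod_closed[OF Sc Tc] by blast
  show "\<one> \<in> subring_prod R S T"
    using subring_prod_tensor[OF Sc Tc subringE(3)[OF S] subringE(3)[OF T]] by simp
  show "\<ominus> h \<in> subring_prod R S T" if "h \<in> subring_prod R S T" for h
  proof -
    have "(\<ominus> \<one>) \<otimes> h \<in> subring_prod R S T"
      using subring_prod_left_mult[OF S Tc _ that] subringE(3,5)[OF S] by simp
    then show ?thesis using subring_prod_closed[OF Sc Tc that] by (simp add: l_minus)
  qed
  show "h1 \<oplus> h2 \<in> subring_prod R S T" if "h1 \<in> subring_prod R S T" "h2 \<in> subring_prod R S T" for h1 h2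
    using subring_prod_add[OF Sc Tc that] .
  show "h1 \<otimes> h2 \<in> subring_prod R S T" if "h1 \<in> subring_prod R S T" "h2 \<in> subring_prod R S T" for h1 h2
    using subring_prod_mult[OF S T that] .
qed

text \<open>The denominator is kept on the left-hand side, so that no inverse occurs.\<close>

lemma subring_compositum_iff:
  assumes S: "subring S R" and T: "subring T R" and x: "x \<in> carrier R"
  shows "x \<in> subring_compositum R S T \<longleftrightarrow>
    (\<exists>r \<in> subring_prod R S T \<inter> Units R. x \<otimes> r \<in> subring_prod R S T)"
proof
  interpret P: subring "subring_prod R S T" R using subring_prod_subring[OF S T] .
  assume "x \<in> subring_compositum R S T"
  then obtain r r' where r: "x = r \<otimes> inv r'" "r \<in> subring_prod R S T" "r' \<in> subring_prod R S T" "r' \<in> Units R"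
    unfolding subring_compositum_def by blast
  then have "x \<otimes> r' = r"
    using P.subset by (auto simp: m_assoc)
  then show "\<exists>r \<in> subring_prod R S T \<inter> Units R. x \<otimes> r \<in> subring_prod R S T"
    using r(2-4) by auto
next
  assume "\<exists>r \<in> subring_prod R S T \<inter> Units R. x \<otimes> r \<in> subring_prod R S T"
  then obtain r where r: "r \<in> subring_prod R S T" "r \<in> Units R" "x \<otimes> r \<in> subring_prod R S T" by blast
  moreover have "x = (x \<otimes> r) \<otimes> inv r" using x r(2) Units_closed[OF r(2)] by (simp add: m_assoc)
  ultimately show "x \<in> subring_compositum R S T" unfolding subring_compositum_def by blast
qed

end

lemma (in ring_hom_cring) hom_Units:
  assumes x: "x \<in> Units R"
  shows "h x \<in> Units S"
proof -
  have c: "h x \<in> carrier S" "h (inv x) \<in> carrier S" using x by auto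
  have "h (inv x) \<otimes>\<^bsub>S\<^esub> h x = \<one>\<^bsub>S\<^esub>"
    using x by (metis R.Units_closed R.Units_inv_closed R.Units_l_inv hom_mult hom_one)
  then show ?thesis unfolding Units_def
    using c S.m_comm[of "h x" "h (inv x)"] by (auto intro!: bexI[of _ "h (inv x)"])
qed

text \<open>With this lemma normality has to be checked only on field generators. For sums and
  products the product of two denominators is a common one. For inverses, if r is a denominator of
  x, then h x r is again a unit in \<open>P\<close>, and it is a denominator of the inverse of x,
  with numerator r.\<close>

lemma (in field) preimage_subfieldI:
  assumes h: "ring_hom_cring R S h" and P: "subring P S"
  shows "subfield {x \<in> carrier R. \<exists>r \<in> P \<inter> Units S. h x \<otimes>\<^bsub>S\<^esub> r \<in> P} R"
proof -
  interpret h: ring_hom_cring R S h by fact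
  interpret P: subring P S by fact
  let ?X = "{x \<in> carrier R. \<exists>r \<in> P \<inter> Units S. h x \<otimes>\<^bsub>S\<^esub> r \<in> P}"
  have Pc: "\<And>x. x \<in> P \<Longrightarrow> x \<in> carrier S" using P.subset by blast
  note Pcl = subringE(5-7)[OF P]
  show ?thesis
  proof (rule subfieldI')
    show "subring ?X R"
    proof (rule subringI)
      show "\<one> \<in> ?X" using P.one_closed by (auto intro!: exI[of _ "\<one>\<^bsub>S\<^esub>"])
    next
      fix x assume x: "x \<in> ?X"
      then obtain r where "r \<in> P" "r \<in> Units S" "h x \<otimes>\<^bsub>S\<^esub> r \<in> P" by blast
      then show "\<ominus> x \<in> ?X" using x Pcl(1)[of "h x \<otimes>\<^bsub>S\<^esub> r"] Pc
        by (auto intro!: bexI[of _ r] simp: h.S.l_minus)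
    next
      fix x y assume x: "x \<in> ?X" and y: "y \<in> ?X"
      then obtain r s where rs: "r \<in> P" "r \<in> Units S" "h x \<otimes>\<^bsub>S\<^esub> r \<in> P"
        "s \<in> P" "s \<in> Units S" "h y \<otimes>\<^bsub>S\<^esub> s \<in> P" by blast
      have c: "h x \<in> carrier S" "h y \<in> carrier S" "r \<in> carrier S" "s \<in> carrier S"
        using x y rs Pc by auto
      have u: "r \<otimes>\<^bsub>S\<^esub> s \<in> P \<inter> Units S" using rs Pcl by auto
      have "(h x \<oplus>\<^bsub>S\<^esub> h y) \<otimes>\<^bsub>S\<^esub> (r \<otimes>\<^bsub>S\<^esub> s) = (h x \<otimes>\<^bsub>S\<^esub> r) \<otimes>\<^bsub>S\<^esub> s \<oplus>\<^bsub>S\<^esub> r \<otimes>\<^bsub>S\<^esub> (h y \<otimes>\<^bsub>S\<^esub> s)"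
        by (simp only: c h.S.l_distr h.S.m_assoc h.S.m_closed h.S.m_lcomm[of "h y" r s])
      moreover have "h (x \<oplus> y) = h x \<oplus>\<^bsub>S\<^esub> h y" using x y by simp
      ultimately have "h (x \<oplus> y) \<otimes>\<^bsub>S\<^esub> (r \<otimes>\<^bsub>S\<^esub> s) \<in> P" by (simp only: Pcl rs)
      then show "x \<oplus> y \<in> ?X" using x y u by blast
      have "(h x \<otimes>\<^bsub>S\<^esub> h y) \<otimes>\<^bsub>S\<^esub> (r \<otimes>\<^bsub>S\<^esub> s) = (h x \<otimes>\<^bsub>S\<^esub> r) \<otimes>\<^bsub>S\<^esub> (h y \<otimes>\<^bsub>S\<^esub> s)"
        using c by (simp add: h.S.m_ac)
      moreover have "h (x \<otimes> y) = h x \<otimes>\<^bsub>S\<^esub> h y" using x y by simp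
      ultimately have "h (x \<otimes> y) \<otimes>\<^bsub>S\<^esub> (r \<otimes>\<^bsub>S\<^esub> s) \<in> P" by (simp only: Pcl rs)
      then show "x \<otimes> y \<in> ?X" using x y u by blast
    qed auto
  next
    fix x assume x: "x \<in> ?X - {\<zero>}"
    then obtain r where r: "r \<in> P" "r \<in> Units S" "h x \<otimes>\<^bsub>S\<^esub> r \<in> P" by blast
    have xu: "x \<in> Units R" using x field_Units by auto
    have i: "h (inv x) \<otimes>\<^bsub>S\<^esub> h x = \<one>\<^bsub>S\<^esub>"
      using xu by (metis Units_closed Units_inv_closed Units_l_inv h.hom_mult h.hom_one)
    have hu: "h x \<in> Units S" using xu by (rule h.hom_Units)
    have "h (inv x) \<otimes>\<^bsub>S\<^esub> (h x \<otimes>\<^bsub>S\<^esub> r) = r"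
      using i xu r Pc by (metis Units_closed Units_inv_closed h.S.l_one h.S.m_assoc h.hom_closed)
    then show "inv x \<in> ?X" using xu hu r by (auto intro!: bexI[of _ "h x \<otimes>\<^bsub>S\<^esub> r"])
  qed
qed

section \<open>Picard-Vessiot extensions are normal\<close>

lemma (in ring_hom_cring) hom_mat_mult:
  assumes "A \<in> matrices n (carrier R)" "B \<in> matrices n (carrier R)" "r < n" "c < n"
  shows "h (mat_mult R n A B r c) = mat_mult S n (\<lambda>r c. h (A r c)) (\<lambda>r c. h (B r c)) r c"
proof -
  have c: "\<And>k. k < n \<Longrightarrow> A r k \<in> carrier R" "\<And>k. k < n \<Longrightarrow> B k c \<in> carrier R"
    using assms by (auto simp: matrices_def)
  then have "h (mat_mult R n A B r c) = (\<Oplus>\<^bsub>S\<^esub>k\<in>{..<n}. (h \<circ> (\<lambda>k. A r k \<otimes> B k c)) k)"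
    unfolding mat_mult_def by (intro hom_finsum) auto
  also have "\<dots> = mat_mult S n (\<lambda>r c. h (A r c)) (\<lambda>r c. h (B r c)) r c"
    unfolding mat_mult_def using c by (intro S.finsum_cong' refl) auto
  finally show ?thesis .
qed

lemma (in delta_field) delta_hom_ring_hom_cring:
  assumes "delta_ring S n \<epsilon>" "h \<in> delta_hom m R \<delta> S \<epsilon>"
  shows "ring_hom_cring R S h"
  using assms is_cring unfolding delta_hom_def delta_ring_def
  by (auto intro!: ring_hom_cring.intro ring_hom_cring_axioms.intro)

lemma (in cring) subring_prod_finsum:
  assumes "S \<subseteq> carrier R" "T \<subseteq> carrier R" "\<And>k. k < n \<Longrightarrow> f k \<in> S" "\<And>k. k < n \<Longrightarrow> g k \<in> T"
  shows "(\<Oplus>k\<in>{..<n::nat}. f k \<otimes> g k) \<in> subring_prod R S T"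
  unfolding subring_prod_def
  using assms(3,4) by (intro CollectI exI[of _ n] exI[of _ f] exI[of _ g]) auto

theorem picard_vessiot_imp_normal_wrt:
  assumes L: "delta_field L m \<delta>" and K: "delta_subfield K L m \<delta>"
    and PV: "picard_vessiot L K m \<delta>" and R: "delta_ring R m \<epsilon>"
    and s: "\<tau>\<^sub>s \<in> delta_hom m L \<delta> R \<epsilon>" and t: "\<tau>\<^sub>t \<in> delta_hom m L \<delta> R \<epsilon>"
    and K_eq: "\<And>x. x \<in> K \<Longrightarrow> \<tau>\<^sub>s x = \<tau>\<^sub>t x"
  shows "delta_normal_wrt L m R \<epsilon> \<tau>\<^sub>s \<tau>\<^sub>t"
proof -
  interpret L: delta_field L m \<delta> by fact
  interpret R: delta_ring R m \<epsilon> by fact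
  interpret s: ring_hom_cring L R \<tau>\<^sub>s using L.delta_hom_ring_hom_cring[OF R s] .
  interpret t: ring_hom_cring L R \<tau>\<^sub>t using L.delta_hom_ring_hom_cring[OF R t] .
  have sd: "\<epsilon> i (\<tau>\<^sub>s x) = \<tau>\<^sub>s (\<delta> i x)" and td: "\<epsilon> i (\<tau>\<^sub>t x) = \<tau>\<^sub>t (\<delta> i x)"
    if "i < m" "x \<in> carrier L" for i x
    using s t that by (auto simp: delta_hom_def)
  have Ksub: "subfield K L" using K by (simp add: delta_subfield_def)
  then have KL: "K \<subseteq> carrier L" using subfieldE(3) by blast
  let ?S = "\<tau>\<^sub>s ` carrier L" and ?C = "constants R m \<epsilon>"
  let ?P = "subring_prod R ?S ?C"
  have S: "subring ?S R" 
    using ring_hom_ring.img_is_subring[OF ring_hom_ringI2[OF L.ring_axioms R.ring_axioms s.homh]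
        L.carrier_is_subring] .
  have C: "subring ?C R" by (rule R.constants_subring)
  note Sc = subringE(1)[OF S] and Cc = subringE(1)[OF C]
  have P: "subring ?P R" using R.subring_prod_subring[OF S C] .
  \<comment> \<open>These are the elements whose image lies in the compositum. They form a subfield,
    so only \<open>K\<close> and the entries of \<open>Y\<close> have to be tested.\<close>
  let ?X = "{x \<in> carrier L. \<exists>r \<in> ?P \<inter> Units R. \<tau>\<^sub>t x \<otimes>\<^bsub>R\<^esub> r \<in> ?P}"
  have PX: "x \<in> ?X" if "x \<in> carrier L" "\<tau>\<^sub>t x \<in> ?P" for x
    using that subringE(3)[OF P] by (auto intro!: bexI[of _ "\<one>\<^bsub>R\<^esub>"])
  obtain n A Y where nAY: "(n::nat) \<ge> 1" "\<forall>i<m. A i \<in> matrices n K" "Y \<in> GL n L"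
    "\<forall>i<m. \<forall>r<n. \<forall>c<n. \<delta> i (Y r c) = mat_mult L n (A i) Y r c"
    "carrier L = generate_field L (K \<union> {Y r c | r c. r < n \<and> c < n})"
    using PV unfolding picard_vessiot_def by blast
  obtain Z where Y: "Y \<in> matrices n (carrier L)" and Z: "Z \<in> matrices n (carrier L)"
    and YZ: "\<And>r c. r < n \<Longrightarrow> c < n \<Longrightarrow> mat_mult L n Y Z r c = (if r = c then \<one>\<^bsub>L\<^esub> else \<zero>\<^bsub>L\<^esub>)"
    and ZY: "\<And>r c. r < n \<Longrightarrow> c < n \<Longrightarrow> mat_mult L n Z Y r c = (if r = c then \<one>\<^bsub>L\<^esub> else \<zero>\<^bsub>L\<^esub>)"
    using nAY(3) unfolding GL_def by blast
  have Yc: "\<And>r c. r < n \<Longrightarrow> c < n \<Longrightarrow> Y r c \<in> carrier L"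
    and Zc: "\<And>r c. r < n \<Longrightarrow> c < n \<Longrightarrow> Z r c \<in> carrier L"
    using Y Z by (auto simp: matrices_def)
  have Ac: "\<And>i r c. i < m \<Longrightarrow> r < n \<Longrightarrow> c < n \<Longrightarrow> A i r c \<in> K"
    using nAY(2) by (auto simp: matrices_def)
  have YX: "Y r c \<in> ?X" if r: "r < n" and c: "c < n" for r c
  proof (rule PX)
    \<comment> \<open>\<open>e\<close> is column \<open>c\<close> of the inverse of
      \<open>\<tau>\<^sub>s(Y)\<close> times \<open>\<tau>\<^sub>t(Y)\<close>, the matrix that
      should consist of constants.\<close>
    define e where "e k = (\<Oplus>\<^bsub>R\<^esub>q\<in>{..<n}. \<tau>\<^sub>s (Z k q) \<otimes>\<^bsub>R\<^esub> \<tau>\<^sub>t (Y q c))" for k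
    have ec: "e k \<in> carrier R" if "k < n" for k
      unfolding e_def using that Zc Yc c by (intro R.finsum_closed) auto
    have Yte: "\<tau>\<^sub>t (Y q c) = (\<Oplus>\<^bsub>R\<^esub>k\<in>{..<n}. \<tau>\<^sub>s (Y q k) \<otimes>\<^bsub>R\<^esub> e k)" if q: "q < n" for q
    proof -
      have "(\<Oplus>\<^bsub>R\<^esub>k\<in>{..<n}. \<tau>\<^sub>s (Y q k) \<otimes>\<^bsub>R\<^esub> e k)
          = (\<Oplus>\<^bsub>R\<^esub>p\<in>{..<n}. mat_mult R n (\<lambda>r c. \<tau>\<^sub>s (Y r c)) (\<lambda>r c. \<tau>\<^sub>s (Z r c)) q p \<otimes>\<^bsub>R\<^esub> \<tau>\<^sub>t (Y p c))"
        unfolding e_def mat_mult_def using q Zc Yc c by (intro R.finsum_assoc) auto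
      also have "\<dots> = (\<Oplus>\<^bsub>R\<^esub>p\<in>{..<n}. (if q = p then \<one>\<^bsub>R\<^esub> else \<zero>\<^bsub>R\<^esub>) \<otimes>\<^bsub>R\<^esub> \<tau>\<^sub>t (Y p c))"
        using q Yc c by (intro R.finsum_cong' refl) (auto simp: s.hom_mat_mult[symmetric] Y Z YZ)
      also have "\<dots> = \<tau>\<^sub>t (Y q c)"
        using q Yc c by (intro R.finsum_unit_vector) auto
      finally show ?thesis by simp
    qed
    have eC: "e k \<in> ?C" if k: "k < n" for k
    proof -
      have "\<epsilon> i (e k) = \<zero>\<^bsub>R\<^esub>" if i: "i < m" for i
      proof (rule R.fundamental_coefficients_constant
          [where A = "\<lambda>r c. \<tau>\<^sub>s (A i r c)" and Y = "\<lambda>r c. \<tau>\<^sub>s (Y r c)" and Z = "\<lambda>r c. \<tau>\<^sub>s (Z r c)"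
            and y = "\<lambda>r. \<tau>\<^sub>t (Y r c)" and n = n])
        show "mat_mult R n (\<lambda>r c. \<tau>\<^sub>s (Z r c)) (\<lambda>r c. \<tau>\<^sub>s (Y r c)) r c = (if r = c then \<one>\<^bsub>R\<^esub> else \<zero>\<^bsub>R\<^esub>)"
          if "r < n" "c < n" for r c
          using that by (simp add: s.hom_mat_mult[symmetric] Y Z ZY)
        show "\<epsilon> i (\<tau>\<^sub>s (Y r c)) = mat_mult R n (\<lambda>r c. \<tau>\<^sub>s (A i r c)) (\<lambda>r c. \<tau>\<^sub>s (Y r c)) r c"
          if "r < n" "c < n" for r c
        proof -
          have "A i \<in> matrices n (carrier L)" using Ac[OF i] KL by (auto simp: matrices_def)
          then show ?thesis
            using that i nAY(4) Yc by (simp add: sd s.hom_mat_mult[symmetric] Y)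
        qed
        show "\<epsilon> i (\<tau>\<^sub>t (Y r c)) = (\<Oplus>\<^bsub>R\<^esub>k\<in>{..<n}. \<tau>\<^sub>s (A i r k) \<otimes>\<^bsub>R\<^esub> \<tau>\<^sub>t (Y k c))" if "r < n" for r
        proof -
          have "A i \<in> matrices n (carrier L)" using Ac[OF i] KL by (auto simp: matrices_def)
          then have "\<epsilon> i (\<tau>\<^sub>t (Y r c)) = mat_mult R n (\<lambda>r c. \<tau>\<^sub>t (A i r c)) (\<lambda>r c. \<tau>\<^sub>t (Y r c)) r c"
            using that i nAY(4) Yc c by (simp add: td t.hom_mat_mult[symmetric] Y)
          \<comment> \<open>The entries of \<open>A i\<close> lie in \<open>K\<close>, where the two
            embeddings agree, so both images of \<open>Y\<close> solve the same system.\<close>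
          also have "\<dots> = (\<Oplus>\<^bsub>R\<^esub>k\<in>{..<n}. \<tau>\<^sub>s (A i r k) \<otimes>\<^bsub>R\<^esub> \<tau>\<^sub>t (Y k c))"
            unfolding mat_mult_def using Ac[OF i that] Yc c KL
            by (intro R.finsum_cong' refl) (auto simp: K_eq subset_iff intro!: R.m_closed)
          finally show ?thesis .
        qed
      qed (use i k Ac[OF i] KL Yc Zc c ec Yte in \<open>auto simp: matrices_def\<close>)
      then show ?thesis using ec[OF k] by (simp add: constants_def)
    qed
    show "\<tau>\<^sub>t (Y r c) \<in> ?P"
      unfolding Yte[OF r] using Sc Cc eC Yc r by (intro R.subring_prod_finsum) auto
    show "Y r c \<in> carrier L" using Yc r c .
  qed
  have KX: "K \<subseteq> ?X"
  proof
    fix k assume k: "k \<in> K"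
    then have "\<tau>\<^sub>s k \<otimes>\<^bsub>R\<^esub> \<one>\<^bsub>R\<^esub> \<in> ?P"
      using KL subringE(3)[OF C] by (intro R.subring_prod_tensor[OF Sc Cc]) auto
    moreover have "\<tau>\<^sub>s k \<in> carrier R" using k KL by auto
    ultimately show "k \<in> ?X" using k KL K_eq by (intro PX) auto
  qed
  have "generate_field L (K \<union> {Y r c | r c. r < n \<and> c < n}) \<subseteq> ?X"
    using KX YX KL Yc by (intro L.generate_field_min_subfield1 L.preimage_subfieldI[OF t.ring_hom_cring_axioms P]) auto
  then have "carrier L \<subseteq> ?X" using nAY(5) by simp
  then show ?thesis unfolding delta_normal_wrt_def
    using R.subring_compositum_iff[OF S C] by auto
qed

section \<open>Linear functionals and finite-dimensional stable subspaces\<close>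

text \<open>The target \<open>W\<close> is a parameter: \<open>K\<close> gives the linear
  functionals, \<open>carrier L\<close> the endomorphisms. Values off the carrier are free, so maps
  equal on \<open>L\<close> may differ as functions.\<close>

definition linear_maps :: "('a, 'b) ring_scheme \<Rightarrow> 'a set \<Rightarrow> 'a set \<Rightarrow> ('a \<Rightarrow> 'a) set" where
  "linear_maps L K W = {\<phi> \<in> carrier L \<rightarrow> W.
     (\<forall>x \<in> carrier L. \<forall>y \<in> carrier L. \<phi> (x \<oplus>\<^bsub>L\<^esub> y) = \<phi> x \<oplus>\<^bsub>L\<^esub> \<phi> y) \<and>
     (\<forall>k \<in> K. \<forall>x \<in> carrier L. \<phi> (k \<otimes>\<^bsub>L\<^esub> x) = k \<otimes>\<^bsub>L\<^esub> \<phi> x)}"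

context field
begin

text \<open>A maximal subspace avoiding \<open>c\<close> is a complement of the line through \<open>c\<close>.\<close>

lemma exists_functional:
  assumes K: "subfield K R" and c: "c \<in> carrier R" "c \<noteq> \<zero>"
  shows "\<exists>\<psi> \<in> linear_maps R K K. \<psi> c = \<one>"
proof -
  note Kc = subfieldE(3)[OF K]
  note Ks = subringE(2,3,5-7)[OF subfieldE(1)[OF K]]
  define \<A> where "\<A> = {M. M \<subseteq> carrier R \<and> \<zero> \<in> M \<and> (\<forall>x\<in>M. \<forall>y\<in>M. x \<oplus> y \<in> M) \<and>
    (\<forall>k\<in>K. \<forall>x\<in>M. k \<otimes> x \<in> M) \<and> c \<notin> M}"
  have "\<exists>M\<in>\<A>. \<forall>B\<in>\<A>. M \<subseteq> B \<longrightarrow> B = M"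
  proof (rule subset_Zorn_nonempty)
    have "{\<zero>} \<in> \<A>" unfolding \<A>_def using c Kc by auto
    then show "\<A> \<noteq> {}" by blast
  next
    fix \<C> assume ne: "\<C> \<noteq> {}" and ch: "subset.chain \<A> \<C>"
    then have sub: "\<C> \<subseteq> \<A>" and tot: "\<And>B Y. B \<in> \<C> \<Longrightarrow> Y \<in> \<C> \<Longrightarrow> B \<subseteq> Y \<or> Y \<subseteq> B"
      by (auto simp: subset_chain_def)
    have "x \<oplus> y \<in> \<Union>\<C>" if xy: "x \<in> \<Union>\<C>" "y \<in> \<Union>\<C>" for x y
    proof -
      obtain B Y where "B \<in> \<C>" "x \<in> B" "Y \<in> \<C>" "y \<in> Y" using xy by blast
      then obtain Z where "Z \<in> \<C>" "x \<in> Z" "y \<in> Z" using tot by blast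
      moreover have "x \<oplus> y \<in> Z" using calculation sub by (auto simp: \<A>_def)
      ultimately show ?thesis by blast
    qed
    moreover have "k \<otimes> x \<in> \<Union>\<C>" if "k \<in> K" "x \<in> \<Union>\<C>" for k x
      using that sub by (fastforce simp: \<A>_def)
    moreover have "\<Union>\<C> \<subseteq> carrier R" "c \<notin> \<Union>\<C>" "\<zero> \<in> \<Union>\<C>"
      using sub ne by (auto simp: \<A>_def)
    ultimately show "\<Union>\<C> \<in> \<A>" by (simp add: \<A>_def)
  qed
  then obtain M where MA: "M \<in> \<A>" and max: "\<And>B. B \<in> \<A> \<Longrightarrow> M \<subseteq> B \<Longrightarrow> B = M" by blast
  then have Mc: "M \<subseteq> carrier R" and M0: "\<zero> \<in> M" and Madd: "\<And>x y. x \<in> M \<Longrightarrow> y \<in> M \<Longrightarrow> x \<oplus> y \<in> M"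
    and Msm: "\<And>k x. k \<in> K \<Longrightarrow> x \<in> M \<Longrightarrow> k \<otimes> x \<in> M" and cM: "c \<notin> M"
    by (auto simp: \<A>_def)
  have decomp: "\<exists>k\<in>K. \<exists>u\<in>M. w = k \<otimes> c \<oplus> u" if w: "w \<in> carrier R" for w
  proof (cases "w \<in> M")
    case True
    then show ?thesis using w c Ks(1) by (intro bexI[of _ \<zero>] bexI[of _ w]) auto
  next
    case False
    \<comment> \<open>\<open>N = M + K w\<close> is strictly larger than \<open>M\<close>, so by
      maximality it contains \<open>c\<close>. In c = k w + u the coefficient k is nonzero because c
      is not in \<open>M\<close>, so the equation can be solved for w.\<close>
    define N where "N = {k \<otimes> w \<oplus> u | k u. k \<in> K \<and> u \<in> M}"
    have NI: "k \<otimes> w \<oplus> u \<in> N" if "k \<in> K" "u \<in> M" for k u using that by (auto simp: N_def)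
    have MN: "M \<subseteq> N"
    proof
      fix u assume "u \<in> M"
      then show "u \<in> N" using NI[OF Ks(1), of u] w Mc by auto
    qed
    have "w \<in> N" using NI[OF Ks(2) M0] w by simp
    then have "N \<notin> \<A>" using max[OF _ MN] False by blast
    moreover have "N \<subseteq> carrier R" using w Kc Mc by (auto simp: N_def)
    moreover have "\<zero> \<in> N" using M0 MN by blast
    moreover have "x \<oplus> y \<in> N" if xy: "x \<in> N" "y \<in> N" for x y
    proof -
      obtain k u k' u' where *: "x = k \<otimes> w \<oplus> u" "y = k' \<otimes> w \<oplus> u'" "k \<in> K" "u \<in> M" "k' \<in> K" "u' \<in> M"
        using xy by (auto simp: N_def)
      then have "k \<in> carrier R" "k' \<in> carrier R" "u \<in> carrier R" "u' \<in> carrier R" using Kc Mc by auto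
      then have "x \<oplus> y = (k \<oplus> k') \<otimes> w \<oplus> (u \<oplus> u')" using * w by (simp add: l_distr a_ac)
      then show ?thesis using NI * Ks Madd by simp
    qed
    moreover have "l \<otimes> x \<in> N" if lx: "l \<in> K" "x \<in> N" for l x
    proof -
      obtain k u where *: "x = k \<otimes> w \<oplus> u" "k \<in> K" "u \<in> M" using lx by (auto simp: N_def)
      then have "k \<in> carrier R" "l \<in> carrier R" "u \<in> carrier R" using Kc Mc lx by auto
      then have "l \<otimes> x = (l \<otimes> k) \<otimes> w \<oplus> l \<otimes> u" using * w by (simp add: r_distr m_assoc)
      then show ?thesis using NI * Ks Msm lx by simp
    qed
    ultimately have "c \<in> N" by (auto simp: \<A>_def)
    then obtain k u where ku: "c = k \<otimes> w \<oplus> u" "k \<in> K" "u \<in> M" by (auto simp: N_def)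
    have kuc: "k \<in> carrier R" "u \<in> carrier R" using ku Kc Mc by auto
    have "k \<noteq> \<zero>" using ku cM w kuc by auto
    then have ki: "inv k \<in> K" "inv k \<in> carrier R" "inv k \<otimes> k = \<one>"
      using subfield_m_inv[OF K, of k] ku(2) Kc by auto
    have "inv k \<otimes> c \<oplus> (\<ominus> (inv k)) \<otimes> u = (inv k \<otimes> k) \<otimes> w \<oplus> (inv k \<otimes> u \<oplus> \<ominus> (inv k \<otimes> u))"
      unfolding ku(1) using kuc ki(2) w by (simp add: r_distr m_assoc l_minus a_assoc)
    also have "\<dots> = w" using kuc ki w by (simp add: r_neg)
    finally show ?thesis using ki(1) Ks Msm ku(3)
      by (intro bexI[of _ "inv k"] bexI[of _ "(\<ominus> (inv k)) \<otimes> u"]) auto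
  qed
  \<comment> \<open>Otherwise a nonzero multiple of \<open>c\<close>, and hence \<open>c\<close>
    itself, would lie in \<open>M\<close>.\<close>
  have uniq: "k = l" if kl: "k \<in> K" "l \<in> K" and uv: "u \<in> M" "v \<in> M" and eq: "k \<otimes> c \<oplus> u = l \<otimes> c \<oplus> v" for k l u v
  proof (rule ccontr)
    assume ne: "k \<noteq> l"
    have car: "k \<in> carrier R" "l \<in> carrier R" "u \<in> carrier R" "v \<in> carrier R" using kl uv Kc Mc by auto
    define h where "h = k \<ominus> l"
    have hK: "h \<in> K" unfolding h_def minus_eq using kl Ks by auto
    have h0: "h \<noteq> \<zero>" unfolding h_def using ne car by (simp add: r_right_minus_eq)
    have hi: "inv h \<in> K" "inv h \<otimes> h = \<one>" "inv h \<in> carrier R" "h \<in> carrier R"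
      using subfield_m_inv[OF K, of h] hK h0 Kc by auto
    have "h \<otimes> c = k \<otimes> c \<ominus> l \<otimes> c" unfolding h_def using car c by (simp add: minus_eq l_distr l_minus)
    also have "\<dots> = v \<oplus> (\<ominus> \<one>) \<otimes> u"
    proof -
      have "k \<otimes> c = l \<otimes> c \<oplus> v \<oplus> \<ominus> u" using eq car c by (metis a_assoc a_inv_closed m_closed r_neg r_zero)
      then show ?thesis using car c by (simp add: minus_eq l_minus a_ac r_neg1 r_neg)
    qed
    finally have "h \<otimes> c \<in> M" using uv Madd Msm Ks by simp
    then have "inv h \<otimes> (h \<otimes> c) \<in> M" using Msm hi by simp
    then show False using cM hi c by (simp add: m_assoc[symmetric])
  qed
  define \<psi> where "\<psi> w = (THE k. k \<in> K \<and> (\<exists>u\<in>M. w = k \<otimes> c \<oplus> u))" for w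
  have \<psi>I: "\<psi> w = k" if "k \<in> K" "u \<in> M" "w = k \<otimes> c \<oplus> u" for w k u
    unfolding \<psi>_def using that uniq by (intro the_equality) auto
  have \<psi>: "\<psi> w \<in> K \<and> (\<exists>u\<in>M. w = \<psi> w \<otimes> c \<oplus> u)" if "w \<in> carrier R" for w
    using decomp[OF that] \<psi>I by metis
  have "\<psi> \<in> linear_maps R K K"
    unfolding linear_maps_def
  proof (intro CollectI conjI ballI)
    show "\<psi> \<in> carrier R \<rightarrow> K" using \<psi> by auto
  next
    fix x y assume xy: "x \<in> carrier R" "y \<in> carrier R"
    obtain u v where uv: "u \<in> M" "x = \<psi> x \<otimes> c \<oplus> u" "v \<in> M" "y = \<psi> y \<otimes> c \<oplus> v"
      using \<psi>[OF xy(1)] \<psi>[OF xy(2)] by blast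
    have car: "\<psi> x \<in> carrier R" "\<psi> y \<in> carrier R" "u \<in> carrier R" "v \<in> carrier R"
      using uv \<psi> xy Kc Mc by auto
    have "x \<oplus> y = (\<psi> x \<otimes> c \<oplus> u) \<oplus> (\<psi> y \<otimes> c \<oplus> v)" using uv by simp
    also have "\<dots> = (\<psi> x \<oplus> \<psi> y) \<otimes> c \<oplus> (u \<oplus> v)"
      using car c by (simp add: l_distr a_ac)
    finally show "\<psi> (x \<oplus> y) = \<psi> x \<oplus> \<psi> y" using uv \<psi> xy Ks Madd by (intro \<psi>I) auto
  next
    fix k x assume kx: "k \<in> K" "x \<in> carrier R"
    obtain u where uv: "u \<in> M" "x = \<psi> x \<otimes> c \<oplus> u" using \<psi>[OF kx(2)] by blast
    have car: "\<psi> x \<in> carrier R" "u \<in> carrier R" "k \<in> carrier R"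
      using uv \<psi> kx Kc Mc by auto
    have "k \<otimes> x = k \<otimes> (\<psi> x \<otimes> c \<oplus> u)" using uv by simp
    also have "\<dots> = (k \<otimes> \<psi> x) \<otimes> c \<oplus> k \<otimes> u" using car c by (simp add: r_distr m_assoc)
    finally show "\<psi> (k \<otimes> x) = k \<otimes> \<psi> x" using uv \<psi> kx Ks Msm by (intro \<psi>I) auto
  qed
  moreover have "\<psi> c = \<one>" using M0 Ks c by (intro \<psi>I[of _ \<zero>]) auto
  ultimately show ?thesis by blast
qed

end

context delta_field
begin

lemma generate_field_delta_closed:
  assumes H: "H \<subseteq> carrier R" and i: "i < m"
    and dH: "\<And>h. h \<in> H \<Longrightarrow> \<delta> i h \<in> generate_field R H" and x: "x \<in> generate_field R H"
  shows "\<delta> i x \<in> generate_field R H"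
  using x
proof (induction rule: generate_field.induct)
  case one
  then show ?case using i zero_in_generate by simp
next
  case (incl h)
  then show ?case by (rule dH)
next
  case (a_inv h)
  then show ?case using i generate_field_in_carrier[OF H] by (simp add: delta_minus generate_field.a_inv)
next
  case (m_inv h)
  then have "h \<in> Units R" using generate_field_in_carrier[OF H] field_Units by auto
  then show ?case using i m_inv by (simp add: delta_inv generate_field.intros)
next
  case (eng_add h1 h2)
  then show ?case using i generate_field_in_carrier[OF H] by (simp add: delta_add generate_field.eng_add)
next
  case (eng_mult h1 h2)
  then show ?case using i generate_field_in_carrier[OF H]
    by (simp add: delta_mult generate_field.eng_add generate_field.eng_mult)
qed

end

section \<open>Finite-dimensional stable subspaces of an extension\<close>

locale delta_extension = delta_field L m \<delta> for L (structure) and m \<delta> +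
  fixes K :: "'a set"
  assumes delta_subfield: "delta_subfield K L m \<delta>"
begin

lemma K_subfield: "subfield K L"
  using delta_subfield by (simp add: delta_subfield_def)

lemma K_carrier: "k \<in> K \<Longrightarrow> k \<in> carrier L"
  using subfieldE(3)[OF K_subfield] by blast

lemmas K_closed = subringE(2,3,5-7)[OF subfieldE(1)[OF K_subfield]]

lemma K_delta: "\<lbrakk>i < m; k \<in> K\<rbrakk> \<Longrightarrow> \<delta> i k \<in> K"
  using delta_subfield by (simp add: delta_subfield_def)

text \<open>An element lies in such a subspace exactly if its iterated derivatives span a
  finite-dimensional \<open>K\<close>-space, as for holonomic functions.\<close>

definition fin_stable :: "'a set \<Rightarrow> bool" where
  "fin_stable V \<longleftrightarrow> finite_dimension K V \<and> (\<forall>i<m. \<forall>x\<in>V. \<delta> i x \<in> V)"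


lemma fin_stable_subset_carrier: "fin_stable V \<Longrightarrow> V \<subseteq> carrier L"
  using subalgebra_in_carrier finite_dimension_imp_subalgebra[OF K_subfield]
  unfolding fin_stable_def by blast

lemma fin_stable_subalgebra: "fin_stable V \<Longrightarrow> subalgebra K V L"
  using finite_dimension_imp_subalgebra[OF K_subfield] unfolding fin_stable_def by blast

lemma fin_stable_zero: "fin_stable V \<Longrightarrow> \<zero> \<in> V"
  using subgroup.one_closed[OF subalgebra.axioms(1)[OF fin_stable_subalgebra]] by simp

lemma fin_stable_base: "fin_stable K"
  using delta_subfield dimension_one[OF K_subfield] unfolding fin_stable_def delta_subfield_def
  by (auto intro: finite_dimensionI)

text \<open>The finite-dimensional stable subspaces form a directed family, so finitely many
  elements of their union can be placed in one of them, and the union is closed under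
  addition.\<close>

lemma fin_stable_sum:
  assumes V: "fin_stable V" and W: "fin_stable W"
  shows "\<exists>U. fin_stable U \<and> V \<subseteq> U \<and> W \<subseteq> U \<and> (\<forall>v\<in>V. \<forall>w\<in>W. v \<oplus> w \<in> U)"
proof (intro exI conjI)
  note Vc = fin_stable_subset_carrier[OF V] and Wc = fin_stable_subset_carrier[OF W]
  have in_sum: "v \<oplus> w \<in> V <+>\<^bsub>L\<^esub> W" if "v \<in> V" "w \<in> W" for v w
    using that unfolding set_add_def' by blast
  show "\<forall>v\<in>V. \<forall>w\<in>W. v \<oplus> w \<in> V <+>\<^bsub>L\<^esub> W" using in_sum by blast
  show "fin_stable (V <+>\<^bsub>L\<^esub> W)"
    unfolding fin_stable_def
  proof (intro conjI allI impI ballI)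
    show "finite_dimension K (V <+>\<^bsub>L\<^esub> W)"
      using V W sum_space_dim(1)[OF K_subfield] by (simp add: fin_stable_def)
    fix i x assume i: "i < m" and "x \<in> V <+>\<^bsub>L\<^esub> W"
    then obtain v w where x: "x = v \<oplus> w" "v \<in> V" "w \<in> W" unfolding set_add_def' by blast
    then have "\<delta> i x = \<delta> i v \<oplus> \<delta> i w" using i Vc Wc by (simp add: delta_add subset_iff)
    then show "\<delta> i x \<in> V <+>\<^bsub>L\<^esub> W" using in_sum x V W i by (simp add: fin_stable_def)
  qed
  show "V \<subseteq> V <+>\<^bsub>L\<^esub> W"
  proof
    fix v assume "v \<in> V"
    then show "v \<in> V <+>\<^bsub>L\<^esub> W" using in_sum[OF _ fin_stable_zero[OF W]] Vc by (metis r_zero subsetD)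
  qed
  show "W \<subseteq> V <+>\<^bsub>L\<^esub> W"
  proof
    fix w assume "w \<in> W"
    then show "w \<in> V <+>\<^bsub>L\<^esub> W" using in_sum[OF fin_stable_zero[OF V]] Wc by (metis l_zero subsetD)
  qed
qed

text \<open>Numerators and denominators of the finitely many generators are collected in one
  \<open>V\<close>. The field K(V) is closed under the derivations because \<open>K\<close> and
  \<open>V\<close> are, so by minimality it is all of \<open>L\<close>: differential generation has
  become ordinary field generation. Having K inside \<open>V\<close> guarantees that a basis of
  \<open>V\<close> is non-empty.\<close>

lemma fin_stable_generates:
  assumes fg: "finitely_delta_generated L K m \<delta>"
    and frac: "\<And>a. a \<in> carrier L \<Longrightarrow>
      \<exists>V t s. fin_stable V \<and> t \<in> V \<and> s \<in> V \<and> s \<noteq> \<zero> \<and> a \<otimes> s = t"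
  shows "\<exists>V. fin_stable V \<and> K \<subseteq> V \<and> carrier L = generate_field L (K \<union> V)"
proof -
  obtain S where S: "finite S" "S \<subseteq> carrier L"
    "carrier L = \<Inter> {F. delta_subfield F L m \<delta> \<and> K \<union> S \<subseteq> F}"
    using fg unfolding finitely_delta_generated_def by blast
  note Kc = subfieldE(3)[OF K_subfield]
  have "\<exists>V. fin_stable V \<and> K \<subseteq> V \<and> S \<subseteq> generate_field L (K \<union> V)"
    using S(1,2)
  proof (induction S rule: finite_induct)
    case empty
    then show ?case using fin_stable_base by blast
  next
    case (insert a S)
    then obtain V where V: "fin_stable V" "K \<subseteq> V" "S \<subseteq> generate_field L (K \<union> V)" by auto
    obtain W t s where W: "fin_stable W" "t \<in> W" "s \<in> W" "s \<noteq> \<zero>" "a \<otimes> s = t"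
      using frac[of a] insert.prems by auto
    obtain U where U: "fin_stable U" "V \<subseteq> U" "W \<subseteq> U" using fin_stable_sum[OF V(1) W(1)] by blast
    have KU: "K \<union> U \<subseteq> carrier L" using Kc fin_stable_subset_carrier[OF U(1)] by blast
    have "S \<subseteq> generate_field L (K \<union> U)"
      using V(3) mono_generate_field[of "K \<union> V" "K \<union> U"] KU U(2) by blast
    moreover have "a \<in> generate_field L (K \<union> U)"
    proof -
      have sc: "s \<in> carrier L" using W U KU by blast
      then have "a = t \<otimes> inv s" using W insert.prems field_Units by (auto simp: m_assoc)
      moreover have "t \<in> generate_field L (K \<union> U)" "s \<in> generate_field L (K \<union> U)"
        using W U by (auto intro: generate_field.incl)
      ultimately show ?thesis using W(4) by (auto intro: generate_field.intros)
    qed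
    ultimately show ?case using U V(2) by blast
  qed
  then obtain V where V: "fin_stable V" "K \<subseteq> V" "S \<subseteq> generate_field L (K \<union> V)" by blast
  have KV: "K \<union> V \<subseteq> carrier L" using Kc fin_stable_subset_carrier[OF V(1)] by blast
  have "delta_subfield (generate_field L (K \<union> V)) L m \<delta>"
    unfolding delta_subfield_def
  proof (intro conjI allI impI ballI)
    show "subfield (generate_field L (K \<union> V)) L" by (rule generate_field_is_subfield[OF KV])
    fix i x assume i: "i < m" and x: "x \<in> generate_field L (K \<union> V)"
    have "\<delta> i h \<in> generate_field L (K \<union> V)" if "h \<in> K \<union> V" for h
      using that i delta_subfield V(1) unfolding delta_subfield_def fin_stable_def by (blast intro: generate_field.incl)
    then show "\<delta> i x \<in> generate_field L (K \<union> V)" by (rule generate_field_delta_closed[OF KV i _ x])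
  qed
  moreover have "K \<subseteq> generate_field L (K \<union> V)" by (blast intro: generate_field.incl)
  ultimately have "carrier L \<subseteq> generate_field L (K \<union> V)" using V(3) S(3) by blast
  then show ?thesis using V generate_field_incl[OF KV] by blast
qed

text \<open>A target \<open>W\<close> of this kind makes the linear maps into \<open>W\<close>
  closed under commutators with the derivations. The two instances are \<open>K\<close> and
  \<open>carrier L\<close>.\<close>

definition stable :: "'a set \<Rightarrow> bool" where
  "stable W \<longleftrightarrow> subalgebra K W L \<and> (\<forall>i<m. \<forall>x\<in>W. \<delta> i x \<in> W)"

lemma stable_base: "stable K"
  using finite_dimension_imp_subalgebra[OF K_subfield finite_dimensionI[OF dimension_one[OF K_subfield]]]
    K_delta by (simp add: stable_def)

lemma stable_carrier: "stable (carrier L)"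
  using carrier_is_subalgebra subfieldE(3)[OF K_subfield] by (simp add: stable_def)

section \<open>Operations on linear maps into a stable subspace\<close>

context
  fixes W
  assumes W: "stable W"
begin

lemma stable_closed:
  shows "x \<in> W \<Longrightarrow> x \<in> carrier L" and "\<zero> \<in> W"
    and "\<lbrakk>x \<in> W; y \<in> W\<rbrakk> \<Longrightarrow> x \<oplus> y \<in> W" and "\<lbrakk>x \<in> W; y \<in> W\<rbrakk> \<Longrightarrow> x \<ominus> y \<in> W"
    and "\<lbrakk>k \<in> K; x \<in> W\<rbrakk> \<Longrightarrow> k \<otimes> x \<in> W" and "\<lbrakk>i < m; x \<in> W\<rbrakk> \<Longrightarrow> \<delta> i x \<in> W"
proof -
  interpret W: subalgebra K W L using W by (simp add: stable_def)
  show "x \<in> W \<Longrightarrow> x \<in> carrier L" "\<zero> \<in> W" "\<lbrakk>x \<in> W; y \<in> W\<rbrakk> \<Longrightarrow> x \<oplus> y \<in> W"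
    "\<lbrakk>k \<in> K; x \<in> W\<rbrakk> \<Longrightarrow> k \<otimes> x \<in> W"
    using W.mem_carrier W.one_closed W.m_closed W.smult_closed by simp_all
  show "\<lbrakk>x \<in> W; y \<in> W\<rbrakk> \<Longrightarrow> x \<ominus> y \<in> W"
    using W.m_closed W.m_inv_closed by (simp add: minus_eq a_inv_def)
  show "\<lbrakk>i < m; x \<in> W\<rbrakk> \<Longrightarrow> \<delta> i x \<in> W" using W by (simp add: stable_def)
qed

lemma linear_map_closed: "\<lbrakk>\<phi> \<in> linear_maps L K W; x \<in> carrier L\<rbrakk> \<Longrightarrow> \<phi> x \<in> W"
  unfolding linear_maps_def by auto

lemma linear_map_carrier: "\<lbrakk>\<phi> \<in> linear_maps L K W; x \<in> carrier L\<rbrakk> \<Longrightarrow> \<phi> x \<in> carrier L"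
  using linear_map_closed stable_closed(1) by blast

lemma linear_map_add:
  "\<lbrakk>\<phi> \<in> linear_maps L K W; x \<in> carrier L; y \<in> carrier L\<rbrakk> \<Longrightarrow> \<phi> (x \<oplus> y) = \<phi> x \<oplus> \<phi> y"
  unfolding linear_maps_def by auto

lemma linear_map_smult:
  "\<lbrakk>\<phi> \<in> linear_maps L K W; k \<in> K; x \<in> carrier L\<rbrakk> \<Longrightarrow> \<phi> (k \<otimes> x) = k \<otimes> \<phi> x"
  unfolding linear_maps_def by auto

lemma linear_mapI:
  assumes "\<And>x. x \<in> carrier L \<Longrightarrow> \<phi> x \<in> W"
    and "\<And>x y. \<lbrakk>x \<in> carrier L; y \<in> carrier L\<rbrakk> \<Longrightarrow> \<phi> (x \<oplus> y) = \<phi> x \<oplus> \<phi> y"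
    and "\<And>k x. \<lbrakk>k \<in> K; x \<in> carrier L\<rbrakk> \<Longrightarrow> \<phi> (k \<otimes> x) = k \<otimes> \<phi> x"
  shows "\<phi> \<in> linear_maps L K W"
  using assms unfolding linear_maps_def by auto

text \<open>This is the transpose of multiplication by \<open>l\<close>. It is the way in which the
  factor 1 \<otimes> l of a tensor acts on functionals.\<close>

lemma linear_map_shift:
  assumes "\<phi> \<in> linear_maps L K W" "l \<in> carrier L"
  shows "(\<lambda>z. \<phi> (l \<otimes> z)) \<in> linear_maps L K W"
proof (rule linear_mapI)
  fix k x assume "k \<in> K" "x \<in> carrier L"
  then have "\<phi> (k \<otimes> (l \<otimes> x)) = k \<otimes> \<phi> (l \<otimes> x)"
    using assms by (intro linear_map_smult) auto
  then show "\<phi> (l \<otimes> (k \<otimes> x)) = k \<otimes> \<phi> (l \<otimes> x)"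
    using assms \<open>k \<in> K\<close> \<open>x \<in> carrier L\<close> K_carrier by (simp add: m_lcomm)
qed (use assms in \<open>auto simp: linear_map_closed linear_map_add r_distr\<close>)

text \<open>Neither composite of \<phi> with the derivation is K-linear in general, but both fail by
  the same term \<delta>(k) \<phi>(x), which cancels in the difference.\<close>

lemma linear_map_commutator:
  assumes \<phi>: "\<phi> \<in> linear_maps L K W" and i: "i < m"
  shows "(\<lambda>y. \<delta> i (\<phi> y) \<ominus> \<phi> (\<delta> i y)) \<in> linear_maps L K W"
proof (rule linear_mapI)
  fix x assume x: "x \<in> carrier L"
  then show "\<delta> i (\<phi> x) \<ominus> \<phi> (\<delta> i x) \<in> W"
    using \<phi> i linear_map_closed by (intro stable_closed) auto
next
  fix x y assume xy: "x \<in> carrier L" "y \<in> carrier L"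
  then have c: "\<phi> x \<in> carrier L" "\<phi> y \<in> carrier L" "\<phi> (\<delta> i x) \<in> carrier L" "\<phi> (\<delta> i y) \<in> carrier L"
    using \<phi> i linear_map_carrier by auto
  then have c': "\<delta> i (\<phi> x) \<in> carrier L" "\<delta> i (\<phi> y) \<in> carrier L" using i by auto
  show "\<delta> i (\<phi> (x \<oplus> y)) \<ominus> \<phi> (\<delta> i (x \<oplus> y)) =
      \<delta> i (\<phi> x) \<ominus> \<phi> (\<delta> i x) \<oplus> (\<delta> i (\<phi> y) \<ominus> \<phi> (\<delta> i y))"
    using xy i c c' \<phi> by (simp add: minus_eq linear_map_add delta_add minus_add a_ac)
next
  fix k x assume kx: "k \<in> K" "x \<in> carrier L"
  then have c: "\<phi> x \<in> carrier L" "\<phi> (\<delta> i x) \<in> carrier L" "k \<in> carrier L" "\<delta> i k \<in> K" "\<delta> i k \<in> carrier L"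
    using \<phi> i linear_map_carrier K_carrier K_delta by auto
  have "\<phi> (\<delta> i (k \<otimes> x)) = \<delta> i k \<otimes> \<phi> x \<oplus> k \<otimes> \<phi> (\<delta> i x)"
    using kx c i \<phi> by (simp add: delta_mult linear_map_add linear_map_smult)
  moreover have "\<delta> i (\<phi> (k \<otimes> x)) = \<delta> i k \<otimes> \<phi> x \<oplus> k \<otimes> \<delta> i (\<phi> x)"
    using kx c i \<phi> by (simp add: delta_mult linear_map_smult)
  moreover have "(p \<oplus> q) \<ominus> (p \<oplus> r) = q \<ominus> r"
    if "p \<in> carrier L" "q \<in> carrier L" "r \<in> carrier L" for p q r
    using that by (simp add: minus_eq minus_add a_assoc a_lcomm[of p q] r_neg1 r_neg2)
  ultimately show "\<delta> i (\<phi> (k \<otimes> x)) \<ominus> \<phi> (\<delta> i (k \<otimes> x)) =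
      k \<otimes> (\<delta> i (\<phi> x) \<ominus> \<phi> (\<delta> i x))"
    using c i by (simp add: minus_eq r_distr r_minus)
qed

lemma linear_map_plus:
  assumes "\<phi> \<in> linear_maps L K W" "\<phi>' \<in> linear_maps L K W"
  shows "(\<lambda>z. \<phi> z \<oplus> \<phi>' z) \<in> linear_maps L K W"
proof (rule linear_mapI)
  fix x y assume xy: "x \<in> carrier L" "y \<in> carrier L"
  then have "\<phi> x \<in> carrier L" "\<phi> y \<in> carrier L" "\<phi>' x \<in> carrier L" "\<phi>' y \<in> carrier L"
    using assms linear_map_carrier by auto
  then show "\<phi> (x \<oplus> y) \<oplus> \<phi>' (x \<oplus> y) = \<phi> x \<oplus> \<phi>' x \<oplus> (\<phi> y \<oplus> \<phi>' y)"
    using xy assms by (simp add: linear_map_add a_ac)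
next
  fix k x assume "k \<in> K" "x \<in> carrier L"
  moreover from this have "\<phi> x \<in> carrier L" "\<phi>' x \<in> carrier L" "k \<in> carrier L"
    using assms linear_map_carrier K_carrier by auto
  ultimately show "\<phi> (k \<otimes> x) \<oplus> \<phi>' (k \<otimes> x) = k \<otimes> (\<phi> x \<oplus> \<phi>' x)"
    using assms by (simp add: linear_map_smult r_distr)
qed (use assms linear_map_closed stable_closed in auto)

lemma linear_map_scale:
  assumes \<phi>: "\<phi> \<in> linear_maps L K W" and k: "k \<in> K"
  shows "(\<lambda>z. k \<otimes> \<phi> z) \<in> linear_maps L K W"
proof (rule linear_mapI)
  fix l x assume lx: "l \<in> K" "x \<in> carrier L"
  then have "\<phi> x \<in> carrier L" "l \<in> carrier L" "k \<in> carrier L"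
    using assms linear_map_carrier K_carrier by auto
  then show "k \<otimes> \<phi> (l \<otimes> x) = l \<otimes> (k \<otimes> \<phi> x)"
    using assms lx by (simp add: linear_map_smult m_ac)
next
  fix x y assume xy: "x \<in> carrier L" "y \<in> carrier L"
  then have "\<phi> x \<in> carrier L" "\<phi> y \<in> carrier L" "k \<in> carrier L"
    using assms linear_map_carrier K_carrier by auto
  then show "k \<otimes> \<phi> (x \<oplus> y) = k \<otimes> \<phi> x \<oplus> k \<otimes> \<phi> y"
    using assms xy by (simp add: linear_map_add r_distr)
qed (use assms linear_map_closed stable_closed in auto)

lemma linear_map_zero: "(\<lambda>z. \<zero>) \<in> linear_maps L K W"
  using stable_closed(2) K_carrier by (intro linear_mapI) auto

end

end

section \<open>The tensor square of an extension\<close>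

text \<open>
  The properties of \<open>R = L \<otimes>\<^sub>K L\<close> on which the argument rests. Here \<open>\<tau>\<^sub>t a\<close> is \<open>a \<otimes> 1\<close>, \<open>\<tau>\<^sub>s l\<close> is
  \<open>1 \<otimes> l\<close>, and \<open>ev r \<psi>\<close> is the image of \<open>r\<close> under \<open>id \<otimes> \<psi>\<close>, for a linear functional
  \<open>\<psi>\<close> on \<open>L\<close> with values in \<open>K\<close>.
\<close>

locale tensor_square =
  L: delta_extension L m \<delta> K + R: delta_ring R m \<epsilon>
  for L :: "('a, 'b) ring_scheme" and m \<delta> and K :: "'a set" and R :: "('c, 'd) ring_scheme" and \<epsilon> +
  fixes \<tau>\<^sub>s \<tau>\<^sub>t :: "'a \<Rightarrow> 'c" and ev :: "'c \<Rightarrow> ('a \<Rightarrow> 'a) \<Rightarrow> 'a"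
  assumes tau_s: "\<tau>\<^sub>s \<in> delta_hom m L \<delta> R \<epsilon>" and tau_t: "\<tau>\<^sub>t \<in> delta_hom m L \<delta> R \<epsilon>"
    and tau_eq: "x \<in> K \<Longrightarrow> \<tau>\<^sub>s x = \<tau>\<^sub>t x"
    and ev_closed: "\<lbrakk>r \<in> carrier R; \<psi> \<in> linear_maps L K K\<rbrakk> \<Longrightarrow> ev r \<psi> \<in> carrier L"
    and ev_add: "\<lbrakk>r \<in> carrier R; r' \<in> carrier R; \<psi> \<in> linear_maps L K K\<rbrakk> \<Longrightarrow>
      ev (r \<oplus>\<^bsub>R\<^esub> r') \<psi> = ev r \<psi> \<oplus>\<^bsub>L\<^esub> ev r' \<psi>"
    and ev_one: "\<psi> \<in> linear_maps L K K \<Longrightarrow> ev \<one>\<^bsub>R\<^esub> \<psi> = \<psi> \<one>\<^bsub>L\<^esub>"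
    and ev_tau_t: "\<lbrakk>r \<in> carrier R; a \<in> carrier L; \<psi> \<in> linear_maps L K K\<rbrakk> \<Longrightarrow>
      ev (\<tau>\<^sub>t a \<otimes>\<^bsub>R\<^esub> r) \<psi> = a \<otimes>\<^bsub>L\<^esub> ev r \<psi>"
    and ev_tau_s: "\<lbrakk>r \<in> carrier R; l \<in> carrier L; \<psi> \<in> linear_maps L K K\<rbrakk> \<Longrightarrow>
      ev (\<tau>\<^sub>s l \<otimes>\<^bsub>R\<^esub> r) \<psi> = ev r (\<lambda>z. \<psi> (l \<otimes>\<^bsub>L\<^esub> z))"
    and ev_delta: "\<lbrakk>i < m; r \<in> carrier R; \<psi> \<in> linear_maps L K K\<rbrakk> \<Longrightarrow>
      ev (\<epsilon> i r) \<psi> = \<delta> i (ev r \<psi>) \<ominus>\<^bsub>L\<^esub> ev r (\<lambda>y. \<delta> i (\<psi> y) \<ominus>\<^bsub>L\<^esub> \<psi> (\<delta> i y))"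
    and ev_finite: "r \<in> carrier R \<Longrightarrow>
      \<exists>E. ring.finite_dimension L K E \<and> (\<forall>\<psi> \<in> linear_maps L K K. ev r \<psi> \<in> E)"
    and ev_add_functional: "\<lbrakk>r \<in> carrier R; \<psi> \<in> linear_maps L K K; \<psi>' \<in> linear_maps L K K\<rbrakk> \<Longrightarrow>
      ev r (\<lambda>z. \<psi> z \<oplus>\<^bsub>L\<^esub> \<psi>' z) = ev r \<psi> \<oplus>\<^bsub>L\<^esub> ev r \<psi>'"
    and ev_smult_functional: "\<lbrakk>r \<in> carrier R; k \<in> K; \<psi> \<in> linear_maps L K K\<rbrakk> \<Longrightarrow>
      ev r (\<lambda>z. k \<otimes>\<^bsub>L\<^esub> \<psi> z) = k \<otimes>\<^bsub>L\<^esub> ev r \<psi>"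
    and ev_mult_zero: "\<lbrakk>s \<in> carrier R; r \<in> carrier R; \<And>\<psi>. \<psi> \<in> linear_maps L K K \<Longrightarrow> ev r \<psi> = \<zero>\<^bsub>L\<^esub>;
        \<psi> \<in> linear_maps L K K\<rbrakk> \<Longrightarrow> ev (s \<otimes>\<^bsub>R\<^esub> r) \<psi> = \<zero>\<^bsub>L\<^esub>"
begin

sublocale s: ring_hom_cring L R \<tau>\<^sub>s
  using L.delta_hom_ring_hom_cring[OF R.delta_ring_axioms tau_s] .

sublocale t: ring_hom_cring L R \<tau>\<^sub>t
  using L.delta_hom_ring_hom_cring[OF R.delta_ring_axioms tau_t] .

lemma delta_tau:
  assumes "i < m" "x \<in> carrier L"
  shows "\<epsilon> i (\<tau>\<^sub>s x) = \<tau>\<^sub>s (\<delta> i x)" "\<epsilon> i (\<tau>\<^sub>t x) = \<tau>\<^sub>t (\<delta> i x)"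
  using assms tau_s tau_t by (auto simp: delta_hom_def)

abbreviation "functionals \<equiv> linear_maps L K K"

abbreviation "D \<equiv> constants R m \<epsilon>"

abbreviation "LD \<equiv> subring_prod R (\<tau>\<^sub>s ` carrier L) D"

lemmas functional_closed = L.linear_map_closed[OF L.stable_base]
lemmas functional_shift = L.linear_map_shift[OF L.stable_base]
lemmas functional_commutator = L.linear_map_commutator[OF L.stable_base]
lemmas functional_plus = L.linear_map_plus[OF L.stable_base]
lemmas functional_scale = L.linear_map_scale[OF L.stable_base]
lemmas functional_zero = L.linear_map_zero[OF L.stable_base]

lemma ev_zero: "\<psi> \<in> functionals \<Longrightarrow> ev \<zero>\<^bsub>R\<^esub> \<psi> = \<zero>\<^bsub>L\<^esub>"
  using ev_add[of "\<zero>\<^bsub>R\<^esub>" "\<zero>\<^bsub>R\<^esub>" \<psi>] ev_closed[of "\<zero>\<^bsub>R\<^esub>" \<psi>]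
  by (metis L.add.l_cancel_one R.l_zero R.zero_closed)

lemma ev_finsum:
  assumes "finite A" "\<And>j. j \<in> A \<Longrightarrow> f j \<in> carrier R" "\<psi> \<in> functionals"
  shows "ev (\<Oplus>\<^bsub>R\<^esub>j\<in>A. f j) \<psi> = (\<Oplus>\<^bsub>L\<^esub>j\<in>A. ev (f j) \<psi>)"
  using assms
proof (induction A rule: finite_induct)
  case empty
  then show ?case by (simp add: ev_zero)
next
  case (insert a A)
  then show ?case
    by (simp add: R.finsum_insert L.finsum_insert Pi_def ev_add ev_closed R.finsum_closed)
qed

lemma image_tau_subring: "subring (\<tau>\<^sub>s ` carrier L) R"
  using ring_hom_ring.img_is_subring[OF ring_hom_ringI2[OF L.ring_axioms R.ring_axioms s.homh]
      L.carrier_is_subring] .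

lemmas D_subring = R.constants_subring

lemmas image_tau_carrier = subringE(1)[OF image_tau_subring]

lemmas D_carrier = subringE(1)[OF D_subring]

lemmas LD_subring = R.subring_prod_subring[OF image_tau_subring D_subring]

lemma LD_carrier: "r \<in> LD \<Longrightarrow> r \<in> carrier R"
  using subringE(1)[OF LD_subring] by blast

text \<open>
  For a constant \<open>d = \<Sum> a\<^sub>i \<otimes> b\<^sub>i\<close> the elements \<open>\<Sum> a\<^sub>i \<psi>(b\<^sub>i)\<close> form a stable subspace, because
  differentiating one of them amounts to replacing \<open>\<psi>\<close> with its commutator with the derivation.
\<close>

lemma constant_values_stable:
  assumes d: "d \<in> D"
  shows "\<exists>V. L.fin_stable V \<and> (\<forall>\<psi> \<in> functionals. ev d \<psi> \<in> V)"
proof (intro exI conjI)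
  \<comment> \<open>The functionals form a \<open>K\<close>-space and \<open>ev d\<close> is linear
    on it, so \<open>?V\<close> is a subspace of the finite-dimensional \<open>E\<close>.\<close>
  let ?V = "ev d ` functionals"
  have dR: "d \<in> carrier R" and d0: "\<And>i. i < m \<Longrightarrow> \<epsilon> i d = \<zero>\<^bsub>R\<^esub>" using d by (auto simp: constants_def)
  obtain E where E: "L.finite_dimension K E" "\<And>\<psi>. \<psi> \<in> functionals \<Longrightarrow> ev d \<psi> \<in> E"
    using ev_finite[OF dR] by blast
  have "subalgebra K ?V L"
  proof (rule subalgebra.intro)
    show "subgroup ?V (add_monoid L)"
    proof (rule L.add.subgroupI)
      show "?V \<subseteq> carrier L" using ev_closed[OF dR] by auto
      show "?V \<noteq> {}" using functional_zero by blast
      fix a assume "a \<in> ?V"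
      then obtain \<psi> where \<psi>: "\<psi> \<in> functionals" "a = ev d \<psi>" by blast
      then have "\<ominus>\<^bsub>L\<^esub> a = (\<ominus>\<^bsub>L\<^esub> \<one>\<^bsub>L\<^esub>) \<otimes>\<^bsub>L\<^esub> ev d \<psi>" using ev_closed[OF dR \<psi>(1)] by (simp add: L.l_minus)
      also have "\<dots> = ev d (\<lambda>z. (\<ominus>\<^bsub>L\<^esub> \<one>\<^bsub>L\<^esub>) \<otimes>\<^bsub>L\<^esub> \<psi> z)"
        using ev_smult_functional[OF dR _ \<psi>(1)] L.K_closed by simp
      finally show "\<ominus>\<^bsub>L\<^esub> a \<in> ?V" using functional_scale[OF \<psi>(1)] L.K_closed by blast
    next
      fix a b assume "a \<in> ?V" "b \<in> ?V"
      then obtain \<psi> \<psi>' where \<psi>: "\<psi> \<in> functionals" "a = ev d \<psi>" "\<psi>' \<in> functionals" "b = ev d \<psi>'" by blast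
      then have "a \<oplus>\<^bsub>L\<^esub> b = ev d (\<lambda>z. \<psi> z \<oplus>\<^bsub>L\<^esub> \<psi>' z)" using ev_add_functional[OF dR] by simp
      then show "a \<oplus>\<^bsub>L\<^esub> b \<in> ?V" using functional_plus \<psi> by blast
    qed
    show "subalgebra_axioms K ?V L"
    proof
      fix k v assume k: "k \<in> K" and "v \<in> ?V"
      then obtain \<psi> where \<psi>: "\<psi> \<in> functionals" "v = ev d \<psi>" by blast
      then have "k \<otimes>\<^bsub>L\<^esub> v = ev d (\<lambda>z. k \<otimes>\<^bsub>L\<^esub> \<psi> z)" using ev_smult_functional[OF dR k] by simp
      then show "k \<otimes>\<^bsub>L\<^esub> v \<in> ?V" using functional_scale[OF \<psi>(1) k] by blast
    qed
  qed
  then have "L.finite_dimension K ?V"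
    using L.subalbegra_incl_imp_finite_dimension[OF L.K_subfield E(1)] E(2) by blast
  moreover have "\<delta> i x \<in> ?V" if i: "i < m" and "x \<in> ?V" for i x
  proof -
    obtain \<psi> where \<psi>: "\<psi> \<in> functionals" "x = ev d \<psi>" using \<open>x \<in> ?V\<close> by blast
    let ?\<psi> = "\<lambda>y. \<delta> i (\<psi> y) \<ominus>\<^bsub>L\<^esub> \<psi> (\<delta> i y)"
    note F = functional_commutator[OF \<psi>(1) i]
    have "\<delta> i (ev d \<psi>) \<ominus>\<^bsub>L\<^esub> ev d ?\<psi> = \<zero>\<^bsub>L\<^esub>"
      using ev_delta[OF i dR \<psi>(1)] d0[OF i] ev_zero[OF \<psi>(1)] by simp
    then have "\<delta> i x = ev d ?\<psi>"
      using ev_closed[OF dR] \<psi> F i by (simp add: L.r_right_minus_eq)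
    then show ?thesis using F by blast
  qed
  ultimately show "L.fin_stable ?V" by (simp add: L.fin_stable_def)
qed blast

text \<open>A factor \<open>\<tau>\<^sub>s l\<close> only shifts the functional, so the values of
  \<open>\<tau>\<^sub>s l\<close> times a constant stay in the stable subspace belonging to that
  constant. Sums are handled by directedness.\<close>

lemma LD_values_stable:
  assumes "p \<in> LD" "\<psi> \<in> functionals"
  shows "\<exists>V. L.fin_stable V \<and> ev p \<psi> \<in> V"
  using assms(1) image_tau_carrier D_carrier
proof (induction p rule: R.subring_prod_induct)
  case zero
  then show ?case using L.fin_stable_base L.K_closed(1) ev_zero[OF assms(2)] by auto
next
  case (step a d p)
  then obtain V where V: "L.fin_stable V" "ev p \<psi> \<in> V" by blast
  obtain l where l: "l \<in> carrier L" "a = \<tau>\<^sub>s l" using step by blast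
  have dR: "d \<in> carrier R" using step D_carrier by blast
  obtain W where W: "L.fin_stable W" "\<forall>\<psi> \<in> functionals. ev d \<psi> \<in> W"
    using constant_values_stable step by blast
  have "ev (a \<otimes>\<^bsub>R\<^esub> d \<oplus>\<^bsub>R\<^esub> p) \<psi> = ev d (\<lambda>z. \<psi> (l \<otimes>\<^bsub>L\<^esub> z)) \<oplus>\<^bsub>L\<^esub> ev p \<psi>"
    using l dR assms(2) LD_carrier step(3) by (simp add: ev_add ev_tau_s)
  moreover have "ev d (\<lambda>z. \<psi> (l \<otimes>\<^bsub>L\<^esub> z)) \<in> W" using W(2) functional_shift[OF assms(2) l(1)] by blast
  ultimately show ?case using L.fin_stable_sum[OF W(1) V(1)] V(2) by metis
qed

text \<open>By \<open>ev_mult_zero\<close> the elements annihilated by all functionals absorb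
  multiplication. If a unit were among them, so would be 1, but a functional with value 1 at 1 does
  not annihilate it.\<close>

lemma unit_value_nonzero:
  assumes r: "r \<in> Units R"
  shows "\<exists>\<psi> \<in> functionals. ev r \<psi> \<noteq> \<zero>\<^bsub>L\<^esub>"
proof (rule ccontr)
  assume *: "\<not> ?thesis"
  obtain \<psi> where \<psi>: "\<psi> \<in> functionals" "\<psi> \<one>\<^bsub>L\<^esub> = \<one>\<^bsub>L\<^esub>"
    using L.exists_functional[OF L.K_subfield L.one_closed] by auto
  have "ev (inv\<^bsub>R\<^esub> r \<otimes>\<^bsub>R\<^esub> r) \<psi> = \<zero>\<^bsub>L\<^esub>"
    using * r \<psi>(1) by (intro ev_mult_zero) auto
  then show False using r \<psi> ev_one[OF \<psi>(1)] by simp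
qed

lemma normal_denominator:
  assumes "delta_normal_wrt L m R \<epsilon> \<tau>\<^sub>s \<tau>\<^sub>t" "a \<in> carrier L"
  shows "\<exists>r \<in> LD \<inter> Units R. \<tau>\<^sub>t a \<otimes>\<^bsub>R\<^esub> r \<in> LD"
  using assms R.subring_compositum_iff[OF image_tau_subring D_subring, of "\<tau>\<^sub>t a"]
  unfolding delta_normal_wrt_def by auto

text \<open>A functional that does not annihilate the denominator r turns the relation between
  \<open>\<tau>\<^sub>t a\<close>, r and their product into an equation in the field
  \<open>L\<close>. It exhibits a as a quotient of two elements of finite-dimensional stable
  subspaces.\<close>

lemma normal_fin_stable_generates:
  assumes normal: "delta_normal_wrt L m R \<epsilon> \<tau>\<^sub>s \<tau>\<^sub>t" and fg: "finitely_delta_generated L K m \<delta>"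
  shows "\<exists>V. L.fin_stable V \<and> K \<subseteq> V \<and> carrier L = generate_field L (K \<union> V)"
proof (rule L.fin_stable_generates[OF fg])
  fix a assume a: "a \<in> carrier L"
  obtain r where r: "r \<in> LD" "r \<in> Units R" "\<tau>\<^sub>t a \<otimes>\<^bsub>R\<^esub> r \<in> LD" using normal_denominator[OF normal a] by blast
  obtain \<psi> where \<psi>: "\<psi> \<in> functionals" "ev r \<psi> \<noteq> \<zero>\<^bsub>L\<^esub>" using unit_value_nonzero[OF r(2)] by blast
  obtain V where V: "L.fin_stable V" "ev r \<psi> \<in> V" using LD_values_stable[OF r(1) \<psi>(1)] by blast
  obtain W where W: "L.fin_stable W" "ev (\<tau>\<^sub>t a \<otimes>\<^bsub>R\<^esub> r) \<psi> \<in> W" using LD_values_stable[OF r(3) \<psi>(1)] by blast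
  obtain U where "L.fin_stable U" "V \<subseteq> U" "W \<subseteq> U" using L.fin_stable_sum[OF V(1) W(1)] by blast
  moreover have "a \<otimes>\<^bsub>L\<^esub> ev r \<psi> = ev (\<tau>\<^sub>t a \<otimes>\<^bsub>R\<^esub> r) \<psi>"
    using ev_tau_t[OF LD_carrier[OF r(1)] a \<psi>(1)] by simp
  ultimately show "\<exists>V t s. L.fin_stable V \<and> t \<in> V \<and> s \<in> V \<and> s \<noteq> \<zero>\<^bsub>L\<^esub> \<and> a \<otimes>\<^bsub>L\<^esub> s = t"
    using V(2) W(2) \<psi>(2) by blast
qed

end

lemma (in ring) subring_finsum:
  assumes P: "subring P R" and "finite A" "\<And>j. j \<in> A \<Longrightarrow> f j \<in> P"
  shows "(\<Oplus>j\<in>A. f j) \<in> P"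
  using assms(2,3)
proof (induction A rule: finite_induct)
  case empty
  then show ?case using subringE(2)[OF P] by simp
next
  case (insert a A)
  then show ?case using subringE(1,7)[OF P] by (subst finsum_insert) auto
qed

section \<open>Linear combinations of constants with coefficients in L\<close>

context tensor_square
begin

text \<open>Coefficients are indexed by the constants themselves and the finite set \<open>F\<close>
  is explicit, which allows one to count the constants in a representation and to speak of their
  independence.\<close>

definition comb :: "'c set \<Rightarrow> ('c \<Rightarrow> 'a) \<Rightarrow> 'c" where
  "comb F l = (\<Oplus>\<^bsub>R\<^esub>d\<in>F. \<tau>\<^sub>s (l d) \<otimes>\<^bsub>R\<^esub> d)"

lemma D_closed: "F \<subseteq> D \<Longrightarrow> d \<in> F \<Longrightarrow> d \<in> carrier R"
  using D_carrier by blast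

lemma comb_cong:
  assumes "F \<subseteq> D" "\<And>d. d \<in> F \<Longrightarrow> l d \<in> carrier L" "\<And>d. d \<in> F \<Longrightarrow> l d = l' d"
  shows "comb F l = comb F l'"
  unfolding comb_def using assms D_carrier by (intro R.finsum_cong' refl) (auto simp: subset_iff)

lemma comb_closed:
  assumes "F \<subseteq> D" "\<And>d. d \<in> F \<Longrightarrow> l d \<in> carrier L"
  shows "comb F l \<in> carrier R"
  unfolding comb_def using assms D_carrier by (intro R.finsum_closed) (auto simp: subset_iff)

lemma comb_add:
  assumes "F \<subseteq> D" "\<And>d. d \<in> F \<Longrightarrow> l d \<in> carrier L" "\<And>d. d \<in> F \<Longrightarrow> l' d \<in> carrier L"
  shows "comb F l \<oplus>\<^bsub>R\<^esub> comb F l' = comb F (\<lambda>d. l d \<oplus>\<^bsub>L\<^esub> l' d)"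
proof -
  have "comb F l \<oplus>\<^bsub>R\<^esub> comb F l' = (\<Oplus>\<^bsub>R\<^esub>d\<in>F. \<tau>\<^sub>s (l d) \<otimes>\<^bsub>R\<^esub> d \<oplus>\<^bsub>R\<^esub> \<tau>\<^sub>s (l' d) \<otimes>\<^bsub>R\<^esub> d)"
    unfolding comb_def using assms D_closed by (intro R.finsum_addf[symmetric]) auto
  also have "\<dots> = comb F (\<lambda>d. l d \<oplus>\<^bsub>L\<^esub> l' d)"
    unfolding comb_def using assms D_closed by (intro R.finsum_cong' refl) (auto simp: R.l_distr)
  finally show ?thesis .
qed

lemma comb_smult:
  assumes "finite F" "F \<subseteq> D" "\<And>d. d \<in> F \<Longrightarrow> l d \<in> carrier L" "c \<in> carrier L"
  shows "\<tau>\<^sub>s c \<otimes>\<^bsub>R\<^esub> comb F l = comb F (\<lambda>d. c \<otimes>\<^bsub>L\<^esub> l d)"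
proof -
  have "\<tau>\<^sub>s c \<otimes>\<^bsub>R\<^esub> comb F l = (\<Oplus>\<^bsub>R\<^esub>d\<in>F. \<tau>\<^sub>s c \<otimes>\<^bsub>R\<^esub> (\<tau>\<^sub>s (l d) \<otimes>\<^bsub>R\<^esub> d))"
    unfolding comb_def using assms D_closed by (intro R.finsum_rdistr) auto
  also have "\<dots> = comb F (\<lambda>d. c \<otimes>\<^bsub>L\<^esub> l d)"
    unfolding comb_def using assms D_closed by (intro R.finsum_cong' refl) (auto simp: R.m_assoc)
  finally show ?thesis .
qed

lemma comb_zero:
  assumes "F \<subseteq> D" "\<And>d. d \<in> F \<Longrightarrow> l d = \<zero>\<^bsub>L\<^esub>"
  shows "comb F l = \<zero>\<^bsub>R\<^esub>"
  unfolding comb_def using assms D_closed by (intro R.add.finprod_one_eqI) auto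

lemma comb_remove:
  assumes "finite F" "F \<subseteq> D" "\<And>d. d \<in> F \<Longrightarrow> l d \<in> carrier L" "q \<in> F" "l q = \<zero>\<^bsub>L\<^esub>"
  shows "comb F l = comb (F - {q}) l"
proof -
  have "comb F l = comb (insert q (F - {q})) l" using assms(4) by (simp add: insert_absorb)
  also have "\<dots> = \<tau>\<^sub>s (l q) \<otimes>\<^bsub>R\<^esub> q \<oplus>\<^bsub>R\<^esub> comb (F - {q}) l"
    unfolding comb_def using assms D_closed[OF assms(2)] by (intro R.finsum_insert) auto
  also have "\<dots> = comb (F - {q}) l"
  proof -
    have "F - {q} \<subseteq> D" using assms(2) by blast
    then show ?thesis
      using assms(3-5) D_closed[OF assms(2)] comb_closed[of "F - {q}" l] by simp
  qed
  finally show ?thesis .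
qed

lemma comb_delta:
  assumes "i < m" "finite F" "F \<subseteq> D" "\<And>d. d \<in> F \<Longrightarrow> l d \<in> carrier L"
  shows "\<epsilon> i (comb F l) = comb F (\<lambda>d. \<delta> i (l d))"
proof -
  have "\<epsilon> i (comb F l) = (\<Oplus>\<^bsub>R\<^esub>d\<in>F. \<epsilon> i (\<tau>\<^sub>s (l d) \<otimes>\<^bsub>R\<^esub> d))"
    unfolding comb_def using assms D_closed by (intro R.delta_finsum) auto
  also have "\<dots> = comb F (\<lambda>d. \<delta> i (l d))"
    unfolding comb_def
  proof (intro R.finsum_cong' refl)
    fix d assume d: "d \<in> F"
    then have "\<epsilon> i d = \<zero>\<^bsub>R\<^esub>" using assms by (auto simp: constants_def)
    then show "\<epsilon> i (\<tau>\<^sub>s (l d) \<otimes>\<^bsub>R\<^esub> d) = \<tau>\<^sub>s (\<delta> i (l d)) \<otimes>\<^bsub>R\<^esub> d"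
      using d assms D_closed[OF assms(3) d] by (simp add: R.delta_mult delta_tau)
  qed (use assms D_closed in auto)
  finally show ?thesis .
qed

lemma comb_lincomb:
  assumes "finite F" "F \<subseteq> D" "\<And>r d. \<lbrakk>r < n; d \<in> F\<rbrakk> \<Longrightarrow> l r d \<in> carrier L"
    "\<And>r. r < n \<Longrightarrow> a r \<in> carrier L"
  shows "(\<Oplus>\<^bsub>R\<^esub>r\<in>{..<n::nat}. \<tau>\<^sub>s (a r) \<otimes>\<^bsub>R\<^esub> comb F (l r)) =
    comb F (\<lambda>d. \<Oplus>\<^bsub>L\<^esub>r\<in>{..<n}. a r \<otimes>\<^bsub>L\<^esub> l r d)"
proof -
  have "(\<Oplus>\<^bsub>R\<^esub>r\<in>{..<n}. \<tau>\<^sub>s (a r) \<otimes>\<^bsub>R\<^esub> comb F (l r)) =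
      (\<Oplus>\<^bsub>R\<^esub>d\<in>F. (\<Oplus>\<^bsub>R\<^esub>r\<in>{..<n}. \<tau>\<^sub>s (a r) \<otimes>\<^bsub>R\<^esub> \<tau>\<^sub>s (l r d)) \<otimes>\<^bsub>R\<^esub> d)"
    unfolding comb_def using assms D_closed by (intro R.finsum_assoc) auto
  also have "\<dots> = comb F (\<lambda>d. \<Oplus>\<^bsub>L\<^esub>r\<in>{..<n}. a r \<otimes>\<^bsub>L\<^esub> l r d)"
    unfolding comb_def
  proof (intro R.finsum_cong' refl)
    fix d assume d: "d \<in> F"
    have "(\<Oplus>\<^bsub>R\<^esub>r\<in>{..<n}. \<tau>\<^sub>s (a r) \<otimes>\<^bsub>R\<^esub> \<tau>\<^sub>s (l r d)) =
        (\<Oplus>\<^bsub>R\<^esub>r\<in>{..<n}. (\<tau>\<^sub>s \<circ> (\<lambda>r. a r \<otimes>\<^bsub>L\<^esub> l r d)) r)"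
      using assms d by (intro R.finsum_cong' refl) auto
    also have "\<dots> = \<tau>\<^sub>s (\<Oplus>\<^bsub>L\<^esub>r\<in>{..<n}. a r \<otimes>\<^bsub>L\<^esub> l r d)"
      using assms d by (intro s.hom_finsum[symmetric]) auto
    finally show "(\<Oplus>\<^bsub>R\<^esub>r\<in>{..<n}. \<tau>\<^sub>s (a r) \<otimes>\<^bsub>R\<^esub> \<tau>\<^sub>s (l r d)) \<otimes>\<^bsub>R\<^esub> d =
        \<tau>\<^sub>s (\<Oplus>\<^bsub>L\<^esub>r\<in>{..<n}. a r \<otimes>\<^bsub>L\<^esub> l r d) \<otimes>\<^bsub>R\<^esub> d" by simp
  next
    show "(\<lambda>d. \<tau>\<^sub>s (\<Oplus>\<^bsub>L\<^esub>r\<in>{..<n}. a r \<otimes>\<^bsub>L\<^esub> l r d) \<otimes>\<^bsub>R\<^esub> d) \<in> F \<rightarrow> carrier R"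
      using assms D_closed[OF assms(2)] by (auto intro!: R.m_closed s.hom_closed L.finsum_closed)
  qed
  finally show ?thesis .
qed

lemma comb_extend:
  assumes "finite G" "F \<subseteq> G" "G \<subseteq> D" "\<And>d. d \<in> F \<Longrightarrow> l d \<in> carrier L"
  shows "comb G (\<lambda>d. if d \<in> F then l d else \<zero>\<^bsub>L\<^esub>) = comb F l"
  unfolding comb_def using assms D_carrier
  by (intro R.add.finprod_mono_neutral_cong_right) (auto simp: subset_iff)

lemma LD_comb:
  assumes "x \<in> LD"
  shows "\<exists>F l. finite F \<and> F \<subseteq> D \<and> (\<forall>d. l d \<in> carrier L) \<and> x = comb F l"
  using assms image_tau_carrier D_carrier
proof (induction x rule: R.subring_prod_induct)
  case zero
  show ?case by (intro exI[of _ "{}"] exI[of _ "\<lambda>_. \<zero>\<^bsub>L\<^esub>"]) (auto simp: comb_def)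
next
  case (step a d p)
  then obtain F l where F: "finite F" "F \<subseteq> D" "\<And>d. l d \<in> carrier L" "p = comb F l" by blast
  obtain b where b: "b \<in> carrier L" "a = \<tau>\<^sub>s b" using step by blast
  have dR: "d \<in> carrier R" using step D_carrier by blast
  have "comb {d} (\<lambda>_. b) = a \<otimes>\<^bsub>R\<^esub> d"
    unfolding comb_def using b dR by simp
  moreover have G: "finite (insert d F)" "insert d F \<subseteq> D" using F step by auto
  \<comment> \<open>\<open>d\<close> may already occur in \<open>F\<close>, so both summands are
    first extended by zero to \<open>insert d F\<close> and then added coefficientwise.\<close>
  moreover have "comb (insert d F) (\<lambda>e. if e \<in> {d} then b else \<zero>\<^bsub>L\<^esub>) = comb {d} (\<lambda>_. b)"
    using G b by (intro comb_extend) auto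
  moreover have "comb (insert d F) (\<lambda>e. if e \<in> F then l e else \<zero>\<^bsub>L\<^esub>) = comb F l"
    using G F by (intro comb_extend) auto
  ultimately have "a \<otimes>\<^bsub>R\<^esub> d \<oplus>\<^bsub>R\<^esub> p = comb (insert d F)
      (\<lambda>e. (if e \<in> {d} then b else \<zero>\<^bsub>L\<^esub>) \<oplus>\<^bsub>L\<^esub> (if e \<in> F then l e else \<zero>\<^bsub>L\<^esub>))"
    using F b by (subst comb_add[symmetric]) auto
  then show ?case using G F(3) b(1) by (intro exI conjI) auto
qed

text \<open>A single \<open>F\<close> serves all r, so that for fixed d the coefficients
  \<open>l r d\<close> form a column. These columns are the future solutions.\<close>

lemma LD_comb_family:
  assumes "\<And>r. r < n \<Longrightarrow> x r \<in> LD"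
  shows "\<exists>F l. finite F \<and> F \<subseteq> D \<and> (\<forall>r d. l r d \<in> carrier L) \<and> (\<forall>r<n::nat. x r = comb F (l r))"
proof -
  have "\<forall>r. \<exists>F l. r < n \<longrightarrow> finite F \<and> F \<subseteq> D \<and> (\<forall>d. l d \<in> carrier L) \<and> x r = comb F l"
    using LD_comb assms by meson
  then obtain F l where Fl: "\<And>r. r < n \<Longrightarrow> finite (F r) \<and> F r \<subseteq> D \<and> (\<forall>d. l r d \<in> carrier L) \<and> x r = comb (F r) (l r)"
    by metis
  let ?G = "\<Union>r<n. F r"
  have G: "finite ?G" "?G \<subseteq> D" using Fl by auto
  show ?thesis
  proof (intro exI conjI allI impI)
    show "finite ?G" "?G \<subseteq> D" using G .
    show "(if r < n \<and> d \<in> F r then l r d else \<zero>\<^bsub>L\<^esub>) \<in> carrier L" for r d using Fl by auto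
    show "x r = comb ?G (\<lambda>d. if r < n \<and> d \<in> F r then l r d else \<zero>\<^bsub>L\<^esub>)" if r: "r < n" for r
    proof -
      have "comb ?G (\<lambda>d. if d \<in> F r then l r d else \<zero>\<^bsub>L\<^esub>) = comb (F r) (l r)"
        using Fl[OF r] r by (intro comb_extend[OF G(1) _ G(2)]) auto
      then show ?thesis using Fl[OF r] r by simp
    qed
  qed
qed

lemma LD_delta: "\<lbrakk>i < m; x \<in> LD\<rbrakk> \<Longrightarrow> \<epsilon> i x \<in> LD"
proof -
  assume i: "i < m" and "x \<in> LD"
  then obtain F l where F: "finite F" "F \<subseteq> D" "\<forall>d. l d \<in> carrier L" "x = comb F l" using LD_comb by blast
  then have "\<epsilon> i x = comb F (\<lambda>d. \<delta> i (l d))" using comb_delta[OF i] by blast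
  also have "\<dots> \<in> LD"
    unfolding comb_def using F i image_tau_carrier D_carrier
    by (intro R.subring_finsum[OF LD_subring] R.subring_prod_tensor) auto
  finally show ?thesis .
qed

text \<open>
  Induction on the number of terms of \<open>x = \<Sum> l\<^sub>d d\<close>. After normalising one coefficient to \<open>1\<close>, either
  all coefficients are constant, or some derivative \<open>\<epsilon> x\<close> has a coefficient \<open>\<delta> l\<^sub>q \<noteq> 0\<close>; then both
  \<open>\<epsilon> x\<close> and \<open>x - (l\<^sub>q / \<delta> l\<^sub>q) \<epsilon> x\<close> have fewer terms.
\<close>

lemma stable_subspace_generated_by_constants:
  assumes N: "N \<subseteq> carrier R" and Nadd: "\<And>x y. \<lbrakk>x \<in> N; y \<in> N\<rbrakk> \<Longrightarrow> x \<oplus>\<^bsub>R\<^esub> y \<in> N"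
    and Nsm: "\<And>a x. \<lbrakk>a \<in> carrier L; x \<in> N\<rbrakk> \<Longrightarrow> \<tau>\<^sub>s a \<otimes>\<^bsub>R\<^esub> x \<in> N"
    and Nd: "\<And>i x. \<lbrakk>i < m; x \<in> N\<rbrakk> \<Longrightarrow> \<epsilon> i x \<in> N"
    and "x \<in> N" "x \<in> LD"
  shows "x \<in> subring_prod R (\<tau>\<^sub>s ` carrier L) (N \<inter> D)" (is "x \<in> ?Q")
proof -
  have ND: "N \<inter> D \<subseteq> carrier R" using N by blast
  note Qadd = R.subring_prod_add[OF image_tau_carrier ND]
  have Qsm: "\<tau>\<^sub>s a \<otimes>\<^bsub>R\<^esub> x \<in> ?Q" if "a \<in> carrier L" "x \<in> ?Q" for a x
    using that by (intro R.subring_prod_left_mult[OF image_tau_subring ND]) auto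
  have "comb F l \<in> ?Q" if "finite F" "F \<subseteq> D" "\<forall>d. l d \<in> carrier L" "comb F l \<in> N" for F l
    using that
  proof (induction "card F" arbitrary: F l rule: less_induct)
    case less
    \<comment> \<open>The induction hypothesis in the form needed: a combination over the same
      \<open>F\<close> with at least one vanishing coefficient.\<close>
    have IH: "comb F l \<in> ?Q" if "q \<in> F" "l q = \<zero>\<^bsub>L\<^esub>" "\<forall>d. l d \<in> carrier L" "comb F l \<in> N" for q l
    proof -
      have e: "comb F l = comb (F - {q}) l" using comb_remove that less.prems by auto
      moreover have "comb (F - {q}) l \<in> ?Q"
        using that less.prems e by (intro less.hyps card_Diff1_less) auto
      ultimately show ?thesis by simp
    qed
    show ?case
    proof (cases "\<exists>q\<in>F. l q \<noteq> \<zero>\<^bsub>L\<^esub>")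
      case False
      then have "comb F l = \<zero>\<^bsub>R\<^esub>" using comb_zero less.prems by auto
      then show ?thesis using R.subring_prod_zero[OF image_tau_carrier ND] by simp
    next
      case True
      then obtain q where q: "q \<in> F" "l q \<noteq> \<zero>\<^bsub>L\<^esub>" by blast
      have lq: "l q \<in> Units L" "l q \<in> carrier L" using q(2) less.prems L.field_Units by auto
      define a where "a = inv\<^bsub>L\<^esub> (l q)"
      have a: "a \<in> carrier L" "a \<otimes>\<^bsub>L\<^esub> l q = \<one>\<^bsub>L\<^esub>" "l q \<otimes>\<^bsub>L\<^esub> a = \<one>\<^bsub>L\<^esub>" unfolding a_def using lq by auto
      define k where "k d = a \<otimes>\<^bsub>L\<^esub> l d" for d
      have k: "\<forall>d. k d \<in> carrier L" "k q = \<one>\<^bsub>L\<^esub>" unfolding k_def using a less.prems by auto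
      have ke: "comb F k = \<tau>\<^sub>s a \<otimes>\<^bsub>R\<^esub> comb F l" unfolding k_def using comb_smult a less.prems by auto
      have kN: "comb F k \<in> N" unfolding ke using Nsm a less.prems by auto
      have "comb F k \<in> ?Q"
      proof (cases "\<exists>i<m. \<exists>p\<in>F. \<delta> i (k p) \<noteq> \<zero>\<^bsub>L\<^esub>")
        case False
        then have "\<epsilon> i (comb F k) = \<zero>\<^bsub>R\<^esub>" if "i < m" for i
          using that comb_delta[OF that less.prems(1,2), of k] k comb_zero[OF less.prems(2), of "\<lambda>d. \<delta> i (k d)"] by auto
        then have "comb F k \<in> N \<inter> D" using kN N by (auto simp: constants_def)
        then have "\<tau>\<^sub>s \<one>\<^bsub>L\<^esub> \<otimes>\<^bsub>R\<^esub> comb F k \<in> ?Q"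
          by (intro R.subring_prod_tensor[OF image_tau_carrier ND] imageI L.one_closed)
        then show ?thesis using kN N by auto
      next
        case True
        then obtain i p where i: "i < m" and p: "p \<in> F" "\<delta> i (k p) \<noteq> \<zero>\<^bsub>L\<^esub>" by blast
        define y where "y = comb F (\<lambda>d. if d \<in> F then \<delta> i (k d) else \<zero>\<^bsub>L\<^esub>)"
        have yk: "y = \<epsilon> i (comb F k)"
          unfolding y_def using comb_delta[OF i less.prems(1,2), of k] k i
            comb_cong[OF less.prems(2), of "\<lambda>d. \<delta> i (k d)" "\<lambda>d. if d \<in> F then \<delta> i (k d) else \<zero>\<^bsub>L\<^esub>"] by auto
        have yN: "y \<in> N" unfolding yk using Nd i kN by blast
        \<comment> \<open>The coefficient of \<open>y\<close> at \<open>q\<close> is the derivative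
          of 1, hence zero; this is the purpose of the normalisation.\<close>
        have yQ: "y \<in> ?Q"
          using yN unfolding y_def using q k i by (intro IH[of q]) auto
        \<comment> \<open>Chosen so that the coefficient of \<open>z\<close> at \<open>p\<close>
          vanishes.\<close>
        define g where "g = k p \<otimes>\<^bsub>L\<^esub> inv\<^bsub>L\<^esub> (\<delta> i (k p))"
        have kp: "k p \<in> carrier L" "\<delta> i (k p) \<in> carrier L" using k(1) i by simp_all
        then have dk: "\<delta> i (k p) \<in> Units L" using p(2) by (simp add: L.field_Units)
        have g: "g \<in> carrier L" "g \<otimes>\<^bsub>L\<^esub> \<delta> i (k p) = k p"
          unfolding g_def using dk kp by (simp_all add: L.m_assoc)
        define z where "z = comb F (\<lambda>d. k d \<oplus>\<^bsub>L\<^esub> (\<ominus>\<^bsub>L\<^esub> g) \<otimes>\<^bsub>L\<^esub> (if d \<in> F then \<delta> i (k d) else \<zero>\<^bsub>L\<^esub>))"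
        have ze: "z = comb F k \<oplus>\<^bsub>R\<^esub> \<tau>\<^sub>s (\<ominus>\<^bsub>L\<^esub> g) \<otimes>\<^bsub>R\<^esub> y"
          unfolding z_def y_def using less.prems k g i by (subst comb_smult) (auto intro!: comb_add[symmetric])
        have zN: "z \<in> N" unfolding ze using Nadd[OF kN Nsm[OF L.a_inv_closed[OF g(1)] yN]] .
        have zQ: "z \<in> ?Q"
        proof -
          have "k p \<oplus>\<^bsub>L\<^esub> (\<ominus>\<^bsub>L\<^esub> g) \<otimes>\<^bsub>L\<^esub> \<delta> i (k p) = \<zero>\<^bsub>L\<^esub>"
            using g i k by (simp add: L.l_minus L.r_neg)
          then have "(\<lambda>d. k d \<oplus>\<^bsub>L\<^esub> (\<ominus>\<^bsub>L\<^esub> g) \<otimes>\<^bsub>L\<^esub> (if d \<in> F then \<delta> i (k d) else \<zero>\<^bsub>L\<^esub>)) p = \<zero>\<^bsub>L\<^esub>"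
            using p(1) by (simp only: if_True)
          moreover have "\<forall>d. k d \<oplus>\<^bsub>L\<^esub> (\<ominus>\<^bsub>L\<^esub> g) \<otimes>\<^bsub>L\<^esub> (if d \<in> F then \<delta> i (k d) else \<zero>\<^bsub>L\<^esub>) \<in> carrier L"
            using k(1) g(1) i by simp
          ultimately show ?thesis using zN p(1) unfolding z_def by (intro IH[of p])
        qed
        have "comb F k = z \<oplus>\<^bsub>R\<^esub> \<tau>\<^sub>s g \<otimes>\<^bsub>R\<^esub> y"
        proof -
          have c: "comb F k \<in> carrier R" "y \<in> carrier R" using kN yN N by auto
          have "z \<oplus>\<^bsub>R\<^esub> \<tau>\<^sub>s g \<otimes>\<^bsub>R\<^esub> y = comb F k \<oplus>\<^bsub>R\<^esub> (\<ominus>\<^bsub>R\<^esub> (\<tau>\<^sub>s g \<otimes>\<^bsub>R\<^esub> y) \<oplus>\<^bsub>R\<^esub> \<tau>\<^sub>s g \<otimes>\<^bsub>R\<^esub> y)"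
            unfolding ze using c g by (simp add: R.a_assoc R.l_minus)
          then show ?thesis using c g by (simp add: R.l_neg)
        qed
        then show ?thesis using Qadd[OF zQ Qsm[OF g(1) yQ]] by simp
      qed
      then have "\<tau>\<^sub>s (l q) \<otimes>\<^bsub>R\<^esub> comb F k \<in> ?Q" using Qsm lq by blast
      moreover have "\<tau>\<^sub>s (l q) \<otimes>\<^bsub>R\<^esub> comb F k = comb F l"
      proof -
        have "comb F l \<in> carrier R" using less.prems N by blast
        then show ?thesis unfolding ke using lq a
          by (simp add: R.m_assoc[symmetric] s.hom_mult[symmetric] del: s.hom_mult)
      qed
      ultimately show ?thesis by simp
    qed
  qed
  then show ?thesis using LD_comb[OF assms(6)] assms(5) by blast
qed

text \<open>A representation with the least number of constants has linearly independent constants.\<close>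

lemma LD_comb_family_independent:
  assumes "\<And>r. r < n \<Longrightarrow> x r \<in> LD"
  obtains F l where "finite F" "F \<subseteq> D" "\<And>r d. l r d \<in> carrier L" "\<And>r. r < (n::nat) \<Longrightarrow> x r = comb F (l r)"
    "\<And>g d. \<lbrakk>\<And>d. g d \<in> carrier L; comb F g = \<zero>\<^bsub>R\<^esub>; d \<in> F\<rbrakk> \<Longrightarrow> g d = \<zero>\<^bsub>L\<^esub>"
proof -
  define rep where "rep F l \<longleftrightarrow> finite F \<and> F \<subseteq> D \<and> (\<forall>r d. l r d \<in> carrier L) \<and> (\<forall>r<n. x r = comb F (l r))" for F l
  obtain F\<^sub>0 where F\<^sub>0: "\<exists>l. rep F\<^sub>0 l"
    using LD_comb_family[of n x, OF assms] unfolding rep_def by blast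
  have "\<exists>F. (\<exists>l. rep F l) \<and> (\<forall>G. (\<exists>l. rep G l) \<longrightarrow> card F \<le> card G)"
    by (rule ex_has_least_nat) (rule F\<^sub>0)
  then obtain F where F: "\<exists>l. rep F l" and least: "\<And>G. \<exists>l. rep G l \<Longrightarrow> card F \<le> card G"
    by blast
  obtain l where l: "rep F l" using F by blast
  have fin: "finite F" "F \<subseteq> D" and lc: "\<And>r d. l r d \<in> carrier L" and xl: "\<And>r. r < n \<Longrightarrow> x r = comb F (l r)"
    using l by (auto simp: rep_def)
  show thesis
  proof (rule that[OF fin lc xl])
    fix g d assume g: "\<And>d. g d \<in> carrier L" and g0: "comb F g = \<zero>\<^bsub>R\<^esub>" and d: "d \<in> F"
    show "g d = \<zero>\<^bsub>L\<^esub>"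
    proof (rule ccontr)
      assume nz: "g d \<noteq> \<zero>\<^bsub>L\<^esub>"
      then have u: "g d \<in> Units L" using g L.field_Units by auto
      define a where "a r = \<ominus>\<^bsub>L\<^esub> (l r d \<otimes>\<^bsub>L\<^esub> inv\<^bsub>L\<^esub> (g d))" for r
      have a: "a r \<in> carrier L" "l r d \<oplus>\<^bsub>L\<^esub> a r \<otimes>\<^bsub>L\<^esub> g d = \<zero>\<^bsub>L\<^esub>" for r
        unfolding a_def using u lc g by (auto simp: L.l_minus L.m_assoc L.r_neg)
      define l' where "l' r e = l r e \<oplus>\<^bsub>L\<^esub> a r \<otimes>\<^bsub>L\<^esub> g e" for r e
      have l'c: "l' r e \<in> carrier L" for r e unfolding l'_def using lc a g by auto
      have "x r = comb (F - {d}) (l' r)" if "r < n" for r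
      proof -
        have "x r = comb F (l r) \<oplus>\<^bsub>R\<^esub> \<tau>\<^sub>s (a r) \<otimes>\<^bsub>R\<^esub> comb F g"
          using xl[OF that] g0 a(1) comb_closed[OF fin(2), of "l r"] lc by auto
        also have "\<dots> = comb F (l' r)"
          unfolding l'_def using fin a g lc by (subst comb_smult) (auto intro!: comb_add)
        also have "\<dots> = comb (F - {d}) (l' r)"
          using fin d l'c a(2) by (intro comb_remove) (auto simp: l'_def)
        finally show ?thesis .
      qed
      then have "rep (F - {d}) l'" using fin l'c by (auto simp: rep_def)
      then have "card F \<le> card (F - {d})" using least by blast
      then show False using fin(1) d by (metis card_Diff1_less linorder_not_le)
    qed
  qed
qed

end

section \<open>Solutions of the system and the fundamental matrix\<close>

text \<open>
  Starting from the identity matrix, the columns are exchanged one after the other for elements of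
  \<open>X'\<close>, and the inverse is updated along with them.
\<close>

lemma (in field) invertible_matrix_of_separating_columns:
  assumes Xc: "\<And>l r. \<lbrakk>l \<in> X'; r < n\<rbrakk> \<Longrightarrow> l r \<in> carrier R"
    and sep: "\<And>c. \<lbrakk>\<And>r. r < n \<Longrightarrow> c r \<in> carrier R; \<exists>r<n. c r \<noteq> \<zero>\<rbrakk> \<Longrightarrow>
      \<exists>l\<in>X'. (\<Oplus>r\<in>{..<n::nat}. c r \<otimes> l r) \<noteq> \<zero>"
  shows "\<exists>Y \<in> GL n R. \<forall>q<n. (\<lambda>r. Y r q) \<in> X'"
proof -
  have "\<exists>Y \<in> matrices n (carrier R). \<exists>Z \<in> matrices n (carrier R).
      (\<forall>r<n. \<forall>c<n. mat_mult R n Y Z r c = (if r = c then \<one> else \<zero>)) \<and>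
      (\<forall>r<n. \<forall>c<n. mat_mult R n Z Y r c = (if r = c then \<one> else \<zero>)) \<and> (\<forall>q<p. (\<lambda>r. Y r q) \<in> X')"
    if "p \<le> n" for p
    using that
  proof (induction p)
    case 0
    let ?I = "\<lambda>r c. if r = c then \<one> else \<zero>"
    have "mat_mult R n ?I ?I r c = (if r = c then \<one> else \<zero>)" if "r < n" "c < n" for r c
      unfolding mat_mult_def using that by (intro finsum_unit_vector) auto
    moreover have "?I \<in> matrices n (carrier R)" by (auto simp: matrices_def)
    ultimately show ?case by (intro bexI[of _ ?I]) auto
  next
    case (Suc p)
    then obtain Y Z where Y: "Y \<in> matrices n (carrier R)" and Z: "Z \<in> matrices n (carrier R)"
      and YZ: "\<And>r c. r < n \<Longrightarrow> c < n \<Longrightarrow> mat_mult R n Y Z r c = (if r = c then \<one> else \<zero>)"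
      and ZY: "\<And>r c. r < n \<Longrightarrow> c < n \<Longrightarrow> mat_mult R n Z Y r c = (if r = c then \<one> else \<zero>)"
      and YX: "\<And>q. q < p \<Longrightarrow> (\<lambda>r. Y r q) \<in> X'" by (auto simp: Suc_le_eq)
    have p: "p < n" using Suc.prems by simp
    have Yc: "\<And>r c. r < n \<Longrightarrow> c < n \<Longrightarrow> Y r c \<in> carrier R"
      and Zc: "\<And>r c. r < n \<Longrightarrow> c < n \<Longrightarrow> Z r c \<in> carrier R"
      using Y Z by (auto simp: matrices_def)
    have "\<exists>r<n. Z p r \<noteq> \<zero>"
    proof (rule ccontr)
      assume "\<not> ?thesis"
      then have "mat_mult R n Z Y p p = \<zero>"
        unfolding mat_mult_def using Yc p by (intro add.finprod_one_eqI) auto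
      then show False using ZY[OF p p] by simp
    qed
    \<comment> \<open>Row \<open>p\<close> of \<open>Z\<close> is orthogonal to all columns of
      \<open>Y\<close> except column \<open>p\<close>. A column \<open>l\<close> not orthogonal to
      that row is therefore independent of the other columns and can replace column
      \<open>p\<close>.\<close>
    then obtain l where l: "l \<in> X'" and nz: "(\<Oplus>r\<in>{..<n}. Z p r \<otimes> l r) \<noteq> \<zero>"
      using sep[of "Z p"] Zc p by auto
    have lc: "\<And>r. r < n \<Longrightarrow> l r \<in> carrier R" using Xc l by blast
    define e where "e q = (\<Oplus>r\<in>{..<n}. Z q r \<otimes> l r)" for q
    have ec: "e q \<in> carrier R" if "q < n" for q
      unfolding e_def using that Zc lc by (intro finsum_closed) auto
    have eu: "e p \<in> Units R" using nz ec[OF p] by (simp add: field_Units e_def)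
    define f where "f = inv (e p)"
    have f: "f \<in> carrier R" "f \<otimes> e p = \<one>" "e p \<otimes> f = \<one>" unfolding f_def using eu by auto
    define z where "z r = f \<otimes> Z p r" for r
    have zc: "z r \<in> carrier R" if "r < n" for r unfolding z_def using that f Zc p by simp
    have ZYe: "(\<Oplus>r\<in>{..<n}. Z q r \<otimes> Y r c) = (if q = c then \<one> else \<zero>)" if "q < n" "c < n" for q c
      using ZY[OF that] by (simp add: mat_mult_def)
    have zdot: "(\<Oplus>r\<in>{..<n}. z r \<otimes> x r) = f \<otimes> (\<Oplus>r\<in>{..<n}. Z p r \<otimes> x r)"
      if "\<And>r. r < n \<Longrightarrow> x r \<in> carrier R" for x
    proof -
      have "(\<Oplus>r\<in>{..<n}. z r \<otimes> x r) = (\<Oplus>r\<in>{..<n}. f \<otimes> (Z p r \<otimes> x r))"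
        unfolding z_def using f Zc p that by (intro finsum_cong' refl) (auto simp: m_assoc)
      also have "\<dots> = f \<otimes> (\<Oplus>r\<in>{..<n}. Z p r \<otimes> x r)"
        using f Zc p that by (intro finsum_rdistr[symmetric]) auto
      finally show ?thesis .
    qed
    \<comment> \<open>\<open>Y' = Y E\<close>, where \<open>E\<close> is the identity with column
      \<open>p\<close> replaced by \<open>e\<close>, the coordinates of \<open>l\<close> in the
      columns of \<open>Y\<close>. \<open>Z'\<close> is the inverse of \<open>E\<close> times
      \<open>Z\<close>: row \<open>p\<close> is divided by the pivot \<open>e p\<close>, and
      multiples of the result are subtracted from the other rows.\<close>
    define Y' where "Y' r q = (if q = p then l r else Y r q)" for r q
    define Z' where "Z' q r = (if q = p then z r else Z q r \<oplus> (\<ominus> e q) \<otimes> z r)" for q r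
    have Y'c: "Y' r q \<in> carrier R" if "r < n" "q < n" for r q unfolding Y'_def using that lc Yc by simp
    have Z'c: "Z' q r \<in> carrier R" if "r < n" "q < n" for r q unfolding Z'_def using that Zc zc ec by simp
    have dot: "(\<Oplus>r\<in>{..<n}. Z' q r \<otimes> x r) =
        (if q = p then f \<otimes> (\<Oplus>r\<in>{..<n}. Z p r \<otimes> x r)
         else (\<Oplus>r\<in>{..<n}. Z q r \<otimes> x r) \<oplus> (\<ominus> e q) \<otimes> (f \<otimes> (\<Oplus>r\<in>{..<n}. Z p r \<otimes> x r)))"
      if x: "\<And>r. r < n \<Longrightarrow> x r \<in> carrier R" and q: "q < n" for x q
    proof (cases "q = p")
      case True
      then show ?thesis using zdot[OF x] by (simp add: Z'_def)
    next
      case False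
      then have "(\<Oplus>r\<in>{..<n}. Z' q r \<otimes> x r) = (\<Oplus>r\<in>{..<n}. Z q r \<otimes> x r \<oplus> (\<ominus> e q) \<otimes> (z r \<otimes> x r))"
        unfolding Z'_def using x q Zc zc ec by (intro finsum_cong' refl) (auto simp: l_distr m_assoc l_minus)
      also have "\<dots> = (\<Oplus>r\<in>{..<n}. Z q r \<otimes> x r) \<oplus> (\<Oplus>r\<in>{..<n}. (\<ominus> e q) \<otimes> (z r \<otimes> x r))"
        using x q Zc zc ec by (intro finsum_addf) auto
      also have "(\<Oplus>r\<in>{..<n}. (\<ominus> e q) \<otimes> (z r \<otimes> x r)) = (\<ominus> e q) \<otimes> (\<Oplus>r\<in>{..<n}. z r \<otimes> x r)"
        using x q zc ec by (intro finsum_rdistr[symmetric]) auto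
      finally show ?thesis using False zdot[OF x] by simp
    qed
    have "mat_mult R n Z' Y' q c = (if q = c then \<one> else \<zero>)" if q: "q < n" and c: "c < n" for q c
    proof (cases "c = p")
      case True
      then have "mat_mult R n Z' Y' q c = (\<Oplus>r\<in>{..<n}. Z' q r \<otimes> l r)"
        by (simp add: mat_mult_def Y'_def)
      also have "\<dots> = (if q = p then f \<otimes> e p else e q \<oplus> (\<ominus> e q) \<otimes> (f \<otimes> e p))"
        unfolding e_def using dot[OF lc q] by (simp add: e_def)
      also have "\<dots> = (if q = c then \<one> else \<zero>)"
        using f ec[OF q] True by (simp add: l_minus r_neg)
      finally show ?thesis .
    next
      case False
      then have "mat_mult R n Z' Y' q c = (\<Oplus>r\<in>{..<n}. Z' q r \<otimes> Y r c)"
        by (simp add: mat_mult_def Y'_def)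
      also have "\<dots> = (if q = p then f \<otimes> \<zero> else (if q = c then \<one> else \<zero>) \<oplus> (\<ominus> e q) \<otimes> (f \<otimes> \<zero>))"
        using dot[of "\<lambda>r. Y r c", OF _ q] Yc c ZYe[OF q c] ZYe[OF p c] False by auto
      also have "\<dots> = (if q = c then \<one> else \<zero>)"
        using f ec[OF q] False by auto
      finally show ?thesis .
    qed
    moreover have "mat_mult R n Y' Z' r c = (if r = c then \<one> else \<zero>)" if r: "r < n" and c: "c < n" for r c
    proof -
      have Ye: "(\<Oplus>q\<in>{..<n}. Y r q \<otimes> e q) = l r"
      proof -
        have "(\<Oplus>q\<in>{..<n}. Y r q \<otimes> e q) = (\<Oplus>s\<in>{..<n}. mat_mult R n Y Z r s \<otimes> l s)"
          unfolding e_def mat_mult_def using r Yc Zc lc by (intro finsum_assoc) auto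
        also have "\<dots> = (\<Oplus>s\<in>{..<n}. (if r = s then \<one> else \<zero>) \<otimes> l s)"
          using r YZ lc by (intro finsum_cong' refl) auto
        also have "\<dots> = l r" using r lc by (intro finsum_unit_vector) auto
        finally show ?thesis .
      qed
      \<comment> \<open>A form uniform in \<open>q\<close>, so that the sum can be split. At
        \<open>q = p\<close> the bracket vanishes because \<open>e p \<otimes> z c = Z p c\<close>,
        and the last term supplies the new column.\<close>
      have summand: "Y' r q \<otimes> Z' q c = (Y r q \<otimes> Z q c \<oplus> (Y r q \<otimes> e q) \<otimes> (\<ominus> z c)) \<oplus> (if p = q then l r \<otimes> z c else \<zero>)"
        if q: "q < n" for q
      proof (cases "q = p")
        case True
        have "e p \<otimes> z c = Z p c"
          unfolding z_def using f ec[OF p] Zc[OF p c] by (simp add: m_assoc[symmetric])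
        then have "Y r p \<otimes> Z p c \<oplus> (Y r p \<otimes> e p) \<otimes> (\<ominus> z c) = \<zero>"
          using Yc[OF r p] Zc[OF p c] ec[OF p] zc[OF c] by (simp add: m_assoc r_minus r_neg)
        then show ?thesis using True lc r zc c by (simp add: Y'_def Z'_def)
      next
        case False
        then show ?thesis
          using Yc[OF r q] Zc[OF q c] ec[OF q] zc[OF c]
          by (simp add: Y'_def Z'_def r_distr l_minus r_minus m_assoc)
      qed
      have "mat_mult R n Y' Z' r c =
          (\<Oplus>q\<in>{..<n}. (Y r q \<otimes> Z q c \<oplus> (Y r q \<otimes> e q) \<otimes> (\<ominus> z c)) \<oplus> (if p = q then l r \<otimes> z c else \<zero>))"
        unfolding mat_mult_def using r c Yc Zc ec zc lc by (intro finsum_cong' refl) (auto simp: summand)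
      also have "\<dots> = (\<Oplus>q\<in>{..<n}. Y r q \<otimes> Z q c \<oplus> (Y r q \<otimes> e q) \<otimes> (\<ominus> z c))
          \<oplus> (\<Oplus>q\<in>{..<n}. if p = q then l r \<otimes> z c else \<zero>)"
        using r c Yc Zc ec zc lc by (intro finsum_addf) auto
      also have "(\<Oplus>q\<in>{..<n}. if p = q then l r \<otimes> z c else \<zero>) = l r \<otimes> z c"
        using p r c lc zc finsum_singleton[of p "{..<n}" "\<lambda>_. l r \<otimes> z c"] by auto
      also have "(\<Oplus>q\<in>{..<n}. Y r q \<otimes> Z q c \<oplus> (Y r q \<otimes> e q) \<otimes> (\<ominus> z c)) =
          (\<Oplus>q\<in>{..<n}. Y r q \<otimes> Z q c) \<oplus> (\<Oplus>q\<in>{..<n}. (Y r q \<otimes> e q) \<otimes> (\<ominus> z c))"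
        using r c Yc Zc ec zc by (intro finsum_addf) auto
      also have "(\<Oplus>q\<in>{..<n}. (Y r q \<otimes> e q) \<otimes> (\<ominus> z c)) = l r \<otimes> (\<ominus> z c)"
        unfolding Ye[symmetric] using r c Yc ec zc by (intro finsum_ldistr[symmetric]) auto
      also have "(\<Oplus>q\<in>{..<n}. Y r q \<otimes> Z q c) = (if r = c then \<one> else \<zero>)"
        using YZ[OF r c] by (simp add: mat_mult_def)
      also have "(if r = c then \<one> else \<zero>) \<oplus> l r \<otimes> (\<ominus> z c) \<oplus> l r \<otimes> z c = (if r = c then \<one> else \<zero>)"
        using lc[OF r] zc[OF c] by (simp add: a_assoc r_minus l_neg)
      finally show ?thesis .
    qed
    moreover have "(\<lambda>r. Y' r q) \<in> X'" if "q < Suc p" for q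
      using that YX[of q] l by (cases "q = p") (auto simp: Y'_def)
    moreover have "Y' \<in> matrices n (carrier R)" "Z' \<in> matrices n (carrier R)"
      using Y'c Z'c by (auto simp: matrices_def)
    ultimately show ?case by blast
  qed
  from this[OF order_refl] obtain Y Z where Y: "Y \<in> matrices n (carrier R)" and Z: "Z \<in> matrices n (carrier R)"
    and YZ: "\<forall>r<n. \<forall>c<n. mat_mult R n Y Z r c = (if r = c then \<one> else \<zero>)"
    and ZY: "\<forall>r<n. \<forall>c<n. mat_mult R n Z Y r c = (if r = c then \<one> else \<zero>)"
    and col: "\<forall>q<n. (\<lambda>r. Y r q) \<in> X'"
    by (elim bexE conjE)
  have Y_GL: "Y \<in> GL n R"
    unfolding GL_def using YZ ZY by (intro CollectI conjI Y bexI[OF _ Z] allI impI) simp_all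
  show ?thesis using col Y_GL by (rule bexI)
qed

lemma (in ring) combine_eq_finsum:
  assumes "length Ks = length Us" "set Ks \<subseteq> carrier R" "set Us \<subseteq> carrier R"
  shows "combine Ks Us = (\<Oplus>r\<in>{..<length Us}. Ks ! r \<otimes> Us ! r)"
  using assms
proof (induction Ks Us rule: list_induct2)
  case Nil
  then show ?case by simp
next
  case (Cons k Ks u Us)
  have c: "Ks ! r \<in> carrier R" "Us ! r \<in> carrier R" if "r < length Us" for r
    using Cons.prems Cons.hyps that by (auto simp: subset_iff)
  have "(\<Oplus>r\<in>{..<Suc (length Us)}. (k # Ks) ! r \<otimes> (u # Us) ! r) =
      k \<otimes> u \<oplus> (\<Oplus>r\<in>Suc ` {..<length Us}. (k # Ks) ! r \<otimes> (u # Us) ! r)"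
    unfolding lessThan_Suc_eq_insert_0 using Cons.prems c by (subst finsum_insert) auto
  also have "(\<Oplus>r\<in>Suc ` {..<length Us}. (k # Ks) ! r \<otimes> (u # Us) ! r) =
      (\<Oplus>r\<in>{..<length Us}. (k # Ks) ! Suc r \<otimes> (u # Us) ! Suc r)"
    using c by (intro finsum_reindex) auto
  finally show ?case using Cons by simp
qed

section \<open>From normality to a system with a fundamental matrix\<close>

context tensor_square
begin

lemma normal_common_denominator:
  assumes "delta_normal_wrt L m R \<epsilon> \<tau>\<^sub>s \<tau>\<^sub>t" "\<And>r. r < n \<Longrightarrow> v r \<in> carrier L"
  shows "\<exists>u \<in> LD \<inter> Units R. \<forall>r<n::nat. \<tau>\<^sub>t (v r) \<otimes>\<^bsub>R\<^esub> u \<in> LD"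
  using assms(2)
proof (induction n)
  case 0
  then show ?case using subringE(3)[OF LD_subring] by auto
next
  case (Suc n)
  then obtain u where u: "u \<in> LD" "u \<in> Units R" "\<And>r. r < n \<Longrightarrow> \<tau>\<^sub>t (v r) \<otimes>\<^bsub>R\<^esub> u \<in> LD" by auto
  obtain w where w: "w \<in> LD" "w \<in> Units R" "\<tau>\<^sub>t (v n) \<otimes>\<^bsub>R\<^esub> w \<in> LD"
    using normal_denominator[OF assms(1), of "v n"] Suc.prems by auto
  have c: "u \<in> carrier R" "w \<in> carrier R" using u w LD_carrier by auto
  have "\<tau>\<^sub>t (v r) \<otimes>\<^bsub>R\<^esub> (u \<otimes>\<^bsub>R\<^esub> w) \<in> LD" if r: "r < Suc n" for r
  proof (cases "r = n")
    case True
    have "\<tau>\<^sub>t (v n) \<otimes>\<^bsub>R\<^esub> (u \<otimes>\<^bsub>R\<^esub> w) = u \<otimes>\<^bsub>R\<^esub> (\<tau>\<^sub>t (v n) \<otimes>\<^bsub>R\<^esub> w)"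
      using c Suc.prems[of n] by (intro R.m_lcomm) auto
    then show ?thesis using True subringE(6)[OF LD_subring u(1) w(3)] by simp
  next
    case False
    have "\<tau>\<^sub>t (v r) \<otimes>\<^bsub>R\<^esub> (u \<otimes>\<^bsub>R\<^esub> w) = (\<tau>\<^sub>t (v r) \<otimes>\<^bsub>R\<^esub> u) \<otimes>\<^bsub>R\<^esub> w"
      using c Suc.prems[of r] r by (intro R.m_assoc[symmetric]) auto
    then show ?thesis using False r subringE(6)[OF LD_subring u(3) w(1)] by simp
  qed
  then show ?case using subringE(6)[OF LD_subring u(1) w(1)] u(2) w(2) by auto
qed

definition solutions :: "nat \<Rightarrow> (nat \<Rightarrow> nat \<Rightarrow> nat \<Rightarrow> 'a) \<Rightarrow> (nat \<Rightarrow> 'a) set" where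
  "solutions n A = {l. (\<forall>r<n. l r \<in> carrier L) \<and>
     (\<forall>i<m. \<forall>r<n. \<delta> i (l r) = (\<Oplus>\<^bsub>L\<^esub>s\<in>{..<n}. A i r s \<otimes>\<^bsub>L\<^esub> l s))}"

text \<open>
  If \<open>c\<close> is orthogonal to all solutions in \<open>L\<close>, then \<open>\<Sum> v\<^sub>r \<otimes> c\<^sub>r\<close> is annihilated by every constant
  \<open>j\<close> with \<open>j (v\<^sub>r \<otimes> 1) \<in> LD\<close>, since the coefficients of the \<open>j (v\<^sub>r \<otimes> 1)\<close> with respect to
  independent constants are solutions. These \<open>j\<close> generate the unit ideal.
\<close>

lemma solutions_separating:
  assumes normal: "delta_normal_wrt L m R \<epsilon> \<tau>\<^sub>s \<tau>\<^sub>t"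
    and v: "\<And>r. r < n \<Longrightarrow> v r \<in> carrier L"
    and A: "\<And>i r s. \<lbrakk>i < m; r < n; s < n\<rbrakk> \<Longrightarrow> A i r s \<in> K"
    and dv: "\<And>i r. \<lbrakk>i < m; r < n\<rbrakk> \<Longrightarrow> \<delta> i (v r) = (\<Oplus>\<^bsub>L\<^esub>s\<in>{..<n}. A i r s \<otimes>\<^bsub>L\<^esub> v s)"
    and indep: "\<And>k r. \<lbrakk>\<And>r. r < n \<Longrightarrow> k r \<in> K; (\<Oplus>\<^bsub>L\<^esub>r\<in>{..<n}. k r \<otimes>\<^bsub>L\<^esub> v r) = \<zero>\<^bsub>L\<^esub>; r < n\<rbrakk> \<Longrightarrow> k r = \<zero>\<^bsub>L\<^esub>"
    and c: "\<And>r. r < n \<Longrightarrow> c r \<in> carrier L" and r: "r < n" "c r \<noteq> \<zero>\<^bsub>L\<^esub>"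
  shows "\<exists>l \<in> solutions n A. (\<Oplus>\<^bsub>L\<^esub>r\<in>{..<n}. c r \<otimes>\<^bsub>L\<^esub> l r) \<noteq> \<zero>\<^bsub>L\<^esub>"
proof (rule ccontr)
  assume "\<not> ?thesis"
  then have orth: "\<And>l. l \<in> solutions n A \<Longrightarrow> (\<Oplus>\<^bsub>L\<^esub>r\<in>{..<n}. c r \<otimes>\<^bsub>L\<^esub> l r) = \<zero>\<^bsub>L\<^esub>" by blast
  have tv: "\<And>r. r < n \<Longrightarrow> \<tau>\<^sub>t (v r) \<in> carrier R" and sc: "\<And>r. r < n \<Longrightarrow> \<tau>\<^sub>s (c r) \<in> carrier R"
    using v c by auto
  obtain u where u: "u \<in> LD" "u \<in> Units R" and uv: "\<And>r. r < n \<Longrightarrow> \<tau>\<^sub>t (v r) \<otimes>\<^bsub>R\<^esub> u \<in> LD"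
    using normal_common_denominator[OF normal, of n v] v by auto
  define N where "N = {x \<in> LD. \<forall>r<n. \<tau>\<^sub>t (v r) \<otimes>\<^bsub>R\<^esub> x \<in> LD}"
  \<comment> \<open>The entries of \<open>A i\<close> lie in \<open>K\<close>, so they may be
    written with \<open>\<tau>\<^sub>s\<close>, whose image acts on \<open>LD\<close>. This is what
    makes \<open>N\<close> closed under the derivations.\<close>
  have dtv: "\<tau>\<^sub>t (\<delta> i (v r)) \<otimes>\<^bsub>R\<^esub> x = (\<Oplus>\<^bsub>R\<^esub>s\<in>{..<n}. \<tau>\<^sub>s (A i r s) \<otimes>\<^bsub>R\<^esub> (\<tau>\<^sub>t (v s) \<otimes>\<^bsub>R\<^esub> x))"
    if i: "i < m" and r: "r < n" and x: "x \<in> carrier R" for i r x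
  proof -
    have Ac: "A i r s \<in> carrier L" if "s < n" for s using A[OF i r that] L.K_carrier by blast
    have "\<tau>\<^sub>t (\<delta> i (v r)) = (\<Oplus>\<^bsub>R\<^esub>s\<in>{..<n}. (\<tau>\<^sub>t \<circ> (\<lambda>s. A i r s \<otimes>\<^bsub>L\<^esub> v s)) s)"
      unfolding dv[OF i r] using Ac v by (intro t.hom_finsum) auto
    also have "\<dots> = (\<Oplus>\<^bsub>R\<^esub>s\<in>{..<n}. \<tau>\<^sub>s (A i r s) \<otimes>\<^bsub>R\<^esub> \<tau>\<^sub>t (v s))"
      using Ac v A[OF i r] by (intro R.finsum_cong' refl) (auto simp: tau_eq)
    also have "\<dots> \<otimes>\<^bsub>R\<^esub> x = (\<Oplus>\<^bsub>R\<^esub>s\<in>{..<n}. (\<tau>\<^sub>s (A i r s) \<otimes>\<^bsub>R\<^esub> \<tau>\<^sub>t (v s)) \<otimes>\<^bsub>R\<^esub> x)"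
      using Ac v x by (intro R.finsum_ldistr) auto
    also have "\<dots> = (\<Oplus>\<^bsub>R\<^esub>s\<in>{..<n}. \<tau>\<^sub>s (A i r s) \<otimes>\<^bsub>R\<^esub> (\<tau>\<^sub>t (v s) \<otimes>\<^bsub>R\<^esub> x))"
      using Ac v x by (intro R.finsum_cong' refl) (auto simp: R.m_assoc)
    finally show ?thesis .
  qed
  have LDs: "\<tau>\<^sub>s a \<otimes>\<^bsub>R\<^esub> x \<in> LD" if "a \<in> carrier L" "x \<in> LD" for a x
    using that by (intro R.subring_prod_left_mult[OF image_tau_subring D_carrier]) auto
  have uQ: "u \<in> subring_prod R (\<tau>\<^sub>s ` carrier L) (N \<inter> D)"
  proof (rule stable_subspace_generated_by_constants)
    show "N \<subseteq> carrier R" using LD_carrier by (auto simp: N_def)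
    show "u \<in> N" "u \<in> LD" using u uv by (auto simp: N_def)
  next
    fix x y assume xy: "x \<in> N" "y \<in> N"
    then have c: "x \<in> carrier R" "y \<in> carrier R" using LD_carrier by (auto simp: N_def)
    show "x \<oplus>\<^bsub>R\<^esub> y \<in> N"
      using xy tv c subringE(7)[OF LD_subring] by (simp add: N_def R.r_distr)
  next
    fix a x assume a: "a \<in> carrier L" and x: "x \<in> N"
    then have xc: "x \<in> carrier R" using LD_carrier by (auto simp: N_def)
    have "\<tau>\<^sub>t (v r) \<otimes>\<^bsub>R\<^esub> (\<tau>\<^sub>s a \<otimes>\<^bsub>R\<^esub> x) = \<tau>\<^sub>s a \<otimes>\<^bsub>R\<^esub> (\<tau>\<^sub>t (v r) \<otimes>\<^bsub>R\<^esub> x)" if "r < n" for r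
      using tv[OF that] a xc by (intro R.m_lcomm) auto
    then show "\<tau>\<^sub>s a \<otimes>\<^bsub>R\<^esub> x \<in> N" using x LDs[OF a] by (simp add: N_def)
  next
    fix i x assume i: "i < m" and x: "x \<in> N"
    then have xc: "x \<in> carrier R" using LD_carrier by (auto simp: N_def)
    have "\<tau>\<^sub>t (v r) \<otimes>\<^bsub>R\<^esub> \<epsilon> i x \<in> LD" if r: "r < n" for r
    proof -
      have tx: "\<tau>\<^sub>t (v r) \<otimes>\<^bsub>R\<^esub> x \<in> LD" using x r by (simp add: N_def)
      have "\<tau>\<^sub>t (\<delta> i (v r)) \<otimes>\<^bsub>R\<^esub> x \<in> LD"
        unfolding dtv[OF i r xc] using x A[OF i r] L.K_carrier
        by (intro R.subring_finsum[OF LD_subring] LDs) (auto simp: N_def)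
      moreover have "\<epsilon> i (\<tau>\<^sub>t (v r) \<otimes>\<^bsub>R\<^esub> x) \<in> LD" using LD_delta[OF i tx] .
      moreover have "\<tau>\<^sub>t (v r) \<otimes>\<^bsub>R\<^esub> \<epsilon> i x = \<ominus>\<^bsub>R\<^esub> (\<tau>\<^sub>t (\<delta> i (v r)) \<otimes>\<^bsub>R\<^esub> x) \<oplus>\<^bsub>R\<^esub> \<epsilon> i (\<tau>\<^sub>t (v r) \<otimes>\<^bsub>R\<^esub> x)"
        using i v[OF r] tv[OF r] xc by (simp add: R.delta_mult delta_tau R.r_neg1)
      ultimately show ?thesis using subringE(5,7)[OF LD_subring] by simp
    qed
    then show "\<epsilon> i x \<in> N" using LD_delta[OF i] x by (simp add: N_def)
  qed
  define w where "w = (\<Oplus>\<^bsub>R\<^esub>r\<in>{..<n}. \<tau>\<^sub>s (c r) \<otimes>\<^bsub>R\<^esub> \<tau>\<^sub>t (v r))"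
  have wc: "w \<in> carrier R" unfolding w_def using tv sc by (intro R.finsum_closed) auto
  have wj: "w \<otimes>\<^bsub>R\<^esub> j = \<zero>\<^bsub>R\<^esub>" if j: "j \<in> N \<inter> D" for j
  proof -
    have jc: "j \<in> carrier R" and j0: "\<And>i. i < m \<Longrightarrow> \<epsilon> i j = \<zero>\<^bsub>R\<^esub>" using j by (auto simp: constants_def)
    have xLD: "\<tau>\<^sub>t (v r) \<otimes>\<^bsub>R\<^esub> j \<in> LD" if "r < n" for r using j that by (simp add: N_def)
    obtain F l where F: "finite F" "F \<subseteq> D" and lc: "\<And>r d. l r d \<in> carrier L"
      and xl: "\<And>r. r < n \<Longrightarrow> \<tau>\<^sub>t (v r) \<otimes>\<^bsub>R\<^esub> j = comb F (l r)"
      and ind: "\<And>g d. \<lbrakk>\<And>d. g d \<in> carrier L; comb F g = \<zero>\<^bsub>R\<^esub>; d \<in> F\<rbrakk> \<Longrightarrow> g d = \<zero>\<^bsub>L\<^esub>"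
      using LD_comb_family_independent[of n "\<lambda>r. \<tau>\<^sub>t (v r) \<otimes>\<^bsub>R\<^esub> j", OF xLD] by blast
    have sol: "(\<lambda>r. l r d) \<in> solutions n A" if d: "d \<in> F" for d
      unfolding solutions_def
    proof (intro CollectI conjI allI impI)
      fix i r assume i: "i < m" and r: "r < n"
      have Ac: "A i r s \<in> carrier L" if "s < n" for s using A[OF i r that] L.K_carrier by blast
      define g where "g d = (\<Oplus>\<^bsub>L\<^esub>s\<in>{..<n}. A i r s \<otimes>\<^bsub>L\<^esub> l s d)" for d
      have gc: "g d \<in> carrier L" for d unfolding g_def using Ac lc by (intro L.finsum_closed) auto
      have dl: "\<delta> i (l r d) \<in> carrier L" for d using i lc by simp
      have "comb F (\<lambda>d. \<delta> i (l r d)) = \<epsilon> i (\<tau>\<^sub>t (v r) \<otimes>\<^bsub>R\<^esub> j)"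
        unfolding xl[OF r] using comb_delta[OF i F] lc by simp
      also have "\<dots> = \<tau>\<^sub>t (\<delta> i (v r)) \<otimes>\<^bsub>R\<^esub> j"
        using i v[OF r] tv[OF r] jc j0[OF i] by (simp add: R.delta_mult delta_tau)
      also have "\<dots> = (\<Oplus>\<^bsub>R\<^esub>s\<in>{..<n}. \<tau>\<^sub>s (A i r s) \<otimes>\<^bsub>R\<^esub> comb F (l s))"
        unfolding dtv[OF i r jc] using Ac lc comb_closed[OF F(2)]
        by (intro R.finsum_cong' refl) (auto simp: xl)
      also have "\<dots> = comb F g"
        unfolding g_def using Ac lc by (intro comb_lincomb F) auto
      finally have eq: "comb F (\<lambda>d. \<delta> i (l r d)) = comb F g" .
      \<comment> \<open>The difference of the two representations is a relation among the constants
        of \<open>F\<close>. By independence each coefficient vanishes, which is row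
        \<open>r\<close> of the system for column \<open>d\<close>.\<close>
      have "comb F (\<lambda>d. \<delta> i (l r d) \<oplus>\<^bsub>L\<^esub> (\<ominus>\<^bsub>L\<^esub> \<one>\<^bsub>L\<^esub>) \<otimes>\<^bsub>L\<^esub> g d) =
          comb F (\<lambda>d. \<delta> i (l r d)) \<oplus>\<^bsub>R\<^esub> \<tau>\<^sub>s (\<ominus>\<^bsub>L\<^esub> \<one>\<^bsub>L\<^esub>) \<otimes>\<^bsub>R\<^esub> comb F g"
        using F gc dl by (subst comb_smult) (auto intro!: comb_add[symmetric])
      also have "\<dots> = \<zero>\<^bsub>R\<^esub>"
        unfolding eq using comb_closed[OF F(2), of g] gc by (simp add: R.l_minus R.r_neg)
      finally have "\<delta> i (l r d) \<oplus>\<^bsub>L\<^esub> (\<ominus>\<^bsub>L\<^esub> \<one>\<^bsub>L\<^esub>) \<otimes>\<^bsub>L\<^esub> g d = \<zero>\<^bsub>L\<^esub>"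
        using gc dl d by (intro ind[of "\<lambda>d. \<delta> i (l r d) \<oplus>\<^bsub>L\<^esub> (\<ominus>\<^bsub>L\<^esub> \<one>\<^bsub>L\<^esub>) \<otimes>\<^bsub>L\<^esub> g d"]) auto
      then have "\<delta> i (l r d) \<ominus>\<^bsub>L\<^esub> g d = \<zero>\<^bsub>L\<^esub>" using gc by (simp add: L.minus_eq L.l_minus)
      then show "\<delta> i (l r d) = (\<Oplus>\<^bsub>L\<^esub>s\<in>{..<n}. A i r s \<otimes>\<^bsub>L\<^esub> l s d)"
        using gc dl by (simp add: L.r_right_minus_eq g_def)
    qed (rule lc)
    have "w \<otimes>\<^bsub>R\<^esub> j = (\<Oplus>\<^bsub>R\<^esub>r\<in>{..<n}. \<tau>\<^sub>s (c r) \<otimes>\<^bsub>R\<^esub> \<tau>\<^sub>t (v r) \<otimes>\<^bsub>R\<^esub> j)"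
      unfolding w_def using tv sc jc by (intro R.finsum_ldistr) auto
    also have "\<dots> = (\<Oplus>\<^bsub>R\<^esub>r\<in>{..<n}. \<tau>\<^sub>s (c r) \<otimes>\<^bsub>R\<^esub> comb F (l r))"
      using tv sc jc xl comb_closed[OF F(2)] lc by (intro R.finsum_cong' refl) (auto simp: R.m_assoc)
    also have "\<dots> = comb F (\<lambda>d. \<Oplus>\<^bsub>L\<^esub>r\<in>{..<n}. c r \<otimes>\<^bsub>L\<^esub> l r d)"
      using c lc by (intro comb_lincomb F) auto
    also have "\<dots> = \<zero>\<^bsub>R\<^esub>" using orth sol by (intro comb_zero F) auto
    finally show ?thesis .
  qed
  have ND: "N \<inter> D \<subseteq> carrier R" using D_carrier by blast
  \<comment> \<open>\<open>u\<close> is a combination of the constants j just treated, so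
    \<open>w\<close> annihilates it as well. Since \<open>u\<close> is a unit,
    \<open>w = 0\<close>.\<close>
  have "w \<otimes>\<^bsub>R\<^esub> u = \<zero>\<^bsub>R\<^esub>"
    using uQ image_tau_carrier ND
  proof (induction u rule: R.subring_prod_induct)
    case zero
    then show ?case using wc by simp
  next
    case (step a j p)
    have car: "a \<in> carrier R" "j \<in> carrier R" "p \<in> carrier R"
      using step image_tau_carrier ND R.subring_prod_closed[OF image_tau_carrier ND] by auto
    then have "w \<otimes>\<^bsub>R\<^esub> (a \<otimes>\<^bsub>R\<^esub> j \<oplus>\<^bsub>R\<^esub> p) = a \<otimes>\<^bsub>R\<^esub> (w \<otimes>\<^bsub>R\<^esub> j) \<oplus>\<^bsub>R\<^esub> w \<otimes>\<^bsub>R\<^esub> p"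
      using wc by (simp add: R.r_distr R.m_lcomm)
    then show ?case using wj step car by simp
  qed
  then have "w = \<zero>\<^bsub>R\<^esub>"
    using u(2) wc by (metis R.Units_closed R.Units_inv_closed R.Units_r_inv R.l_null R.m_assoc R.r_one)
  \<comment> \<open>Evaluating \<open>w = 0\<close> at \<psi> gives a \<open>K\<close>-linear
    relation among the \<open>v r\<close> with coefficients \<psi>(c r). Independence makes them all
    zero, yet some functional has value 1 at the nonzero \<open>c r\<close>.\<close>
  have "\<psi> (c r) = \<zero>\<^bsub>L\<^esub>" if \<psi>: "\<psi> \<in> functionals" for \<psi>
  proof (rule indep)
    show "\<psi> (c r) \<in> K" if "r < n" for r using functional_closed[OF \<psi> c[OF that]] .
    have "\<zero>\<^bsub>L\<^esub> = ev w \<psi>" unfolding \<open>w = \<zero>\<^bsub>R\<^esub>\<close> using ev_zero[OF \<psi>] by simp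
    also have "\<dots> = (\<Oplus>\<^bsub>L\<^esub>r\<in>{..<n}. ev (\<tau>\<^sub>s (c r) \<otimes>\<^bsub>R\<^esub> \<tau>\<^sub>t (v r)) \<psi>)"
      unfolding w_def using tv sc \<psi> by (intro ev_finsum) auto
    also have "\<dots> = (\<Oplus>\<^bsub>L\<^esub>r\<in>{..<n}. \<psi> (c r) \<otimes>\<^bsub>L\<^esub> v r)"
    proof (intro L.finsum_cong' refl)
      show "(\<lambda>r. \<psi> (c r) \<otimes>\<^bsub>L\<^esub> v r) \<in> {..<n} \<rightarrow> carrier L"
        using functional_closed[OF \<psi>] L.K_carrier c v by auto
      fix r assume "r \<in> {..<n}"
      then have r: "r < n" by simp
      let ?\<psi> = "\<lambda>z. \<psi> (c r \<otimes>\<^bsub>L\<^esub> z)"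
      have F: "?\<psi> \<in> functionals" using functional_shift[OF \<psi> c[OF r]] .
      have "ev (\<tau>\<^sub>s (c r) \<otimes>\<^bsub>R\<^esub> (\<tau>\<^sub>t (v r) \<otimes>\<^bsub>R\<^esub> \<one>\<^bsub>R\<^esub>)) \<psi> = v r \<otimes>\<^bsub>L\<^esub> \<psi> (c r \<otimes>\<^bsub>L\<^esub> \<one>\<^bsub>L\<^esub>)"
        using tv[OF r] c[OF r] v[OF r] \<psi> F by (subst ev_tau_s) (auto simp: ev_tau_t ev_one simp del: R.r_one)
      then show "ev (\<tau>\<^sub>s (c r) \<otimes>\<^bsub>R\<^esub> \<tau>\<^sub>t (v r)) \<psi> = \<psi> (c r) \<otimes>\<^bsub>L\<^esub> v r"
        using tv[OF r] c[OF r] v[OF r] functional_closed[OF \<psi> c[OF r]] L.K_carrier by (simp add: L.m_comm)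
    qed
    finally show "(\<Oplus>\<^bsub>L\<^esub>r\<in>{..<n}. \<psi> (c r) \<otimes>\<^bsub>L\<^esub> v r) = \<zero>\<^bsub>L\<^esub>" by simp
  qed (rule r(1))
  moreover obtain \<psi> where "\<psi> \<in> functionals" "\<psi> (c r) = \<one>\<^bsub>L\<^esub>"
    using L.exists_functional[OF L.K_subfield c[OF r(1)] r(2)] by blast
  ultimately show False using L.one_not_zero by metis
qed

theorem normal_imp_picard_vessiot:
  assumes normal: "delta_normal_wrt L m R \<epsilon> \<tau>\<^sub>s \<tau>\<^sub>t" and fg: "finitely_delta_generated L K m \<delta>"
    and const_eq: "constants L m \<delta> = constants (L\<lparr>carrier := K\<rparr>) m \<delta>"
  shows "picard_vessiot L K m \<delta>"
proof -
  obtain V where V: "L.fin_stable V" and KV: "K \<subseteq> V" and gen: "carrier L = generate_field L (K \<union> V)"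
    using normal_fin_stable_generates[OF normal fg] by blast
  obtain Us where Us: "set Us \<subseteq> carrier L" "L.independent K Us" "L.Span K Us = V"
    using V L.exists_base[OF L.K_subfield] unfolding L.fin_stable_def by (metis L.finite_dimensionE')
  define n where "n = length Us"
  define v where "v r = Us ! r" for r
  have v: "v r \<in> carrier L" if "r < n" for r using that Us(1) by (auto simp: v_def n_def)
  have comb_v: "L.combine (map k [0..<n]) Us = (\<Oplus>\<^bsub>L\<^esub>r\<in>{..<n}. k r \<otimes>\<^bsub>L\<^esub> v r)"
    if "\<And>r. r < n \<Longrightarrow> k r \<in> K" for k
  proof -
    have "L.combine (map k [0..<n]) Us =
        (\<Oplus>\<^bsub>L\<^esub>r\<in>{..<length Us}. map k [0..<n] ! r \<otimes>\<^bsub>L\<^esub> Us ! r)"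
      using that Us(1) L.K_carrier by (intro L.combine_eq_finsum) (auto simp: n_def)
    also have "\<dots> = (\<Oplus>\<^bsub>L\<^esub>r\<in>{..<n}. k r \<otimes>\<^bsub>L\<^esub> v r)"
      using that v L.K_carrier by (intro L.finsum_cong') (auto simp: n_def v_def)
    finally show ?thesis .
  qed
  have indep: "k r = \<zero>\<^bsub>L\<^esub>"
    if k: "\<And>r. r < n \<Longrightarrow> k r \<in> K" and "(\<Oplus>\<^bsub>L\<^esub>r\<in>{..<n}. k r \<otimes>\<^bsub>L\<^esub> v r) = \<zero>\<^bsub>L\<^esub>" and r: "r < n" for k r
  proof -
    have "L.combine (map k [0..<n]) Us = \<zero>\<^bsub>L\<^esub>" using comb_v[OF k] that(2) by simp
    then have "set (take (length Us) (map k [0..<n])) \<subseteq> {\<zero>\<^bsub>L\<^esub>}"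
      using k by (intro L.independent_imp_trivial_combine[OF L.K_subfield Us(2)]) auto
    then show ?thesis using r by (auto simp: n_def image_subset_iff)
  qed
  have in_V: "\<exists>k. (\<forall>r<n. k r \<in> K) \<and> x = (\<Oplus>\<^bsub>L\<^esub>r\<in>{..<n}. k r \<otimes>\<^bsub>L\<^esub> v r)" if "x \<in> V" for x
  proof -
    have "x \<in> L.Span K Us" using that Us(3) by simp
    then obtain Ks where Ks: "set Ks \<subseteq> K" "length Ks = n" "x = L.combine Ks Us"
      using L.Span_mem_iff_length_version[OF L.K_subfield Us(1)] by (auto simp: n_def)
    then have "map ((!) Ks) [0..<n] = Ks" by (auto intro: nth_equalityI)
    moreover have "Ks ! r \<in> K" if "r < n" for r using Ks that by auto
    ultimately show ?thesis using comb_v[of "(!) Ks"] Ks(3) by auto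
  qed
  have vV: "v r \<in> V" if "r < n" for r
    using that L.Span_base_incl[OF L.K_subfield Us(1)] Us(3) by (auto simp: v_def n_def)
  have "\<exists>k. (\<forall>s<n. k s \<in> K) \<and> \<delta> i (v r) = (\<Oplus>\<^bsub>L\<^esub>s\<in>{..<n}. k s \<otimes>\<^bsub>L\<^esub> v s)" if "i < m" "r < n" for i r
    using in_V vV that V by (simp add: L.fin_stable_def)
  then obtain A where A: "\<And>i r s. \<lbrakk>i < m; r < n; s < n\<rbrakk> \<Longrightarrow> A i r s \<in> K"
    and dv: "\<And>i r. \<lbrakk>i < m; r < n\<rbrakk> \<Longrightarrow> \<delta> i (v r) = (\<Oplus>\<^bsub>L\<^esub>s\<in>{..<n}. A i r s \<otimes>\<^bsub>L\<^esub> v s)"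
    by metis
  have Ac: "A i r s \<in> carrier L" if "i < m" "r < n" "s < n" for i r s using A L.K_carrier that by blast
  have n1: "n \<ge> 1"
  proof (rule ccontr)
    assume "\<not> ?thesis"
    then have "Us = []" by (cases Us) (auto simp: n_def)
    then have "V = {\<zero>\<^bsub>L\<^esub>}" using Us(3) by simp
    then show False using KV L.K_closed(2) by auto
  qed
  have integrable: "integrable_system L m \<delta> n A"
    unfolding integrable_system_def
  proof (intro allI impI)
    fix i j r c assume i: "i < m" and j: "j < m" and r: "r < n" and c: "c < n"
    \<comment> \<open>Row \<open>r\<close> of the matrix through which the composite of two
      derivations acts on \<open>v\<close>. The derivations commute and \<open>v\<close> is
      independent over \<open>K\<close>, so the matrices for both orders agree; rearranged, this is
      the integrability condition.\<close>
    define B where "B i j s = \<delta> i (A j r s) \<oplus>\<^bsub>L\<^esub> mat_mult L n (A j) (A i) r s" for i j s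
    have MK: "mat_mult L n (A j) (A i) r s \<in> K" if "i < m" "j < m" "s < n" for i j s
      unfolding mat_mult_def using A that r L.K_closed
      by (intro L.subring_finsum[OF subfieldE(1)[OF L.K_subfield]]) auto
    have BK: "B i j s \<in> K" if "i < m" "j < m" "s < n" for i j s
      unfolding B_def using MK[OF that] L.K_delta A that r L.K_closed by simp
    have dd: "\<delta> i (\<delta> j (v r)) = (\<Oplus>\<^bsub>L\<^esub>s\<in>{..<n}. B i j s \<otimes>\<^bsub>L\<^esub> v s)" if i: "i < m" and j: "j < m" for i j
    proof -
      have "\<delta> i (\<delta> j (v r)) = (\<Oplus>\<^bsub>L\<^esub>s\<in>{..<n}. \<delta> i (A j r s) \<otimes>\<^bsub>L\<^esub> v s) \<oplus>\<^bsub>L\<^esub>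
          (\<Oplus>\<^bsub>L\<^esub>s\<in>{..<n}. A j r s \<otimes>\<^bsub>L\<^esub> \<delta> i (v s))"
        unfolding dv[OF j r] using Ac i j r v by (intro L.delta_lincomb) auto
      also have "(\<Oplus>\<^bsub>L\<^esub>s\<in>{..<n}. A j r s \<otimes>\<^bsub>L\<^esub> \<delta> i (v s)) =
          (\<Oplus>\<^bsub>L\<^esub>s\<in>{..<n}. A j r s \<otimes>\<^bsub>L\<^esub> (\<Oplus>\<^bsub>L\<^esub>t\<in>{..<n}. A i s t \<otimes>\<^bsub>L\<^esub> v t))"
        using Ac i j r v by (intro L.finsum_cong' refl) (auto simp: dv intro!: L.m_closed L.finsum_closed)
      also have "\<dots> = (\<Oplus>\<^bsub>L\<^esub>t\<in>{..<n}. mat_mult L n (A j) (A i) r t \<otimes>\<^bsub>L\<^esub> v t)"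
        unfolding mat_mult_def using Ac i j r v by (intro L.finsum_assoc) auto
      also have "(\<Oplus>\<^bsub>L\<^esub>s\<in>{..<n}. \<delta> i (A j r s) \<otimes>\<^bsub>L\<^esub> v s) \<oplus>\<^bsub>L\<^esub> \<dots> =
          (\<Oplus>\<^bsub>L\<^esub>s\<in>{..<n}. \<delta> i (A j r s) \<otimes>\<^bsub>L\<^esub> v s \<oplus>\<^bsub>L\<^esub> mat_mult L n (A j) (A i) r s \<otimes>\<^bsub>L\<^esub> v s)"
        using Ac i j r v MK L.K_carrier by (intro L.finsum_addf[symmetric]) auto
      also have "\<dots> = (\<Oplus>\<^bsub>L\<^esub>s\<in>{..<n}. B i j s \<otimes>\<^bsub>L\<^esub> v s)"
        unfolding B_def using Ac i j r v MK L.K_carrier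
        by (intro L.finsum_cong' refl) (auto simp: L.l_distr)
      finally show ?thesis .
    qed
    have Bc: "B i j s \<in> carrier L" "B j i s \<in> carrier L" if "s < n" for s
      using BK i j that L.K_carrier by auto
    define k where "k s = B i j s \<ominus>\<^bsub>L\<^esub> B j i s" for s
    have "(\<Oplus>\<^bsub>L\<^esub>s\<in>{..<n}. k s \<otimes>\<^bsub>L\<^esub> v s) =
        (\<Oplus>\<^bsub>L\<^esub>s\<in>{..<n}. B i j s \<otimes>\<^bsub>L\<^esub> v s \<oplus>\<^bsub>L\<^esub> \<ominus>\<^bsub>L\<^esub> (B j i s \<otimes>\<^bsub>L\<^esub> v s))"
      unfolding k_def using Bc v by (intro L.finsum_cong' refl) (auto simp: L.minus_eq L.l_distr L.l_minus)
    also have "\<dots> = (\<Oplus>\<^bsub>L\<^esub>s\<in>{..<n}. B i j s \<otimes>\<^bsub>L\<^esub> v s) \<oplus>\<^bsub>L\<^esub> (\<Oplus>\<^bsub>L\<^esub>s\<in>{..<n}. \<ominus>\<^bsub>L\<^esub> (B j i s \<otimes>\<^bsub>L\<^esub> v s))"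
      using Bc v by (intro L.finsum_addf) auto
    also have "(\<Oplus>\<^bsub>L\<^esub>s\<in>{..<n}. \<ominus>\<^bsub>L\<^esub> (B j i s \<otimes>\<^bsub>L\<^esub> v s)) = \<ominus>\<^bsub>L\<^esub> (\<Oplus>\<^bsub>L\<^esub>s\<in>{..<n}. B j i s \<otimes>\<^bsub>L\<^esub> v s)"
      using Bc v by (intro L.finsum_neg) auto
    also have "(\<Oplus>\<^bsub>L\<^esub>s\<in>{..<n}. B i j s \<otimes>\<^bsub>L\<^esub> v s) \<oplus>\<^bsub>L\<^esub> \<dots> = \<zero>\<^bsub>L\<^esub>"
    proof -
      have "\<delta> i (\<delta> j (v r)) = \<delta> j (\<delta> i (v r))" using L.derivations_commute[OF i j v[OF r]] .
      moreover have "\<delta> j (\<delta> i (v r)) \<in> carrier L" using i j v[OF r] by auto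
      ultimately show ?thesis unfolding dd[OF i j, symmetric] dd[OF j i, symmetric] by (simp add: L.r_neg)
    qed
    finally have k0: "(\<Oplus>\<^bsub>L\<^esub>s\<in>{..<n}. k s \<otimes>\<^bsub>L\<^esub> v s) = \<zero>\<^bsub>L\<^esub>" .
    have "k s \<in> K" if "s < n" for s
      unfolding k_def using BK i j that by (intro L.stable_closed(4)[OF L.stable_base])
    then have "k c = \<zero>\<^bsub>L\<^esub>" by (rule indep[OF _ k0 c])
    then have "B i j c = B j i c" using Bc[OF c] by (simp add: k_def L.r_right_minus_eq)
    moreover have "p \<ominus>\<^bsub>L\<^esub> q = t \<ominus>\<^bsub>L\<^esub> s"
      if e: "p \<oplus>\<^bsub>L\<^esub> s = q \<oplus>\<^bsub>L\<^esub> t" and car: "p \<in> carrier L" "q \<in> carrier L" "s \<in> carrier L" "t \<in> carrier L" for p q s t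
    proof -
      have "p = q \<oplus>\<^bsub>L\<^esub> t \<oplus>\<^bsub>L\<^esub> \<ominus>\<^bsub>L\<^esub> s" using car by (simp add: e[symmetric] L.a_assoc L.r_neg)
      then show ?thesis using car
        by (simp add: L.minus_eq L.a_assoc L.a_comm[of _ "\<ominus>\<^bsub>L\<^esub> q"] L.r_neg1)
    qed
    ultimately show "\<delta> i (A j r c) \<ominus>\<^bsub>L\<^esub> \<delta> j (A i r c) =
        mat_mult L n (A i) (A j) r c \<ominus>\<^bsub>L\<^esub> mat_mult L n (A j) (A i) r c"
      using MK[OF i j c] MK[OF j i c] L.K_carrier Ac i j r c by (simp add: B_def)
  qed
  have "\<exists>Y \<in> GL n L. \<forall>q<n. (\<lambda>r. Y r q) \<in> solutions n A"
  proof (rule L.invertible_matrix_of_separating_columns)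
    show "l r \<in> carrier L" if "l \<in> solutions n A" "r < n" for l r using that by (simp add: solutions_def)
    fix c assume c: "\<And>r. r < n \<Longrightarrow> c r \<in> carrier L" and "\<exists>r<n. c r \<noteq> \<zero>\<^bsub>L\<^esub>"
    then obtain r where r: "r < n" "c r \<noteq> \<zero>\<^bsub>L\<^esub>" by blast
    show "\<exists>l\<in>solutions n A. (\<Oplus>\<^bsub>L\<^esub>r\<in>{..<n}. c r \<otimes>\<^bsub>L\<^esub> l r) \<noteq> \<zero>\<^bsub>L\<^esub>"
    proof (rule solutions_separating[where v = v and c = c and r = r, OF normal])
      show "k r = \<zero>\<^bsub>L\<^esub>"
        if "\<And>r. r < n \<Longrightarrow> k r \<in> K" "(\<Oplus>\<^bsub>L\<^esub>r\<in>{..<n}. k r \<otimes>\<^bsub>L\<^esub> v r) = \<zero>\<^bsub>L\<^esub>" "r < n" for k r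
        using that by (rule indep)
    qed (fact v A dv c r)+
  qed
  then obtain Y where YGL: "Y \<in> GL n L" and sol: "\<And>q. q < n \<Longrightarrow> (\<lambda>r. Y r q) \<in> solutions n A" by blast
  then obtain Z where Y: "Y \<in> matrices n (carrier L)" and Z: "Z \<in> matrices n (carrier L)"
    and YZ: "\<And>r c. r < n \<Longrightarrow> c < n \<Longrightarrow> mat_mult L n Y Z r c = (if r = c then \<one>\<^bsub>L\<^esub> else \<zero>\<^bsub>L\<^esub>)"
    and ZY: "\<And>r c. r < n \<Longrightarrow> c < n \<Longrightarrow> mat_mult L n Z Y r c = (if r = c then \<one>\<^bsub>L\<^esub> else \<zero>\<^bsub>L\<^esub>)"
    unfolding GL_def by blast
  have Yc: "\<And>r c. r < n \<Longrightarrow> c < n \<Longrightarrow> Y r c \<in> carrier L"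
    and Zc: "\<And>r c. r < n \<Longrightarrow> c < n \<Longrightarrow> Z r c \<in> carrier L"
    using Y Z by (auto simp: matrices_def)
  have dY: "\<delta> i (Y r c) = mat_mult L n (A i) Y r c" if "i < m" "r < n" "c < n" for i r c
    using sol[OF that(3)] that by (simp add: solutions_def mat_mult_def)
  let ?H = "K \<union> {Y r c | r c. r < n \<and> c < n}"
  let ?G = "generate_field L ?H"
  have Hc: "?H \<subseteq> carrier L" using Yc L.K_carrier by auto
  have G: "subfield ?G L" by (rule L.generate_field_is_subfield[OF Hc])
  have HG: "h \<in> ?G" if "h \<in> ?H" for h using that by (rule generate_field.incl)
  have vG: "v r \<in> ?G" if r: "r < n" for r
  proof -
    define e where "e q = (\<Oplus>\<^bsub>L\<^esub>s\<in>{..<n}. Z q s \<otimes>\<^bsub>L\<^esub> v s)" for q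
    have ec: "e q \<in> carrier L" if "q < n" for q
      unfolding e_def using that Zc v by (intro L.finsum_closed) auto
    have ve: "v r = (\<Oplus>\<^bsub>L\<^esub>q\<in>{..<n}. Y r q \<otimes>\<^bsub>L\<^esub> e q)" if r: "r < n" for r
    proof -
      have "(\<Oplus>\<^bsub>L\<^esub>q\<in>{..<n}. Y r q \<otimes>\<^bsub>L\<^esub> e q) = (\<Oplus>\<^bsub>L\<^esub>s\<in>{..<n}. mat_mult L n Y Z r s \<otimes>\<^bsub>L\<^esub> v s)"
        unfolding e_def mat_mult_def using r Yc Zc v by (intro L.finsum_assoc) auto
      also have "\<dots> = (\<Oplus>\<^bsub>L\<^esub>s\<in>{..<n}. (if r = s then \<one>\<^bsub>L\<^esub> else \<zero>\<^bsub>L\<^esub>) \<otimes>\<^bsub>L\<^esub> v s)"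
        using r YZ v by (intro L.finsum_cong' refl) auto
      also have "\<dots> = v r" using r v by (intro L.finsum_unit_vector) auto
      finally show ?thesis by simp
    qed
    have "e q \<in> K" if q: "q < n" for q
    proof -
      have "\<delta> i (e q) = \<zero>\<^bsub>L\<^esub>" if i: "i < m" for i
        using i Ac[OF i] Y Z ZY dY[OF i] ec ve dv[OF i] q
        by (intro L.fundamental_coefficients_constant[of i "A i" n Y Z e v q]) (auto simp: matrices_def)
      then have "e q \<in> constants L m \<delta>" using ec[OF q] by (simp add: constants_def)
      \<comment> \<open>Since \<open>L\<close> has no constants beyond those of \<open>K\<close>,
        the coordinates of \<open>v\<close> in the columns of \<open>Y\<close> lie in
        \<open>K\<close>, so \<open>v\<close> lies in K(Y).\<close>
      then show ?thesis unfolding const_eq by (simp add: constants_def)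
    qed
    then show ?thesis unfolding ve[OF r] using r HG subringE(6)[OF subfieldE(1)[OF G]]
      by (intro L.subring_finsum[OF subfieldE(1)[OF G]]) blast+
  qed
  have "x \<in> ?G" if x: "x \<in> V" for x
  proof -
    obtain k where k: "\<And>r. r < n \<Longrightarrow> k r \<in> K" "x = (\<Oplus>\<^bsub>L\<^esub>r\<in>{..<n}. k r \<otimes>\<^bsub>L\<^esub> v r)"
      using in_V[OF x] by blast
    show ?thesis unfolding k(2) using k(1) vG HG subringE(6)[OF subfieldE(1)[OF G]]
      by (intro L.subring_finsum[OF subfieldE(1)[OF G]]) blast+
  qed
  then have "K \<union> V \<subseteq> ?G" using HG by blast
  then have "carrier L \<subseteq> ?G"
    unfolding gen using L.generate_field_min_subfield1[OF _ G] L.fin_stable_subset_carrier[OF V] L.K_carrier by blast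
  then have "carrier L = ?G" using L.generate_field_incl[OF Hc] by blast
  then show ?thesis
    unfolding picard_vessiot_def
    using const_eq n1 A integrable YGL dY by (intro conjI exI[of _ n] exI[of _ A] exI[of _ Y]) (auto simp: matrices_def)
qed

end

section \<open>Construction of the tensor square\<close>

text \<open>
  An element \<open>\<Sum> x\<^sub>i \<otimes> y\<^sub>i\<close> of \<open>L \<otimes>\<^sub>K L\<close> is determined by the map \<open>\<phi> \<mapsto> \<Sum> x\<^sub>i \<phi>(y\<^sub>i)\<close> on the
  \<open>K\<close>-linear endomorphisms of \<open>L\<close>. The tensor product is realised as the set of these maps, on which
  the multiplication and the derivations have intrinsic descriptions. The maps are zero off the
  endomorphisms, to make them unique as functions of the ambient type.
\<close>

context delta_extension
begin

abbreviation "endos \<equiv> linear_maps L K (carrier L)"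

lemmas endo_closed = linear_map_closed[OF stable_carrier]
lemmas endo_add = linear_map_add[OF stable_carrier]
lemmas endo_smult = linear_map_smult[OF stable_carrier]
lemmas endoI = linear_mapI[OF stable_carrier]
lemmas endo_shift = linear_map_shift[OF stable_carrier]
lemmas endo_commutator = linear_map_commutator[OF stable_carrier]
lemmas endo_plus = linear_map_plus[OF stable_carrier]
lemmas endo_scale = linear_map_scale[OF stable_carrier]
lemmas endo_zero = linear_map_zero[OF stable_carrier]

lemma functional_is_endo: "\<psi> \<in> linear_maps L K K \<Longrightarrow> \<psi> \<in> endos"
  using K_carrier unfolding linear_maps_def by auto

definition tens :: "'a \<Rightarrow> 'a \<Rightarrow> ('a \<Rightarrow> 'a) \<Rightarrow> 'a" where
  "tens x y = (\<lambda>\<phi>. if \<phi> \<in> endos then x \<otimes> \<phi> y else \<zero>)"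

text \<open>Sums grow by one simple tensor at a time, so that identities additive in each argument
  reduce to simple tensors by induction. The relations of the tensor product need not be imposed,
  because equality is equality of functions.\<close>

inductive_set tensors :: "(('a \<Rightarrow> 'a) \<Rightarrow> 'a) set" where
  zero: "(\<lambda>\<phi>. \<zero>) \<in> tensors"
| step: "\<lbrakk>x \<in> carrier L; y \<in> carrier L; r \<in> tensors\<rbrakk> \<Longrightarrow> (\<lambda>\<phi>. tens x y \<phi> \<oplus> r \<phi>) \<in> tensors"

text \<open>On simple tensors the product evaluates to x (a \<phi>(y b)). The inner map, sending y
  to the value of s at \<phi>(y _), takes values in \<open>L\<close> even if \<phi> takes values in
  \<open>K\<close>. For this reason tensors are functions on endomorphisms and not only on
  functionals.\<close>

definition tensor_ring :: "(('a \<Rightarrow> 'a) \<Rightarrow> 'a) ring" where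
  "tensor_ring = \<lparr>carrier = tensors,
     monoid.mult = (\<lambda>r s \<phi>. if \<phi> \<in> endos then r (\<lambda>y. s (\<lambda>z. \<phi> (y \<otimes> z))) else \<zero>),
     monoid.one = tens \<one> \<one>, ring.zero = (\<lambda>\<phi>. \<zero>), ring.add = (\<lambda>r s \<phi>. r \<phi> \<oplus> s \<phi>)\<rparr>"

text \<open>For r = x \<otimes> y the first term is \<delta>(x) \<phi>(y) + x \<delta>(\<phi>(y)),
  and the commutator replaces \<delta>(\<phi>(y)) with \<phi>(\<delta>(y)). This is the product rule
  on the tensor square, stated without choosing a representation of r.\<close>

definition tensor_delta :: "nat \<Rightarrow> (('a \<Rightarrow> 'a) \<Rightarrow> 'a) \<Rightarrow> ('a \<Rightarrow> 'a) \<Rightarrow> 'a" where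
  "tensor_delta i r = (\<lambda>\<phi>. if \<phi> \<in> endos then \<delta> i (r \<phi>) \<ominus> r (\<lambda>y. \<delta> i (\<phi> y) \<ominus> \<phi> (\<delta> i y)) else \<zero>)"

lemma tensor_ring_simps [simp]:
  "carrier tensor_ring = tensors"
  "\<one>\<^bsub>tensor_ring\<^esub> = tens \<one> \<one>"
  "\<zero>\<^bsub>tensor_ring\<^esub> = (\<lambda>\<phi>. \<zero>)"
  by (simp_all add: tensor_ring_def)

lemma tensor_add: "r \<oplus>\<^bsub>tensor_ring\<^esub> s = (\<lambda>\<phi>. r \<phi> \<oplus> s \<phi>)"
  by (simp add: tensor_ring_def)

lemma tensor_mult:
  "r \<otimes>\<^bsub>tensor_ring\<^esub> s = (\<lambda>\<phi>. if \<phi> \<in> endos then r (\<lambda>y. s (\<lambda>z. \<phi> (y \<otimes> z))) else \<zero>)"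
  by (simp add: tensor_ring_def)

lemma tens_closed: "\<lbrakk>x \<in> carrier L; y \<in> carrier L\<rbrakk> \<Longrightarrow> tens x y \<phi> \<in> carrier L"
  by (simp add: tens_def endo_closed)

lemma tensor_closed: "r \<in> tensors \<Longrightarrow> r \<phi> \<in> carrier L"
  by (induction rule: tensors.induct) (auto simp: tens_closed)

lemma tensor_outside: "\<lbrakk>r \<in> tensors; \<phi> \<notin> endos\<rbrakk> \<Longrightarrow> r \<phi> = \<zero>"
  by (induction rule: tensors.induct) (auto simp: tens_def)

text \<open>Ring laws hold only on the carrier, so two descriptions of the same endomorphism, such
  as \<phi>(1 z) and \<phi>(z), may be different functions. This lemma makes them interchangeable as
  arguments of a tensor.\<close>

lemma tensor_cong:
  assumes "r \<in> tensors" "\<phi> \<in> endos" "\<And>x. x \<in> carrier L \<Longrightarrow> \<phi> x = \<phi>' x"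
  shows "r \<phi> = r \<phi>'"
proof -
  have "\<phi>' \<in> endos"
    using assms(2,3) endo_closed endo_add endo_smult K_carrier by (intro endoI) (simp_all flip: assms(3))
  with assms(1) show ?thesis
    by (induction rule: tensors.induct) (use assms(2,3) in \<open>auto simp: tens_def\<close>)
qed

lemma tensor_additive:
  assumes "r \<in> tensors" "\<phi> \<in> endos" "\<phi>' \<in> endos"
  shows "r (\<lambda>z. \<phi> z \<oplus> \<phi>' z) = r \<phi> \<oplus> r \<phi>'"
  using assms(1)
proof (induction rule: tensors.induct)
  case zero
  then show ?case by simp
next
  case (step x y r)
  have c: "\<phi> y \<in> carrier L" "\<phi>' y \<in> carrier L" "r \<phi> \<in> carrier L" "r \<phi>' \<in> carrier L"
    using step assms endo_closed tensor_closed by auto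
  then show ?case using step assms endo_plus[OF assms(2,3)] by (simp add: tens_def r_distr a_ac)
qed

lemma tensor_linear:
  assumes "r \<in> tensors" "\<phi> \<in> endos" "k \<in> K"
  shows "r (\<lambda>z. k \<otimes> \<phi> z) = k \<otimes> r \<phi>"
  using assms(1)
proof (induction rule: tensors.induct)
  case zero
  then show ?case using K_carrier assms by simp
next
  case (step x y r)
  have c: "\<phi> y \<in> carrier L" "r \<phi> \<in> carrier L" "k \<in> carrier L"
    using step assms endo_closed tensor_closed K_carrier by auto
  then show ?case using step assms endo_scale[OF assms(2,3)] by (simp add: tens_def r_distr m_lcomm)
qed

lemma tensor_zero_map: "r \<in> tensors \<Longrightarrow> r (\<lambda>z. \<zero>) = \<zero>"
  using tensor_linear[OF _ endo_zero K_closed(1), of r] tensor_closed by simp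

lemma tensor_shift_endo:
  assumes s: "s \<in> tensors" and \<phi>: "\<phi> \<in> endos"
  shows "(\<lambda>y. s (\<lambda>z. \<phi> (y \<otimes> z))) \<in> endos"
proof (rule endoI)
  fix y y' assume y: "y \<in> carrier L" "y' \<in> carrier L"
  note E = endo_shift[OF \<phi> y(1)] endo_shift[OF \<phi> y(2)]
  have "s (\<lambda>z. \<phi> ((y \<oplus> y') \<otimes> z)) = s (\<lambda>z. \<phi> (y \<otimes> z) \<oplus> \<phi> (y' \<otimes> z))"
    using y \<phi> endo_shift[OF \<phi>, of "y \<oplus> y'"] by (intro tensor_cong[OF s]) (auto simp: l_distr endo_add)
  then show "s (\<lambda>z. \<phi> ((y \<oplus> y') \<otimes> z)) = s (\<lambda>z. \<phi> (y \<otimes> z)) \<oplus> s (\<lambda>z. \<phi> (y' \<otimes> z))"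
    using tensor_additive[OF s E] by simp
next
  fix k y assume k: "k \<in> K" and y: "y \<in> carrier L"
  have kL: "k \<in> carrier L" using k K_carrier by blast
  have "s (\<lambda>z. \<phi> ((k \<otimes> y) \<otimes> z)) = s (\<lambda>z. k \<otimes> \<phi> (y \<otimes> z))"
    using y \<phi> k kL endo_shift[OF \<phi>, of "k \<otimes> y"]
    by (intro tensor_cong[OF s]) (auto simp: m_assoc endo_smult)
  then show "s (\<lambda>z. \<phi> ((k \<otimes> y) \<otimes> z)) = k \<otimes> s (\<lambda>z. \<phi> (y \<otimes> z))"
    using tensor_linear[OF s endo_shift[OF \<phi> y] k] by simp
qed (rule tensor_closed[OF s])

lemma tens_tensor:
  assumes "x \<in> carrier L" "y \<in> carrier L"
  shows "tens x y \<in> tensors"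
proof -
  have "(\<lambda>\<phi>. tens x y \<phi> \<oplus> \<zero>) = tens x y" using tens_closed[OF assms] by simp
  then show ?thesis using tensors.step[OF assms tensors.zero] by simp
qed

lemma tensor_induct [consumes 1, case_names zero step]:
  assumes "r \<in> tensors" "P \<zero>\<^bsub>tensor_ring\<^esub>"
    and "\<And>x y r. \<lbrakk>x \<in> carrier L; y \<in> carrier L; r \<in> tensors; P r\<rbrakk> \<Longrightarrow> P (tens x y \<oplus>\<^bsub>tensor_ring\<^esub> r)"
  shows "P r"
  using assms(1) by (induction rule: tensors.induct) (use assms(2,3) in \<open>simp_all add: tensor_add\<close>)

lemma tensor_add_closed: "\<lbrakk>r \<in> tensors; s \<in> tensors\<rbrakk> \<Longrightarrow> r \<oplus>\<^bsub>tensor_ring\<^esub> s \<in> tensors"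
proof (induction r rule: tensors.induct)
  case zero
  then show ?case using tensor_closed by (simp add: tensor_add)
next
  case (step x y r)
  then have "(\<lambda>\<phi>. tens x y \<phi> \<oplus> (r \<phi> \<oplus> s \<phi>)) \<in> tensors"
    using tensors.step by (simp add: tensor_add)
  moreover have "(\<lambda>\<phi>. tens x y \<phi> \<oplus> (r \<phi> \<oplus> s \<phi>)) = (\<lambda>\<phi>. (tens x y \<phi> \<oplus> r \<phi>) \<oplus> s \<phi>)"
    using step tensor_closed tens_closed by (simp add: a_assoc)
  ultimately show ?case by (simp add: tensor_add)
qed

lemma tens_mult:
  assumes "x \<in> carrier L" "y \<in> carrier L" "s \<in> tensors"
  shows "tens x y \<otimes>\<^bsub>tensor_ring\<^esub> s = (\<lambda>\<phi>. if \<phi> \<in> endos then x \<otimes> s (\<lambda>z. \<phi> (y \<otimes> z)) else \<zero>)"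
  using assms tensor_shift_endo by (auto simp: tensor_mult tens_def fun_eq_iff)

lemma tens_mult_tens:
  assumes "x \<in> carrier L" "y \<in> carrier L" "a \<in> carrier L" "b \<in> carrier L"
  shows "tens x y \<otimes>\<^bsub>tensor_ring\<^esub> tens a b = tens (x \<otimes> a) (y \<otimes> b)"
  using assms endo_shift endo_closed tens_tensor
  by (auto simp: tens_mult fun_eq_iff m_assoc) (auto simp: tens_def m_assoc)

lemma tensor_l_distr:
  "(r \<oplus>\<^bsub>tensor_ring\<^esub> s) \<otimes>\<^bsub>tensor_ring\<^esub> t = r \<otimes>\<^bsub>tensor_ring\<^esub> t \<oplus>\<^bsub>tensor_ring\<^esub> s \<otimes>\<^bsub>tensor_ring\<^esub> t"
  by (auto simp: tensor_add tensor_mult)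

lemma tensor_r_distr:
  assumes "r \<in> tensors" "s \<in> tensors" "t \<in> tensors"
  shows "r \<otimes>\<^bsub>tensor_ring\<^esub> (s \<oplus>\<^bsub>tensor_ring\<^esub> t) = r \<otimes>\<^bsub>tensor_ring\<^esub> s \<oplus>\<^bsub>tensor_ring\<^esub> r \<otimes>\<^bsub>tensor_ring\<^esub> t"
  using tensor_additive[OF assms(1)] tensor_shift_endo assms
  by (auto simp: tensor_add tensor_mult fun_eq_iff)

lemma tensor_zero_mult [simp]: "(\<lambda>\<phi>. \<zero>) \<otimes>\<^bsub>tensor_ring\<^esub> s = (\<lambda>\<phi>. \<zero>)"
  by (auto simp: tensor_mult)

lemma tensor_mult_zero [simp]: "r \<in> tensors \<Longrightarrow> r \<otimes>\<^bsub>tensor_ring\<^esub> (\<lambda>\<phi>. \<zero>) = (\<lambda>\<phi>. \<zero>)"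
  by (auto simp: tensor_mult tensor_zero_map)

lemma tensor_mult_closed:
  assumes "r \<in> tensors" "s \<in> tensors"
  shows "r \<otimes>\<^bsub>tensor_ring\<^esub> s \<in> tensors"
  using assms(1)
proof (induction r rule: tensor_induct)
  case zero
  then show ?case by (simp add: tensors.zero)
next
  case (step x y r)
  have "tens x y \<otimes>\<^bsub>tensor_ring\<^esub> s \<in> tensors"
    using assms(2)
  proof (induction s rule: tensor_induct)
    case zero
    then show ?case using step tens_tensor by (simp add: tensors.zero)
  next
    case (step a b s)
    then show ?case
      using \<open>x \<in> carrier L\<close> \<open>y \<in> carrier L\<close>
      by (simp add: tensor_r_distr tens_tensor tens_mult_tens tensor_add_closed)
  qed
  then show ?case using step by (simp add: tensor_l_distr tensor_add_closed)
qed

text \<open>The formula for the product is not symmetric in its factors. Two inductions reduce the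
  claim to simple tensors, where it is commutativity in \<open>L\<close>.\<close>

lemma tensor_mult_commute:
  assumes "r \<in> tensors" "s \<in> tensors"
  shows "r \<otimes>\<^bsub>tensor_ring\<^esub> s = s \<otimes>\<^bsub>tensor_ring\<^esub> r"
  using assms(1)
proof (induction r rule: tensor_induct)
  case zero
  then show ?case using assms by simp
next
  case (step x y r)
  have "tens x y \<otimes>\<^bsub>tensor_ring\<^esub> s = s \<otimes>\<^bsub>tensor_ring\<^esub> tens x y"
    using assms(2)
  proof (induction s rule: tensor_induct)
    case zero
    then show ?case using step tens_tensor by simp
  next
    case (step a b s)
    then show ?case
      using \<open>x \<in> carrier L\<close> \<open>y \<in> carrier L\<close>
      by (simp add: tensor_r_distr tensor_l_distr tens_tensor tens_mult_tens m_comm)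
  qed
  then show ?case using step assms by (simp add: tensor_l_distr tensor_r_distr tens_tensor)
qed

text \<open>Both sides unfold to r, s and t nested in this order around \<phi>. They differ only in
  the bracketing of the product inside \<phi>, which is changed one layer at a time with
  \<open>tensor_cong\<close>.\<close>

lemma tensor_mult_assoc:
  assumes "r \<in> tensors" "s \<in> tensors" "t \<in> tensors"
  shows "(r \<otimes>\<^bsub>tensor_ring\<^esub> s) \<otimes>\<^bsub>tensor_ring\<^esub> t = r \<otimes>\<^bsub>tensor_ring\<^esub> (s \<otimes>\<^bsub>tensor_ring\<^esub> t)"
proof
  fix \<phi>
  show "((r \<otimes>\<^bsub>tensor_ring\<^esub> s) \<otimes>\<^bsub>tensor_ring\<^esub> t) \<phi> = (r \<otimes>\<^bsub>tensor_ring\<^esub> (s \<otimes>\<^bsub>tensor_ring\<^esub> t)) \<phi>"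
  proof (cases "\<phi> \<in> endos")
    case True
    have E: "(\<lambda>w. t (\<lambda>u. \<phi> (w \<otimes> u))) \<in> endos" using tensor_shift_endo[OF assms(3) True] .
    have "((r \<otimes>\<^bsub>tensor_ring\<^esub> s) \<otimes>\<^bsub>tensor_ring\<^esub> t) \<phi> = r (\<lambda>y. s (\<lambda>z. t (\<lambda>u. \<phi> (y \<otimes> z \<otimes> u))))"
      using True E by (simp add: tensor_mult)
    also have "\<dots> = r (\<lambda>y. (s \<otimes>\<^bsub>tensor_ring\<^esub> t) (\<lambda>z. \<phi> (y \<otimes> z)))"
    proof (rule tensor_cong[OF assms(1)])
      show "(\<lambda>y. s (\<lambda>z. t (\<lambda>u. \<phi> (y \<otimes> z \<otimes> u)))) \<in> endos"
        using tensor_shift_endo[OF assms(2) E] .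
      fix y assume y: "y \<in> carrier L"
      have "s (\<lambda>z. t (\<lambda>u. \<phi> (y \<otimes> z \<otimes> u))) = s (\<lambda>z. t (\<lambda>u. \<phi> (y \<otimes> (z \<otimes> u))))"
      proof (rule tensor_cong[OF assms(2)])
        show "(\<lambda>z. t (\<lambda>u. \<phi> (y \<otimes> z \<otimes> u))) \<in> endos" using endo_shift[OF E y] .
        fix z assume z: "z \<in> carrier L"
        show "t (\<lambda>u. \<phi> (y \<otimes> z \<otimes> u)) = t (\<lambda>u. \<phi> (y \<otimes> (z \<otimes> u)))"
          using y z endo_shift[OF True, of "y \<otimes> z"] by (intro tensor_cong[OF assms(3)]) (auto simp: m_assoc)
      qed
      then show "s (\<lambda>z. t (\<lambda>u. \<phi> (y \<otimes> z \<otimes> u))) = (s \<otimes>\<^bsub>tensor_ring\<^esub> t) (\<lambda>z. \<phi> (y \<otimes> z))"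
        using endo_shift[OF True y] by (simp add: tensor_mult)
    qed
    also have "\<dots> = (r \<otimes>\<^bsub>tensor_ring\<^esub> (s \<otimes>\<^bsub>tensor_ring\<^esub> t)) \<phi>"
      using True by (subst (2) tensor_mult) simp
    finally show ?thesis .
  next
    case False
    then show ?thesis by (simp add: tensor_mult)
  qed
qed

lemma tensor_one_mult:
  assumes "r \<in> tensors"
  shows "tens \<one> \<one> \<otimes>\<^bsub>tensor_ring\<^esub> r = r"
proof
  fix \<phi>
  have "r (\<lambda>z. \<phi> (\<one> \<otimes> z)) = r \<phi>" if "\<phi> \<in> endos"
    using that endo_shift[OF that one_closed] by (intro tensor_cong[OF assms]) auto
  then show "(tens \<one> \<one> \<otimes>\<^bsub>tensor_ring\<^esub> r) \<phi> = r \<phi>"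
    using assms tensor_closed tensor_outside by (simp add: tens_mult)
qed

lemma tensor_neg:
  assumes "r \<in> tensors"
  shows "\<exists>s \<in> tensors. s \<oplus>\<^bsub>tensor_ring\<^esub> r = \<zero>\<^bsub>tensor_ring\<^esub>"
proof (intro bexI)
  have m1: "\<ominus> \<one> \<in> carrier L" by simp
  show "tens (\<ominus> \<one>) \<one> \<otimes>\<^bsub>tensor_ring\<^esub> r \<in> tensors"
    using tens_tensor[OF m1 one_closed] assms by (rule tensor_mult_closed)
  have "tens (\<ominus> \<one>) \<one> \<otimes>\<^bsub>tensor_ring\<^esub> r \<oplus>\<^bsub>tensor_ring\<^esub> tens \<one> \<one> \<otimes>\<^bsub>tensor_ring\<^esub> r =
      (tens (\<ominus> \<one>) \<one> \<oplus>\<^bsub>tensor_ring\<^esub> tens \<one> \<one>) \<otimes>\<^bsub>tensor_ring\<^esub> r"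
    by (simp add: tensor_l_distr)
  also have "tens (\<ominus> \<one>) \<one> \<oplus>\<^bsub>tensor_ring\<^esub> tens \<one> \<one> = (\<lambda>\<phi>. \<zero>)"
    using endo_closed by (auto simp: tensor_add tens_def l_minus l_neg)
  finally show "tens (\<ominus> \<one>) \<one> \<otimes>\<^bsub>tensor_ring\<^esub> r \<oplus>\<^bsub>tensor_ring\<^esub> r = \<zero>\<^bsub>tensor_ring\<^esub>"
    using tensor_one_mult[OF assms] by simp
qed

lemma tensor_ring_cring: "cring tensor_ring"
proof (rule cringI)
  show "abelian_group tensor_ring"
  proof (rule abelian_groupI)
    show "x \<oplus>\<^bsub>tensor_ring\<^esub> y = y \<oplus>\<^bsub>tensor_ring\<^esub> x"
      if "x \<in> carrier tensor_ring" "y \<in> carrier tensor_ring" for x y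
      using that by (simp add: tensor_add tensor_closed a_comm)
  qed (use tensor_add_closed tensors.zero tensor_neg in \<open>auto simp: tensor_add tensor_closed a_assoc\<close>)
  show "comm_monoid tensor_ring"
    using tensor_mult_closed tens_tensor tensor_mult_assoc tensor_mult_commute tensor_one_mult
    by (intro comm_monoidI) auto
  show "(x \<oplus>\<^bsub>tensor_ring\<^esub> y) \<otimes>\<^bsub>tensor_ring\<^esub> z = x \<otimes>\<^bsub>tensor_ring\<^esub> z \<oplus>\<^bsub>tensor_ring\<^esub> y \<otimes>\<^bsub>tensor_ring\<^esub> z" for x y z
    by (rule tensor_l_distr)
qed

section \<open>The derivations of the tensor square\<close>

interpretation T: cring tensor_ring
  by (rule tensor_ring_cring)

lemma tens_add_left:
  assumes "x \<in> carrier L" "x' \<in> carrier L" "y \<in> carrier L"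
  shows "tens (x \<oplus> x') y = tens x y \<oplus>\<^bsub>tensor_ring\<^esub> tens x' y"
  using assms endo_closed by (auto simp: tens_def tensor_add l_distr)

lemma tens_add_right:
  assumes "x \<in> carrier L" "y \<in> carrier L" "y' \<in> carrier L"
  shows "tens x (y \<oplus> y') = tens x y \<oplus>\<^bsub>tensor_ring\<^esub> tens x y'"
  using assms endo_closed by (auto simp: tens_def tensor_add r_distr endo_add)

lemma tens_zero_left: "y \<in> carrier L \<Longrightarrow> tens \<zero> y = (\<lambda>\<phi>. \<zero>)"
  using endo_closed by (auto simp: tens_def)

lemma tens_zero_right: "x \<in> carrier L \<Longrightarrow> tens x \<zero> = (\<lambda>\<phi>. \<zero>)"
  using tens_add_right[of x \<zero> \<zero>] tens_tensor[of x \<zero>]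
  by (metis T.add.l_cancel_one l_zero tensor_ring_simps(1,3) zero_closed)

lemma tens_base:
  assumes "k \<in> K"
  shows "tens k \<one> = tens \<one> k"
proof -
  have "\<phi> (k \<otimes> \<one>) = k \<otimes> \<phi> \<one>" if "\<phi> \<in> endos" for \<phi>
    using that assms by (intro endo_smult) auto
  then show ?thesis using assms K_carrier endo_closed by (auto simp: tens_def fun_eq_iff)
qed

lemma tensor_delta_tens:
  assumes i: "i < m" and xy: "x \<in> carrier L" "y \<in> carrier L"
  shows "tensor_delta i (tens x y) = tens (\<delta> i x) y \<oplus>\<^bsub>tensor_ring\<^esub> tens x (\<delta> i y)"
proof
  fix \<phi>
  show "tensor_delta i (tens x y) \<phi> = (tens (\<delta> i x) y \<oplus>\<^bsub>tensor_ring\<^esub> tens x (\<delta> i y)) \<phi>"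
  proof (cases "\<phi> \<in> endos")
    case True
    define a b where "a = \<delta> i (\<phi> y)" and "b = \<phi> (\<delta> i y)"
    have c: "\<phi> y \<in> carrier L" "a \<in> carrier L" "b \<in> carrier L" "\<delta> i x \<in> carrier L"
      using True i xy endo_closed by (auto simp: a_def b_def)
    have "\<delta> i (x \<otimes> \<phi> y) \<ominus> x \<otimes> (a \<ominus> b) = \<delta> i x \<otimes> \<phi> y \<oplus> (x \<otimes> a \<oplus> (\<ominus> (x \<otimes> a) \<oplus> x \<otimes> b))"
      using c xy i by (simp add: delta_mult minus_eq r_distr r_minus minus_add a_assoc a_def)
    also have "\<dots> = \<delta> i x \<otimes> \<phi> y \<oplus> x \<otimes> b" using c xy by (simp add: r_neg2)
    finally show ?thesis
      using True endo_commutator[OF True i] by (simp add: tensor_delta_def tens_def tensor_add a_def b_def)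
  next
    case False
    then show ?thesis by (simp add: tensor_delta_def tens_def tensor_add)
  qed
qed

lemma tensor_delta_zero [simp]: "i < m \<Longrightarrow> tensor_delta i (\<lambda>\<phi>. \<zero>) = (\<lambda>\<phi>. \<zero>)"
  by (auto simp: tensor_delta_def minus_eq)

lemma tensor_delta_add:
  assumes i: "i < m" and r: "r \<in> tensors" and s: "s \<in> tensors"
  shows "tensor_delta i (r \<oplus>\<^bsub>tensor_ring\<^esub> s) = tensor_delta i r \<oplus>\<^bsub>tensor_ring\<^esub> tensor_delta i s"
proof
  fix \<phi>
  show "tensor_delta i (r \<oplus>\<^bsub>tensor_ring\<^esub> s) \<phi> = (tensor_delta i r \<oplus>\<^bsub>tensor_ring\<^esub> tensor_delta i s) \<phi>"
    using i tensor_closed[OF r] tensor_closed[OF s]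
    by (simp add: tensor_delta_def tensor_add delta_add minus_eq minus_add a_ac)
qed

lemma tensor_delta_closed:
  assumes i: "i < m" and "r \<in> tensors"
  shows "tensor_delta i r \<in> tensors"
  using assms(2)
proof (induction r rule: tensor_induct)
  case zero
  then show ?case using i tensors.zero by simp
next
  case (step x y r)
  then show ?case
    using i by (simp add: tensor_delta_add tensor_delta_tens tens_tensor tensor_add_closed)
qed

text \<open>Both sides are additive in r and in s, so two inductions leave simple tensors, where the
  product rule in each factor suffices.\<close>

lemma tensor_delta_mult:
  assumes i: "i < m" and r: "r \<in> tensors" and s: "s \<in> tensors"
  shows "tensor_delta i (r \<otimes>\<^bsub>tensor_ring\<^esub> s) =
    tensor_delta i r \<otimes>\<^bsub>tensor_ring\<^esub> s \<oplus>\<^bsub>tensor_ring\<^esub> r \<otimes>\<^bsub>tensor_ring\<^esub> tensor_delta i s"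
  using r
proof (induction r rule: tensor_induct)
  case zero
  then show ?case using i s tensor_delta_closed by (simp add: tensor_add)
next
  case (step x y r)
  have xy: "x \<in> carrier L" "y \<in> carrier L" by fact+
  have "tensor_delta i (tens x y \<otimes>\<^bsub>tensor_ring\<^esub> s) =
    tensor_delta i (tens x y) \<otimes>\<^bsub>tensor_ring\<^esub> s \<oplus>\<^bsub>tensor_ring\<^esub> tens x y \<otimes>\<^bsub>tensor_ring\<^esub> tensor_delta i s"
    using s
  proof (induction s rule: tensor_induct)
    case zero
    then show ?case using i xy tens_tensor tensor_delta_closed by (simp add: tensor_add)
  next
    case (step a b s)
    have c: "tens x y \<in> tensors" "tens a b \<in> tensors" "s \<in> tensors"
      "tensor_delta i (tens x y) \<in> tensors" "tensor_delta i (tens a b) \<in> tensors" "tensor_delta i s \<in> tensors"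
      using step xy i tens_tensor tensor_delta_closed by auto
    have d: "\<delta> i x \<in> carrier L" "\<delta> i y \<in> carrier L" "\<delta> i a \<in> carrier L" "\<delta> i b \<in> carrier L"
      using i xy step by auto
    have "tensor_delta i (tens x y \<otimes>\<^bsub>tensor_ring\<^esub> tens a b) =
        tensor_delta i (tens x y) \<otimes>\<^bsub>tensor_ring\<^esub> tens a b \<oplus>\<^bsub>tensor_ring\<^esub> tens x y \<otimes>\<^bsub>tensor_ring\<^esub> tensor_delta i (tens a b)"
    proof -
      have ca: "a \<in> carrier L" "b \<in> carrier L" by fact+
      have t: "tens p q \<in> carrier tensor_ring" if "p \<in> carrier L" "q \<in> carrier L" for p q
        using tens_tensor that by simp
      show ?thesis
        using xy ca d i
        by (simp add: tens_mult_tens tensor_delta_tens delta_mult tens_add_left tens_add_right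
            T.l_distr T.r_distr T.a_ac t del: tensor_ring_simps(1))
    qed
    then show ?case
      using step(4) c i T.r_distr T.a_ac tensor_mult_closed tensor_add_closed tensor_delta_add
      by (simp add: tensor_delta_add)
  qed
  moreover have c: "tens x y \<in> tensors" "r \<in> tensors" "s \<in> tensors"
    "tensor_delta i (tens x y) \<in> tensors" "tensor_delta i r \<in> tensors" "tensor_delta i s \<in> tensors"
    using step s xy i tens_tensor tensor_delta_closed by auto
  ultimately show ?case
    using step(4) i T.l_distr T.a_ac tensor_mult_closed tensor_add_closed
    by (simp add: tensor_delta_add)
qed

lemma tensor_delta_commute:
  assumes i: "i < m" and j: "j < m" and "r \<in> tensors"
  shows "tensor_delta i (tensor_delta j r) = tensor_delta j (tensor_delta i r)"
  using assms(3)
proof (induction r rule: tensor_induct)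
  case zero
  then show ?case using i j by simp
next
  case (step x y r)
  have c: "tens p q \<in> tensors" if "p \<in> carrier L" "q \<in> carrier L" for p q using that by (rule tens_tensor)
  have "tensor_delta i (tensor_delta j (tens x y)) = tensor_delta j (tensor_delta i (tens x y))"
    using i j step(1,2) derivations_commute[OF i j] T.a_ac c
    by (simp add: tensor_delta_tens tensor_delta_add tensor_add_closed)
  then show ?case
    using step i j by (simp add: tensor_delta_add tens_tensor tensor_delta_closed)
qed

lemma tensor_delta_ring: "delta_ring tensor_ring m tensor_delta"
proof
  show "derivation tensor_ring (tensor_delta i)" if "i < m" for i
    using that tensor_delta_closed tensor_delta_add tensor_delta_mult by (auto simp: derivation_def)
  show "tensor_delta i (tensor_delta j x) = tensor_delta j (tensor_delta i x)"
    if "i < m" "j < m" "x \<in> carrier tensor_ring" for i j x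
    using that tensor_delta_commute by simp
qed

lemma tens_left_hom: "(\<lambda>x. tens x \<one>) \<in> delta_hom m L \<delta> tensor_ring tensor_delta"
  unfolding delta_hom_def
proof (intro CollectI conjI ring_hom_memI allI impI ballI)
  show "tens (\<delta> i x) \<one> = tensor_delta i (tens x \<one>)" if "i < m" "x \<in> carrier L" for i x
    using that T.r_zero tens_tensor by (simp add: tensor_delta_tens tens_zero_right)
qed (auto simp: tens_tensor tens_mult_tens tens_add_left)

lemma tens_right_hom: "tens \<one> \<in> delta_hom m L \<delta> tensor_ring tensor_delta"
  unfolding delta_hom_def
proof (intro CollectI conjI ring_hom_memI allI impI ballI)
  show "tens \<one> (\<delta> i x) = tensor_delta i (tens \<one> x)" if "i < m" "x \<in> carrier L" for i x
    using that T.l_zero tens_tensor by (simp add: tensor_delta_tens tens_zero_left)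
qed (auto simp: tens_tensor tens_mult_tens tens_add_right)

text \<open>At a functional with values in \<open>K\<close>, a sum of tensors
  \<open>x\<^sub>i \<otimes> y\<^sub>i\<close> takes a value in the \<open>K\<close>-span of the
  \<open>x\<^sub>i\<close>.\<close>

lemma tensor_values_finite_dimension:
  assumes "r \<in> tensors"
  shows "\<exists>V. finite_dimension K V \<and> (\<forall>\<psi> \<in> linear_maps L K K. r \<psi> \<in> V)"
  using assms
proof (induction rule: tensors.induct)
  case zero
  have "finite_dimension K {\<zero>}" by (rule finite_dimensionI) (rule zero_dim)
  then show ?case by blast
next
  case (step x y r)
  then obtain V where V: "finite_dimension K V" "\<And>\<psi>. \<psi> \<in> linear_maps L K K \<Longrightarrow> r \<psi> \<in> V" by blast
  have x: "set [x] \<subseteq> carrier L" using step by simp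
  have "tens x y \<psi> \<in> Span K [x]" if \<psi>: "\<psi> \<in> linear_maps L K K" for \<psi>
  proof -
    have k: "\<psi> y \<in> K" using linear_map_closed[OF stable_base \<psi>] step by blast
    have "\<psi> y \<otimes> x \<in> Span K [x]"
      using Span_base_incl[OF K_subfield x] by (intro Span_smult_closed[OF K_subfield x k]) auto
    then show ?thesis using functional_is_endo[OF \<psi>] k K_carrier step by (simp add: tens_def m_comm)
  qed
  then have "\<forall>\<psi> \<in> linear_maps L K K. tens x y \<psi> \<oplus> r \<psi> \<in> Span K [x] <+>\<^bsub>L\<^esub> V"
    using V(2) unfolding set_add_def' by blast
  moreover have "finite_dimension K (Span K [x] <+>\<^bsub>L\<^esub> V)"
    using sum_space_dim(1)[OF K_subfield Span_finite_dimension[OF K_subfield x] V(1)] .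
  ultimately show ?case by blast
qed

end

text \<open>Tensors are functions on endomorphisms and functionals are among these, so the
  evaluation \<open>ev\<close> is plain application.\<close>

theorem (in delta_extension) tensor_ring_is_tensor_square:
  "tensor_square L m \<delta> K tensor_ring tensor_delta (tens \<one>) (\<lambda>x. tens x \<one>) (\<lambda>r. r)"
proof (intro tensor_square.intro tensor_square_axioms.intro)
  show "delta_extension L m \<delta> K" by (rule delta_extension_axioms)
  show "delta_ring tensor_ring m tensor_delta" by (rule tensor_delta_ring)
  show "tens \<one> \<in> delta_hom m L \<delta> tensor_ring tensor_delta" by (rule tens_right_hom)
  show "(\<lambda>x. tens x \<one>) \<in> delta_hom m L \<delta> tensor_ring tensor_delta" by (rule tens_left_hom)
  show "tens \<one> x = tens x \<one>" if "x \<in> K" for x using tens_base[OF that] by simp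
  show "r \<psi> \<in> carrier L" if "r \<in> carrier tensor_ring" for r \<psi> using that tensor_closed by simp
  show "(r \<oplus>\<^bsub>tensor_ring\<^esub> r') \<psi> = r \<psi> \<oplus> r' \<psi>" for r r' \<psi> by (simp add: tensor_add)
  show "\<one>\<^bsub>tensor_ring\<^esub> \<psi> = \<psi> \<one>" if "\<psi> \<in> linear_maps L K K" for \<psi>
    using functional_is_endo[OF that] endo_closed by (simp add: tens_def)
  show "(tens a \<one> \<otimes>\<^bsub>tensor_ring\<^esub> r) \<psi> = a \<otimes> r \<psi>"
    if "r \<in> carrier tensor_ring" "a \<in> carrier L" "\<psi> \<in> linear_maps L K K" for r a \<psi>
  proof -
    have \<psi>: "\<psi> \<in> endos" and r: "r \<in> tensors" using functional_is_endo that by auto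
    have "r (\<lambda>z. \<psi> (\<one> \<otimes> z)) = r \<psi>"
      using endo_shift[OF \<psi> one_closed] by (intro tensor_cong[OF r]) auto
    then show ?thesis using \<psi> r that by (simp add: tens_mult)
  qed
  show "(tens \<one> l \<otimes>\<^bsub>tensor_ring\<^esub> r) \<psi> = r (\<lambda>z. \<psi> (l \<otimes> z))"
    if "r \<in> carrier tensor_ring" "l \<in> carrier L" "\<psi> \<in> linear_maps L K K" for r l \<psi>
    using functional_is_endo that tensor_closed by (simp add: tens_mult)
  show "tensor_delta i r \<psi> = \<delta> i (r \<psi>) \<ominus> r (\<lambda>y. \<delta> i (\<psi> y) \<ominus> \<psi> (\<delta> i y))"
    if "\<psi> \<in> linear_maps L K K" for i r \<psi>
    using functional_is_endo[OF that] by (simp add: tensor_delta_def)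
  show "\<exists>E. finite_dimension K E \<and> (\<forall>\<psi>\<in>linear_maps L K K. r \<psi> \<in> E)" if "r \<in> carrier tensor_ring" for r
    using tensor_values_finite_dimension that by simp
  show "r (\<lambda>z. \<psi> z \<oplus> \<psi>' z) = r \<psi> \<oplus> r \<psi>'"
    if "r \<in> carrier tensor_ring" "\<psi> \<in> linear_maps L K K" "\<psi>' \<in> linear_maps L K K" for r \<psi> \<psi>'
    using tensor_additive functional_is_endo that by simp
  show "r (\<lambda>z. k \<otimes> \<psi> z) = k \<otimes> r \<psi>"
    if "r \<in> carrier tensor_ring" "k \<in> K" "\<psi> \<in> linear_maps L K K" for r k \<psi>
    using tensor_linear functional_is_endo that by simp
  show "(s \<otimes>\<^bsub>tensor_ring\<^esub> r) \<psi> = \<zero>"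
    if s: "s \<in> carrier tensor_ring" and r: "r \<in> carrier tensor_ring"
      and 0: "\<And>\<psi>. \<psi> \<in> linear_maps L K K \<Longrightarrow> r \<psi> = \<zero>" and \<psi>: "\<psi> \<in> linear_maps L K K" for s r \<psi>
  proof -
    have E: "\<psi> \<in> endos" using functional_is_endo[OF \<psi>] .
    \<comment> \<open>For each y in \<open>L\<close> the shifted map is again a functional, so r
      vanishes at it and the inner map agrees with zero on \<open>L\<close>.\<close>
    have "s (\<lambda>y. r (\<lambda>z. \<psi> (y \<otimes> z))) = s (\<lambda>y. \<zero>)"
    proof (rule tensor_cong[of s "\<lambda>y. r (\<lambda>z. \<psi> (y \<otimes> z))" "\<lambda>y. \<zero>"])
      show "s \<in> tensors" using s by simp
      show "(\<lambda>y. r (\<lambda>z. \<psi> (y \<otimes> z))) \<in> endos" using r tensor_shift_endo[OF _ E] by simp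
      show "r (\<lambda>z. \<psi> (y \<otimes> z)) = \<zero>" if "y \<in> carrier L" for y
        using linear_map_shift[OF stable_base \<psi> that] by (rule 0)
    qed
    then show ?thesis using E s tensor_zero_map by (simp add: tensor_mult)
  qed
qed

section \<open>Transport to a ring on the type of \<open>L\<close>\<close>

lemma infinite_imp_inj_lists:
  assumes "infinite (UNIV :: 'a set)"
  shows "\<exists>f :: ('a \<times> 'a) list \<Rightarrow> 'a. inj f"
proof -
  have "|UNIV \<times> UNIV :: ('a \<times> 'a) set| =o |UNIV :: 'a set|"
    using card_of_Times_same_infinite[OF assms] .
  then obtain p :: "'a \<times> 'a \<Rightarrow> 'a" where p: "inj p"
    using card_of_ordLeq[of "UNIV :: ('a \<times> 'a) set" "UNIV :: 'a set"] ordIso_imp_ordLeq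
    by (auto simp flip: UNIV_Times_UNIV)
  obtain \<nu> :: "nat \<Rightarrow> 'a" where \<nu>: "inj \<nu>" using infinite_countable_subset[OF assms] by blast
  define enc where "enc xs = foldr (\<lambda>x a. p (p x, a)) xs (\<nu> 0)" for xs :: "('a \<times> 'a) list"
  have enc: "xs = ys" if "length xs = length ys" "enc xs = enc ys" for xs ys
    using that by (induction xs ys rule: list_induct2) (auto simp: enc_def dest!: injD[OF p])
  \<comment> \<open>\<open>enc\<close> separates only lists of equal length, so the length is coded
    as well.\<close>
  have "inj (\<lambda>xs. p (\<nu> (length xs), enc xs))"
    by (rule injI) (auto dest!: injD[OF p] injD[OF \<nu>] intro: enc)
  then show ?thesis by blast
qed

lemma (in ring) char_zero_imp_infinite:
  assumes "char_zero R"
  shows "infinite (carrier R)"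
proof
  assume fin: "finite (carrier R)"
  let ?f = "\<lambda>n::nat. [n] \<cdot> \<one>"
  have "range ?f \<subseteq> carrier R" by auto
  then have "finite (range ?f)" using fin finite_subset by blast
  then have "\<not> inj ?f" using finite_imageD by (metis infinite_UNIV_nat)
  then obtain a b where ab: "?f a = ?f b" "a < b" by (metis injI linorder_neqE_nat)
  have "?f a \<oplus> ?f (b - a) = ?f b"
    using ab(2) add.nat_pow_mult[of \<one> a "b - a"] by simp
  then have "?f (b - a) = \<zero>" using ab(1) by (metis add.l_cancel_one add.nat_pow_closed one_closed)
  then show False using assms ab(2) by (auto simp: char_zero_def)
qed

text \<open>A tensor is recovered from any list of pairs that represents it. Choosing one list for
  each tensor and coding it in \<open>'a\<close> is therefore injective.\<close>

lemma (in delta_extension) tensors_inj: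
  assumes "infinite (UNIV :: 'a set)"
  shows "\<exists>g :: (('a \<Rightarrow> 'a) \<Rightarrow> 'a) \<Rightarrow> 'a. inj_on g tensors"
proof -
  obtain f :: "('a \<times> 'a) list \<Rightarrow> 'a" where f: "inj f" using infinite_imp_inj_lists[OF assms] by blast
  define sum where "sum ts = foldr (\<lambda>(x, y) r \<phi>. tens x y \<phi> \<oplus> r \<phi>) ts (\<lambda>\<phi>. \<zero>)" for ts
  have "\<exists>ts. r = sum ts" if "r \<in> tensors" for r
    using that
  proof (induction rule: tensors.induct)
    case zero
    show ?case by (intro exI[of _ "[]"]) (simp add: sum_def)
  next
    case (step x y r)
    then obtain ts where "r = sum ts" by blast
    then show ?case by (intro exI[of _ "(x, y) # ts"]) (simp add: sum_def)
  qed
  then obtain h where h: "\<And>r. r \<in> tensors \<Longrightarrow> r = sum (h r)" by metis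
  have "inj_on (f \<circ> h) tensors" using h injD[OF f] by (intro inj_onI) (metis comp_apply)
  then show ?thesis by blast
qed

text \<open>\<open>S\<close> is a copy of \<open>R\<close> on the type \<open>'r\<close>, where
  normality is available. The inverse isomorphism \<open>h\<close> brings the conclusion back to
  \<open>R\<close>.\<close>

lemma delta_normal_transfer:
  fixes R :: "('c, 'd) ring_scheme" and g :: "'c \<Rightarrow> 'r"
  assumes L: "delta_field L m \<delta>" and K: "subfield K L" and normal: "delta_normal TYPE('r) L K m \<delta>"
    and R: "delta_ring R m \<epsilon>" and g: "inj_on g (carrier R)"
    and s: "\<tau>\<^sub>s \<in> delta_hom m L \<delta> R \<epsilon>" and t: "\<tau>\<^sub>t \<in> delta_hom m L \<delta> R \<epsilon>"
    and K_eq: "\<And>x. x \<in> K \<Longrightarrow> \<tau>\<^sub>s x = \<tau>\<^sub>t x"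
  shows "delta_normal_wrt L m R \<epsilon> \<tau>\<^sub>s \<tau>\<^sub>t"
proof -
  interpret L: delta_field L m \<delta> by fact
  interpret R: delta_ring R m \<epsilon> by fact
  interpret s: ring_hom_cring L R \<tau>\<^sub>s using L.delta_hom_ring_hom_cring[OF R s] .
  interpret t: ring_hom_cring L R \<tau>\<^sub>t using L.delta_hom_ring_hom_cring[OF R t] .
  define S where "S = image_ring g R"
  define h where "h = inv_into (carrier R) g"
  define \<epsilon>' where "\<epsilon>' i x = g (\<epsilon> i (h x))" for i x
  have Scar: "carrier S = g ` carrier R" by (simp add: S_def image_ring_carrier)
  have hg: "h (g x) = x" if "x \<in> carrier R" for x using g that by (simp add: h_def)
  have giso: "g \<in> ring_iso R S" unfolding S_def by (rule inj_imp_image_ring_iso[OF g])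
  \<comment> \<open>The zero of the image ring is already g 0, so the update does not change
    \<open>S\<close>.\<close>
  have "cring (S\<lparr>zero := g \<zero>\<^bsub>R\<^esub>\<rparr>)" by (rule R.ring_iso_imp_img_cring[OF giso])
  moreover have "S\<lparr>zero := g \<zero>\<^bsub>R\<^esub>\<rparr> = S" by (simp add: S_def flip: image_ring_zero)
  ultimately have Scring: "cring S" by simp
  then interpret S: cring S .
  interpret g: ring_hom_cring R S g
    using giso by (intro ring_hom_cring.intro ring_hom_cring_axioms.intro R.is_cring Scring) (simp add: ring_iso_def)
  have hc: "h x \<in> carrier R" if "x \<in> carrier S" for x using that hg by (auto simp: Scar)
  have gh: "g (h x) = x" if "x \<in> carrier S" for x using that hg by (auto simp: Scar)
  interpret h: ring_hom_cring S R h
  proof (intro ring_hom_cring.intro ring_hom_cring_axioms.intro R.is_cring Scring ring_hom_memI)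
    show "h x \<in> carrier R" if "x \<in> carrier S" for x using hc that .
    show "h (x \<otimes>\<^bsub>S\<^esub> y) = h x \<otimes>\<^bsub>R\<^esub> h y" "h (x \<oplus>\<^bsub>S\<^esub> y) = h x \<oplus>\<^bsub>R\<^esub> h y" if "x \<in> carrier S" "y \<in> carrier S" for x y
      using that hg by (auto simp: Scar simp flip: g.hom_mult g.hom_add)
    show "h \<one>\<^bsub>S\<^esub> = \<one>\<^bsub>R\<^esub>" using hg by (simp flip: g.hom_one)
  qed
  have \<epsilon>'c: "\<epsilon>' i x \<in> carrier S" if "i < m" "x \<in> carrier S" for i x
    using that hc by (simp add: \<epsilon>'_def)
  have S: "delta_ring S m \<epsilon>'"
  proof (intro delta_ring.intro delta_ring_axioms.intro Scring)
    show "derivation S (\<epsilon>' i)" if "i < m" for i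
      using that \<epsilon>'c hc gh by (auto simp: derivation_def \<epsilon>'_def R.delta_add R.delta_mult)
    show "\<epsilon>' i (\<epsilon>' j x) = \<epsilon>' j (\<epsilon>' i x)" if "i < m" "j < m" "x \<in> carrier S" for i j x
      using that hc hg R.derivations_commute by (simp add: \<epsilon>'_def)
  qed
  have comp: "g \<circ> \<tau> \<in> delta_hom m L \<delta> S \<epsilon>'" if "\<tau> \<in> delta_hom m L \<delta> R \<epsilon>" for \<tau>
  proof -
    have hom: "\<tau> \<in> ring_hom L R" and d: "\<And>i x. \<lbrakk>i < m; x \<in> carrier L\<rbrakk> \<Longrightarrow> \<tau> (\<delta> i x) = \<epsilon> i (\<tau> x)"
      using that by (auto simp: delta_hom_def)
    have "g \<circ> \<tau> \<in> ring_hom L S" using hom g.homh by (rule ring_hom_trans)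
    then show ?thesis using d hg ring_hom_closed[OF hom] by (simp add: delta_hom_def \<epsilon>'_def)
  qed
  \<comment> \<open>The structure morphism that makes \<open>S\<close> an algebra over
    \<open>K\<close>.\<close>
  have restr: "g \<circ> \<tau>\<^sub>s \<in> delta_hom m (L\<lparr>carrier := K\<rparr>) \<delta> S \<epsilon>'"
  proof -
    have "K \<subseteq> carrier L" using subfieldE(3)[OF K] .
    then show ?thesis using comp[OF s] unfolding delta_hom_def ring_hom_def by (auto simp: subset_iff)
  qed
  have "delta_normal_wrt L m S \<epsilon>' (g \<circ> \<tau>\<^sub>s) (g \<circ> \<tau>\<^sub>t)"
    using normal S comp[OF s] comp[OF t] restr K_eq unfolding delta_normal_def by (metis comp_apply)
  then have *: "g (\<tau>\<^sub>t a) \<in> subring_compositum S ((g \<circ> \<tau>\<^sub>s) ` carrier L) (constants S m \<epsilon>')"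
    if "a \<in> carrier L" for a
    using that unfolding delta_normal_wrt_def by auto
  interpret S': delta_ring S m \<epsilon>' by (rule S)
  interpret gs: ring_hom_cring L S "g \<circ> \<tau>\<^sub>s" using L.delta_hom_ring_hom_cring[OF S comp[OF s]] .
  have im: "subring (\<tau>\<^sub>s ` carrier L) R" "subring ((g \<circ> \<tau>\<^sub>s) ` carrier L) S"
    using ring_hom_ring.img_is_subring[OF ring_hom_ringI2 L.carrier_is_subring]
      L.ring_axioms R.ring_axioms S.ring_axioms s.homh gs.homh by blast+
  have hC: "h d \<in> constants R m \<epsilon>" if "d \<in> constants S m \<epsilon>'" for d
  proof -
    have d: "d \<in> carrier S" "\<And>i. i < m \<Longrightarrow> \<epsilon>' i d = \<zero>\<^bsub>S\<^esub>" using that by (auto simp: constants_def)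
    have "\<epsilon> i (h d) = \<zero>\<^bsub>R\<^esub>" if i: "i < m" for i
    proof -
      have "\<epsilon> i (h d) = h (\<epsilon>' i d)"
        unfolding \<epsilon>'_def using i hc[OF d(1)] by (intro hg[symmetric]) simp
      then show ?thesis by (simp only: d(2)[OF i] h.hom_zero)
    qed
    then show ?thesis using hc d by (simp add: constants_def)
  qed
  have hP: "h p \<in> subring_prod R (\<tau>\<^sub>s ` carrier L) (constants R m \<epsilon>)"
    if "p \<in> subring_prod S ((g \<circ> \<tau>\<^sub>s) ` carrier L) (constants S m \<epsilon>')" for p
    using that subringE(1)[OF im(2)] subringE(1)[OF S'.constants_subring]
  proof (induction p rule: S.subring_prod_induct)
    case zero
    then show ?case
      using R.subring_prod_zero[OF subringE(1)[OF im(1)] subringE(1)[OF R.constants_subring]] by simp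
  next
    case (step a d p)
    have c: "a \<in> carrier S" "d \<in> carrier S" "p \<in> carrier S"
      using step subringE(1)[OF im(2)] subringE(1)[OF S'.constants_subring]
        S.subring_prod_closed by blast+
    have "h a \<in> \<tau>\<^sub>s ` carrier L" using step(1) hg by auto
    then show ?case
      using c step(4) hC[OF step(2)]
        R.subring_prod_step[OF subringE(1)[OF im(1)] subringE(1)[OF R.constants_subring]] by simp
  qed
  show ?thesis unfolding delta_normal_wrt_def
  proof (rule image_subsetI)
    fix a assume a: "a \<in> carrier L"
    \<comment> \<open>With the denominator on the left-hand side, no inverse has to be transported:
      \<open>h\<close> preserves products, units and constants.\<close>
    then have "\<exists>r \<in> subring_prod S ((g \<circ> \<tau>\<^sub>s) ` carrier L) (constants S m \<epsilon>') \<inter> Units S.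
        g (\<tau>\<^sub>t a) \<otimes>\<^bsub>S\<^esub> r \<in> subring_prod S ((g \<circ> \<tau>\<^sub>s) ` carrier L) (constants S m \<epsilon>')"
      using *[OF a] by (subst (asm) S.subring_compositum_iff[OF im(2) S'.constants_subring]) auto
    then obtain r where r: "r \<in> subring_prod S ((g \<circ> \<tau>\<^sub>s) ` carrier L) (constants S m \<epsilon>')" "r \<in> Units S"
      "g (\<tau>\<^sub>t a) \<otimes>\<^bsub>S\<^esub> r \<in> subring_prod S ((g \<circ> \<tau>\<^sub>s) ` carrier L) (constants S m \<epsilon>')" by blast
    have "h (g (\<tau>\<^sub>t a) \<otimes>\<^bsub>S\<^esub> r) = \<tau>\<^sub>t a \<otimes>\<^bsub>R\<^esub> h r"
      using t.hom_closed[OF a] S.Units_closed[OF r(2)] by (simp add: hg)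
    then have "\<tau>\<^sub>t a \<otimes>\<^bsub>R\<^esub> h r \<in> subring_prod R (\<tau>\<^sub>s ` carrier L) (constants R m \<epsilon>)" using hP[OF r(3)] by simp
    then show "\<tau>\<^sub>t a \<in> subring_compositum R (\<tau>\<^sub>s ` carrier L) (constants R m \<epsilon>)"
      using hP[OF r(1)] h.hom_Units[OF r(2)] a
      by (subst R.subring_compositum_iff[OF im(1) R.constants_subring]) auto
  qed
qed

lemma picard_vessiot_imp_normal:
  assumes "delta_field L m \<delta>" "delta_subfield K L m \<delta>" "picard_vessiot L K m \<delta>"
  shows "delta_normal TYPE('r) L K m \<delta>"
  unfolding delta_normal_def using picard_vessiot_imp_normal_wrt[OF assms] by metis

text \<open>The second conjunct makes the result independent of the type in
  \<open>delta_normal\<close>: together with the first, normality tested on rings in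
  \<open>'a\<close> implies normality for rings in any type \<open>'r\<close>.\<close>

theorem theorem2p8:
  fixes L :: "('a, 'b) ring_scheme" and K :: "'a set"
    and m :: nat and \<delta> :: "nat \<Rightarrow> 'a \<Rightarrow> 'a"
  assumes "delta_field L m \<delta>"
    and "delta_subfield K L m \<delta>"
    and "char_zero (L\<lparr>carrier := K\<rparr>)"
    and "algebraically_closed (L\<lparr>carrier := constants (L\<lparr>carrier := K\<rparr>) m \<delta>\<rparr>)"
    and "finitely_delta_generated L K m \<delta>"
    and "constants L m \<delta> = constants (L\<lparr>carrier := K\<rparr>) m \<delta>"
  shows "(picard_vessiot L K m \<delta> \<longleftrightarrow> delta_normal TYPE('a) L K m \<delta>) \<and>
         (picard_vessiot L K m \<delta> \<longrightarrow> delta_normal TYPE('r) L K m \<delta>)"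
proof -
  interpret delta_extension L m \<delta> K
    using assms(1,2) by (intro delta_extension.intro delta_extension_axioms.intro)
  interpret T: tensor_square L m \<delta> K tensor_ring tensor_delta "tens \<one>\<^bsub>L\<^esub>" "\<lambda>x. tens x \<one>\<^bsub>L\<^esub>" "\<lambda>r. r"
    by (rule tensor_ring_is_tensor_square)
  interpret K: field "L\<lparr>carrier := K\<rparr>" using subfield_iff(2)[OF K_subfield] .
  \<comment> \<open>Characteristic zero enters here, to leave room in \<open>'a\<close> for a copy
    of the tensor square.\<close>
  have "infinite (UNIV :: 'a set)"
    using K.char_zero_imp_infinite[OF assms(3)] finite_subset[OF subset_UNIV] by auto
  then obtain g :: "(('a \<Rightarrow> 'a) \<Rightarrow> 'a) \<Rightarrow> 'a" where g: "inj_on g tensors" using tensors_inj by blast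
  have "picard_vessiot L K m \<delta>" if normal: "delta_normal TYPE('a) L K m \<delta>"
  proof (rule T.normal_imp_picard_vessiot[OF _ assms(5,6)])
    show "delta_normal_wrt L m tensor_ring tensor_delta (tens \<one>\<^bsub>L\<^esub>) (\<lambda>x. tens x \<one>\<^bsub>L\<^esub>)"
      by (rule delta_normal_transfer[OF assms(1) K_subfield normal tensor_delta_ring _ tens_right_hom tens_left_hom])
        (use g tens_base in auto)
  qed
  then show ?thesis
    using picard_vessiot_imp_normal[OF assms(1,2), where 'r = 'a]
      picard_vessiot_imp_normal[OF assms(1,2), where 'r = 'r] by blast
qed

end
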